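(* Let $D\subseteq\mathbb{R}^n$ be a triangulable subspace, let $K_1,K_2$ be non-empty closed subsets of $D$, and let $\vec\varphi_1,\vec\varphi_2:D\to\mathbb{R}^k$ be continuous. For $\epsilon>0$ define $\vec\Psi_1^\epsilon,\vec\Psi_2^\epsilon:D\to\mathbb{R}^{k+1}$ by $\vec\Psi_1^\epsilon=(-\lambda^\epsilon_{K_1},\vec\varphi_1)$ and $\vec\Psi_2^\epsilon=(-\lambda^\epsilon_{K_2},\vec\varphi_2)$. Then for every $q\in\mathbb{Z}$, $$D_{match}\left(\rho_{(D,\vec\Psi_1^\epsilon),q},\rho_{(D,\vec\Psi_2^\epsilon),q}\right)\le\max\left\{\frac{d_\triangle(K_1,K_2)}{\mu(B_\epsilon)},\ \|\vec\varphi_1-\vec\varphi_2\|_\infty\right\}.$$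
   Context: Triangulable means homeomorphic to the polyhedron of a finite simplicial complex. $\mu$ is Lebesgue measure on $\mathbb{R}^n$, $B_\epsilon(x)$ the $n$-disk of radius $\epsilon$ centered at $x$, $B_\epsilon=B_\epsilon(\vec 0)$, $\chi_K$ the characteristic function of $K$, and $\lambda^\epsilon_K(x)=\mu(B_\epsilon)^{-1}\int_{B_\epsilon(x)}\chi_K(y)\,dy$. The symmetric difference distance is $d_\triangle(A,B)=\mu((A\cup B)\setminus(A\cap B))$. On $\mathbb{R}^m$, $\vec u\preceq\vec v$ (resp. $\prec$) means $u_i\le v_i$ (resp. $u_i<v_i$) for all $i$; $\|\vec u\|_\infty=\max_i|u_i|$; $\|\vec f\|_\infty=\max_{x}\|\vec f(x)\|_\infty$. Rank invariant: for continuous $\vec f:X\to\mathbb{R}^m$ and $\vec u\prec\vec v$, $\rho_{(X,\vec f),q}(\vec u,\vec v)$ is the rank of $\check H_q(X\langle\vec f\preceq\vec u\rangle)\to\check H_q(X\langle\vec f\preceq\vec v\rangle)$ induced by inclusion, where $X\langle\vec f\preceq\vec u\rangle=\{x:\vec f(x)\preceq\vec u\}$ and $\check H_q$ is Čech homology with coefficients in a fixed field. 1-dimensional matching distance: for continuous $f:X\to\mathbb{R}$ with $\rho=\rho_{(X,f),q}$, a proper cornerpoint is $(s,t)$, $s<t$, with multiplicity $\min_{\epsilon>0,\,s+\epsilon<t-\epsilon}[\rho(s+\epsilon,t-\epsilon)-\rho(s-\epsilon,t-\epsilon)-\rho(s+\epsilon,t+\epsilon)+\rho(s-\epsilon,t+\epsilon)]>0$;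 a cornerpoint at infinity is $(s,\infty)$ with multiplicity $\min_{\epsilon>0,\,s+\epsilon<1/\epsilon}[\rho(s+\epsilon,1/\epsilon)-\rho(s-\epsilon,1/\epsilon)]>0$. The persistence diagram is the multiset of cornerpoints plus all diagonal points counted with infinite multiplicity; $d_{match}$ is the infimum over bijections $\sigma$ between two persistence diagrams of $\sup_p\delta(p,\sigma(p))$, with $\delta((u,v),(u',v'))=\min\{\max\{|u-u'|,|v-v'|\},\max\{\frac{v-u}{2},\frac{v'-u'}{2}\}\}$ (conventions $\infty-\infty=0$, $\infty-a=\infty$, $\infty/2=\infty$). Multidimensional matching distance: $Adm_m=\{(\vec l,\vec b)\in\mathbb{R}^m\times\mathbb{R}^m:l_i>0,\sum l_i^2=1,\sum b_i=0\}$, and $D_{match}(\rho_{(X,\vec f),q},\rho_{(X,\vec g),q})=\sup_{(\vec l,\vec b)\in Adm_m}\min_i l_i\cdot d_{match}(\rho_{(X,F_{(\vec l,\vec b)}),q},\rho_{(X,G_{(\vec l,\vec b)}),q})$ with $F_{(\vec l,\vec b)}(x)=\max_i\frac{f_i(x)-b_i}{l_i}$, $G_{(\vec l,\vec b)}(x)=\max_i\frac{g_i(x)-b_i}{l_i}$. *)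

theory Defs
  imports "HOL-Analysis.Analysis" "HOL-Library.Extended_Nat"
begin

text \<open>Finite abstract simplicial complex on vertices in nat, and its standard geometric
  realization (barycentric coordinates) in nat => real with the product topology.\<close>

definition abs_simplicial_complex :: "nat set set \<Rightarrow> bool" where
  "abs_simplicial_complex S \<longleftrightarrow> finite S \<and> (\<forall>\<sigma>\<in>S. finite \<sigma> \<and> \<sigma> \<noteq> {}) \<and>
     (\<forall>\<sigma>\<in>S. \<forall>\<tau>. \<tau> \<subseteq> \<sigma> \<and> \<tau> \<noteq> {} \<longrightarrow> \<tau> \<in> S)"

definition polyhedron_of :: "nat set set \<Rightarrow> (nat \<Rightarrow> real) set" where
  "polyhedron_of S = {p. (\<forall>i. 0 \<le> p i) \<and> {i. p i \<noteq> 0} \<in> S \<and> (\<Sum>i\<in>{i. p i \<noteq> 0}. p i) = 1}"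

definition triangulable :: "'a::topological_space set \<Rightarrow> bool" where
  "triangulable X \<longleftrightarrow> (\<exists>S. abs_simplicial_complex S \<and> X homeomorphic polyhedron_of S)"

text \<open>Open covers of a subspace X (traces of ambient open sets), their nerves relative to X,
  ordered simplicial chains of the nerve with coefficients in 'f.\<close>

definition is_cover :: "'a::topological_space set \<Rightarrow> 'a set set \<Rightarrow> bool" where
  "is_cover X U \<longleftrightarrow> (\<forall>u\<in>U. open u) \<and> X \<subseteq> \<Union>U"

definition nerve_simplex :: "'a set \<Rightarrow> 'a set set \<Rightarrow> 'a set list \<Rightarrow> bool" where
  "nerve_simplex X U l \<longleftrightarrow> l \<noteq> [] \<and> set l \<subseteq> U \<and> X \<inter> \<Inter>(set l) \<noteq> {}"

definition chains :: "'a set \<Rightarrow> 'a set set \<Rightarrow> int \<Rightarrow> ('a set list \<Rightarrow> 'f::field) set" where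
  "chains X U q = {c. finite {l. c l \<noteq> 0} \<and>
      (\<forall>l. c l \<noteq> 0 \<longrightarrow> nerve_simplex X U l \<and> int (length l) = q + 1)}"

definition bd :: "('b list \<Rightarrow> 'f::field) \<Rightarrow> ('b list \<Rightarrow> 'f)" where
  "bd c m = (\<Sum>l\<in>{l. c l \<noteq> 0}. \<Sum>i<length l.
      if take i l @ drop (Suc i) l = m then (-1) ^ i * c l else 0)"

definition cycles :: "'a set \<Rightarrow> 'a set set \<Rightarrow> int \<Rightarrow> ('a set list \<Rightarrow> 'f::field) set" where
  "cycles X U q = {c \<in> chains X U q. \<forall>m. m \<noteq> [] \<longrightarrow> bd c m = 0}"

definition boundaries :: "'a set \<Rightarrow> 'a set set \<Rightarrow> int \<Rightarrow> ('a set list \<Rightarrow> 'f::field) set" where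
  "boundaries X U q = bd ` chains X U (q + 1)"

definition push :: "('b \<Rightarrow> 'b) \<Rightarrow> ('b list \<Rightarrow> 'f::field) \<Rightarrow> ('b list \<Rightarrow> 'f)" where
  "push \<pi> c m = (\<Sum>l\<in>{l. c l \<noteq> 0}. if map \<pi> l = m then c l else 0)"

definition is_refinement :: "'a set \<Rightarrow> 'a set set \<Rightarrow> 'a set set \<Rightarrow> ('a set \<Rightarrow> 'a set) \<Rightarrow> bool" where
  "is_refinement X U V \<pi> \<longleftrightarrow> (\<forall>u\<in>U. \<pi> u \<in> V \<and> X \<inter> u \<subseteq> \<pi> u)"

text \<open>Representatives of elements of the inverse limit (Cech homology of X in degree q):
  a family of cycles, one per cover, compatible under all refinement projections up to
  boundaries.\<close>

definition cech_cycles :: "'a::topological_space set \<Rightarrow> int \<Rightarrow> ('a set set \<Rightarrow> 'a set list \<Rightarrow> 'f::field) set" where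
  "cech_cycles X q = {z. \<forall>U. is_cover X U \<longrightarrow> z U \<in> cycles X U q \<and>
      (\<forall>V \<pi>. is_cover X V \<and> is_refinement X U V \<pi> \<longrightarrow>
          (\<lambda>m. push \<pi> (z U) m - z V m) \<in> boundaries X V q)}"

text \<open>Rank of the map on Cech homology induced by inclusion A \<subseteq> B:
  dimension of the image (supremum of sizes of families whose images are linearly independent).\<close>

definition cech_rank :: "'f::field itself \<Rightarrow> 'a::topological_space set \<Rightarrow> 'a set \<Rightarrow> int \<Rightarrow> enat" where
  "cech_rank F A B q = Sup {enat n | n. \<exists>zs :: nat \<Rightarrow> 'a set set \<Rightarrow> 'a set list \<Rightarrow> 'f.
      (\<forall>j<n. zs j \<in> cech_cycles A q) \<and>
      (\<forall>c :: nat \<Rightarrow> 'f. (\<exists>j<n. c j \<noteq> 0) \<longrightarrow>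
          (\<exists>V. is_cover B V \<and> (\<lambda>m. \<Sum>j<n. c j * zs j V m) \<notin> boundaries B V q))}"

definition rank1 :: "'f::field itself \<Rightarrow> 'a::topological_space set \<Rightarrow> ('a \<Rightarrow> real) \<Rightarrow> int \<Rightarrow> real \<Rightarrow> real \<Rightarrow> enat" where
  "rank1 F X f q u v = cech_rank F {x\<in>X. f x \<le> u} {x\<in>X. f x \<le> v} q"

text \<open>Integer value of a rank (ranks are finite in the setting of the paper; \<infinity> is sent to 0).\<close>
definition rk_int :: "enat \<Rightarrow> int" where
  "rk_int r = (case r of enat n \<Rightarrow> int n | \<infinity> \<Rightarrow> 0)"

definition mult_proper :: "'f::field itself \<Rightarrow> 'a::topological_space set \<Rightarrow> ('a \<Rightarrow> real) \<Rightarrow> int \<Rightarrow> real \<Rightarrow> real \<Rightarrow> nat" where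
  "mult_proper F X f q s t = Inf {nat (rk_int (rank1 F X f q (s+e) (t-e)) - rk_int (rank1 F X f q (s-e) (t-e))
        - rk_int (rank1 F X f q (s+e) (t+e)) + rk_int (rank1 F X f q (s-e) (t+e))) | e. e > 0 \<and> s + e < t - e}"

definition mult_inf :: "'f::field itself \<Rightarrow> 'a::topological_space set \<Rightarrow> ('a \<Rightarrow> real) \<Rightarrow> int \<Rightarrow> real \<Rightarrow> nat" where
  "mult_inf F X f q s = Inf {nat (rk_int (rank1 F X f q (s+e) (1/e)) - rk_int (rank1 F X f q (s-e) (1/e)))
        | e. e > 0 \<and> s + e < 1/e}"

text \<open>Persistence diagram as a set of labelled points (point, copy index): each cornerpoint
  appears as many times as its multiplicity, each diagonal point infinitely (countably) often.\<close>

definition pdiag :: "'f::field itself \<Rightarrow> 'a::topological_space set \<Rightarrow> ('a \<Rightarrow> real) \<Rightarrow> int \<Rightarrow> ((real \<times> ereal) \<times> nat) set" where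
  "pdiag F X f q =
     {((s, ereal t), i) | s t i. s < t \<and> i < mult_proper F X f q s t}
   \<union> {((s, \<infinity>), i) | s i. i < mult_inf F X f q s}
   \<union> {((x, ereal x), i) | x i. True}"

definition ediff_abs :: "ereal \<Rightarrow> ereal \<Rightarrow> ereal" where
  "ediff_abs v v' = (if v = \<infinity> \<and> v' = \<infinity> then 0 else \<bar>v - v'\<bar>)"

definition pdelta :: "real \<times> ereal \<Rightarrow> real \<times> ereal \<Rightarrow> ereal" where
  "pdelta p p' = (case (p, p') of ((u, v), (u', v')) \<Rightarrow>
      min (max (ereal \<bar>u - u'\<bar>) (ediff_abs v v')) (max ((v - ereal u) / 2) ((v' - ereal u') / 2)))"

definition dmatch :: "((real \<times> ereal) \<times> nat) set \<Rightarrow> ((real \<times> ereal) \<times> nat) set \<Rightarrow> ereal" where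
  "dmatch P Q = (INF \<sigma>\<in>{\<sigma>. bij_betw \<sigma> P Q}. SUP p\<in>P. pdelta (fst p) (fst (\<sigma> p)))"

definition Adm :: "((real^'m) \<times> (real^'m)) set" where
  "Adm = {(l, b). (\<forall>i. l $ i > 0) \<and> (\<Sum>i\<in>UNIV. (l $ i)^2) = 1 \<and> (\<Sum>i\<in>UNIV. b $ i) = 0}"

definition Fred :: "('a \<Rightarrow> real^'m) \<Rightarrow> real^'m \<Rightarrow> real^'m \<Rightarrow> 'a \<Rightarrow> real" where
  "Fred f l b x = Max (range (\<lambda>i. (f x $ i - b $ i) / l $ i))"

definition Dmatch :: "'f::field itself \<Rightarrow> 'a::topological_space set \<Rightarrow> ('a \<Rightarrow> real^'m) \<Rightarrow> ('a \<Rightarrow> real^'m) \<Rightarrow> int \<Rightarrow> ereal" where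
  "Dmatch F X f g q = (SUP lb\<in>Adm. ereal (Min (range (\<lambda>i. fst lb $ i))) *
      dmatch (pdiag F X (Fred f (fst lb) (snd lb)) q) (pdiag F X (Fred g (fst lb) (snd lb)) q))"

definition lam :: "real \<Rightarrow> (real^'n) set \<Rightarrow> real^'n \<Rightarrow> real" where
  "lam e K x = integral (cball x e) (indicator K :: real^'n \<Rightarrow> real) / measure lebesgue (cball (0::real^'n) e)"

definition dtri :: "(real^'n) set \<Rightarrow> (real^'n) set \<Rightarrow> real" where
  "dtri A B = measure lebesgue ((A \<union> B) - (A \<inter> B))"

definition Psi :: "real \<Rightarrow> (real^'n) set \<Rightarrow> (real^'n \<Rightarrow> real^'k) \<Rightarrow> real^'n \<Rightarrow> real^('k option)" where
  "Psi e K \<phi> x = (\<chi> i. case i of None \<Rightarrow> - lam e K x | Some j \<Rightarrow> \<phi> x $ j)"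

definition supnorm :: "'a set \<Rightarrow> ('a \<Rightarrow> real^'k) \<Rightarrow> ('a \<Rightarrow> real^'k) \<Rightarrow> real" where
  "supnorm D f g = Sup ((\<lambda>x. Max (range (\<lambda>i. \<bar>f x $ i - g x $ i\<bar>))) ` D)"

end

theory Submission
  imports Defs "HOL-Library.Function_Algebras" "HOL-Library.Poly_Mapping"
begin

text \<open>
  A compact polyhedron \<open>D\<close> is a neighbourhood retract of the ambient space, so small simplices
  with vertices in a sublevel set can be filled in linearly, subdivided and retracted into any
  larger sublevel set. Hence a Cech cycle of \<open>{f \<le> u}\<close> that vanishes on one fixed finite cover
  dies in \<open>{f \<le> v}\<close> for \<open>u < v\<close>, and all ranks are finite. For a rectangle \<open>a < b < c < d\<close> the
  alternating sum of ranks is the dimension of a single space, namely of the cycles of \<open>{f \<le> b}\<close>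
  that die in \<open>{f \<le> d}\<close>, modulo those coming from \<open>{f \<le> a}\<close> and those dying in \<open>{f \<le> c}\<close>. This
  dimension only grows when a perturbation of \<open>f\<close> of size \<open>\<epsilon>\<close> is compensated by enlarging the
  rectangle by \<open>\<epsilon>\<close>. Close functions therefore have close corner points, and following the corner
  points along the segment from \<open>f\<close> to \<open>g\<close> gives a matching of cost at most the supremum norm of
  \<open>f - g\<close>. The theorem follows, since the reduction along \<open>(l, b)\<close> is Lipschitz with constant
  \<open>1 / min l\<close> and \<open>\<lambda>\<close> changes by at most the measure of the symmetric difference divided by the
  measure of the ball.
\<close>

section \<open>Dimension modulo a subspace\<close>

text \<open>Inclusion of sublevel sets acts as the identity on families indexed by all covers,
  because covers consist of ambient open sets. Cycle spaces and spaces of dying families are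
  therefore nested subspaces of one vector space, and stability of ranks needs only that the
  dimension of a subquotient is monotone; no quotient and no inverse limit is formed. Finiteness is
  what makes this usable: multiplicities are alternating sums of integers, and \<open>rk_int\<close>
  sends an infinite rank to 0.

  The combinatorial obstacle is that two functions at distance \<epsilon> are matched directly only
  if \<epsilon> is small against the distances between the corner points of one of them, and corner
  points may accumulate at the diagonal. This forces both the threshold on persistence and the
  compactness argument along the segment. The bound is reached up to an arbitrary \<kappa> > 0, half
  of it spent on the threshold and half on a strict gap between interleaving and matching
  parameters.\<close>

lemma dependent_combination:
  fixes a :: "nat \<Rightarrow> 'i \<Rightarrow> 'f::field"
  assumes "finite S" "card S < n"
  shows "\<exists>c. (\<exists>j<n. c j \<noteq> 0) \<and> (\<forall>s\<in>S. (\<Sum>j<n. c j * a j s) = 0)"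
  using assms
proof (induction S arbitrary: n a rule: finite_induct)
  case empty
  then show ?case by (intro exI[of _ "\<lambda>_. 1"]) auto
next
  case (insert s S)
  then obtain n' where n: "n = Suc n'" by (cases n) auto
  show ?case
  proof (cases "\<forall>j<n. a j s = 0")
    case True
    from insert.IH[of n a] insert.prems insert.hyps obtain c where
      "\<exists>j<n. c j \<noteq> 0" "\<forall>s\<in>S. (\<Sum>j<n. c j * a j s) = 0" by auto
    with True show ?thesis by (intro exI[of _ c]) auto
  next
    case False
    then obtain k where k: "k < n" "a k s \<noteq> 0" by auto
    \<comment> \<open>Elimination: \<open>k\<close> is the pivot unknown, \<open>\<tau>\<close>
      enumerates the others, and \<open>a'\<close> is the system after the pivot equation
      \<open>s\<close> has been used up.\<close>
    define \<tau> where "\<tau> = (\<lambda>j. if j < k then j else Suc j)"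
    have bij: "bij_betw \<tau> {..<n'} ({..<n} - {k})"
    proof (rule bij_betwI[where g = "\<lambda>j. if j < k then j else j - 1"])
      show "\<tau> \<in> {..<n'} \<rightarrow> {..<n} - {k}" using k n by (auto simp: \<tau>_def)
      show "(\<lambda>j. if j < k then j else j - 1) \<in> {..<n} - {k} \<rightarrow> {..<n'}"
        using k n by (auto simp: Pi_iff)
    qed (auto simp: \<tau>_def)
    define a' where "a' = (\<lambda>j x. a (\<tau> j) x - a (\<tau> j) s / a k s * a k x)"
    from insert.IH[of n' a'] insert.prems insert.hyps n obtain c where
      c: "\<exists>j<n'. c j \<noteq> 0" "\<forall>x\<in>S. (\<Sum>j<n'. c j * a' j x) = 0" by auto
    \<comment> \<open>Back substitution: the coefficient at \<open>k\<close> is the one that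
      equation \<open>s\<close> forces.\<close>
    define d where "d = (\<lambda>j. if j = k then - (\<Sum>j<n'. c j * (a (\<tau> j) s / a k s))
       else c (if j < k then j else j - 1))"
    have d\<tau>: "d (\<tau> j) = c j" for j by (auto simp: d_def \<tau>_def)
    have sum: "(\<Sum>j<n. d j * a j x) = (\<Sum>j<n'. c j * a' j x)" for x
    proof -
      have "(\<Sum>j<n. d j * a j x) = d k * a k x + (\<Sum>j\<in>{..<n}-{k}. d j * a j x)"
        using k by (subst sum.remove[of _ k]) auto
      also have "(\<Sum>j\<in>{..<n}-{k}. d j * a j x) = (\<Sum>j<n'. d (\<tau> j) * a (\<tau> j) x)"
        using sum.reindex_bij_betw[OF bij, of "\<lambda>j. d j * a j x"] by simp
      also have "d k * a k x + \<dots> = (\<Sum>j<n'. c j * a' j x)"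
        unfolding d\<tau> by (simp add: a'_def d_def algebra_simps sum_subtractf sum_distrib_left)
      finally show ?thesis .
    qed
    have "a' j s = 0" for j using k by (simp add: a'_def)
    then have "\<forall>x\<in>insert s S. (\<Sum>j<n. d j * a j x) = 0" using c sum by auto
    moreover from c obtain j where "j < n'" "c j \<noteq> 0" by auto
    then have "\<exists>j<n. d j \<noteq> 0" using d\<tau>[of j] bij
      by (intro exI[of _ "\<tau> j"]) (auto simp: bij_betw_def)
    ultimately show ?thesis by blast
  qed
qed

locale mod_dimension = vector_space scale
  for scale :: "'f::field \<Rightarrow> 'v::ab_group_add \<Rightarrow> 'v"  (infixr "\<odot>" 75)
begin

definition indep_mod :: "'v set \<Rightarrow> nat \<Rightarrow> (nat \<Rightarrow> 'v) \<Rightarrow> bool" where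
  "indep_mod N n z \<longleftrightarrow> (\<forall>c. (\<exists>j<n. c j \<noteq> 0) \<longrightarrow> (\<Sum>j<n. c j \<odot> z j) \<notin> N)"

text \<open>For subspaces this is the dimension of \<open>X / (X \<inter> N)\<close>. Independent
  families instead of a quotient agree with the shape of \<open>cech_rank\<close>, and
  \<open>enat\<close> lets the value be infinite.\<close>

definition dim_mod :: "'v set \<Rightarrow> 'v set \<Rightarrow> enat" where
  "dim_mod X N = Sup {enat n | n. \<exists>z. (\<forall>j<n. z j \<in> X) \<and> indep_mod N n z}"

lemma indep_mod_mono: "indep_mod N n z \<Longrightarrow> N' \<subseteq> N \<Longrightarrow> indep_mod N' n z"
  by (auto simp: indep_mod_def)

lemma dim_mod_mono:
  assumes "X \<subseteq> X'" "N' \<subseteq> N"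
  shows "dim_mod X N \<le> dim_mod X' N'"
  unfolding dim_mod_def using assms
  by (intro Sup_subset_mono) (blast intro: indep_mod_mono)

lemma dim_mod_ge: "(\<And>j. j < n \<Longrightarrow> z j \<in> X) \<Longrightarrow> indep_mod N n z \<Longrightarrow> enat n \<le> dim_mod X N"
  unfolding dim_mod_def by (rule Sup_upper) auto

lemma dim_mod_le:
  assumes "\<And>n z. (\<And>j. j < n \<Longrightarrow> z j \<in> X) \<Longrightarrow> indep_mod N n z \<Longrightarrow> enat n \<le> k"
  shows "dim_mod X N \<le> k"
  unfolding dim_mod_def by (rule Sup_least) (use assms in auto)

lemma dim_mod_attained:
  assumes "dim_mod X N = enat n"
  obtains z where "\<And>j. j < n \<Longrightarrow> z j \<in> X" "indep_mod N n z"
proof -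
  let ?S = "{n. \<exists>z. (\<forall>j<n. z j \<in> X) \<and> indep_mod N n z}"
  have 0: "0 \<in> ?S" by (auto simp: indep_mod_def)
  have fin: "finite ?S"
  proof (rule finite_subset)
    show "?S \<subseteq> {..n}"
    proof
      fix m assume "m \<in> ?S"
      then obtain z where "\<forall>j<m. z j \<in> X" "indep_mod N m z" by auto
      then have "enat m \<le> dim_mod X N" by (intro dim_mod_ge[of _ z]) auto
      then show "m \<in> {..n}" using assms by simp
    qed
  qed simp
  have "dim_mod X N \<le> enat (Max ?S)"
    by (rule dim_mod_le) (use fin in \<open>auto intro!: Max_ge\<close>)
  then have 1: "n \<le> Max ?S" using assms by simp
  have 2: "Max ?S \<in> ?S" using fin 0 by (intro Max_in) auto
  then obtain z where "\<forall>j<Max ?S. z j \<in> X" "indep_mod N (Max ?S) z" by auto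
  then have "enat (Max ?S) \<le> dim_mod X N" by (intro dim_mod_ge[of _ z]) auto
  then have "Max ?S \<le> n" using assms by simp
  with 1 2 have "n \<in> ?S" by simp
  then show ?thesis using that by auto
qed

lemma dim_mod_zero: "X \<subseteq> N \<Longrightarrow> subspace N \<Longrightarrow> dim_mod X N = 0"
proof -
  assume *: "X \<subseteq> N" "subspace N"
  have "dim_mod X N \<le> 0"
  proof (rule dim_mod_le)
    fix n z assume z: "\<And>j. j < n \<Longrightarrow> z j \<in> X" "indep_mod N n z"
    have "(\<Sum>j<n. 1 \<odot> z j) \<in> N" using z * by (intro subspace_sum subspace_scale) auto
    then have "\<not> (\<exists>j<n. (1::'f) \<noteq> 0)" using z(2)[unfolded indep_mod_def, rule_format, of "\<lambda>_. 1"]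
      by blast
    then have "n = 0" by (cases n) auto
    then show "enat n \<le> 0" by (simp add: zero_enat_def)
  qed
  then show ?thesis by simp
qed

lemma indep_mod_extend:
  assumes "indep_mod N n z" "subspace N" "\<And>c. x - (\<Sum>j<n. c j \<odot> z j) \<notin> N"
  shows "indep_mod N (Suc n) (z(n := x))"
  unfolding indep_mod_def
proof (intro allI impI notI)
  fix c assume c: "\<exists>j<Suc n. c j \<noteq> 0" "(\<Sum>j<Suc n. c j \<odot> (z(n := x)) j) \<in> N"
  have eq: "(\<Sum>j<Suc n. c j \<odot> (z(n := x)) j) = (\<Sum>j<n. c j \<odot> z j) + c n \<odot> x"
    by (auto intro!: sum.cong)
  show False
  proof (cases "c n = 0")
    case True
    with c eq assms(1) show False unfolding indep_mod_def
      by (metis add.right_neutral less_SucE scale_zero_left)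
  next
    case False
    have "(1 / c n) \<odot> ((\<Sum>j<n. c j \<odot> z j) + c n \<odot> x) \<in> N"
      using c(2) eq assms(2) subspace_scale by metis
    also have "(1 / c n) \<odot> ((\<Sum>j<n. c j \<odot> z j) + c n \<odot> x) = x - (\<Sum>j<n. (- c j / c n) \<odot> z j)"
      using False by (simp add: scale_right_distrib scale_sum_right sum_negf scale_minus_left)
    finally show False using assms(3)[of "\<lambda>j. - c j / c n"] by simp
  qed
qed

lemma dim_mod_spanning:
  assumes "dim_mod X N = enat n" "\<And>j. j < n \<Longrightarrow> z j \<in> X" "indep_mod N n z" "subspace N" "x \<in> X"
  shows "\<exists>c. x - (\<Sum>j<n. c j \<odot> z j) \<in> N"
proof (rule ccontr)
  assume "\<nexists>c. x - (\<Sum>j<n. c j \<odot> z j) \<in> N"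
  then have "\<And>c. x - (\<Sum>j<n. c j \<odot> z j) \<notin> N" by auto
  from indep_mod_extend[OF assms(3,4) this] have "enat (Suc n) \<le> dim_mod X N"
    using assms by (intro dim_mod_ge) auto
  then show False using assms by simp
qed

text \<open>Additivity for \<open>N \<subseteq> M\<close>: a maximal family of \<open>X\<close>
  modulo \<open>M\<close>, followed by a maximal family of \<open>X \<inter> M\<close> modulo
  \<open>N\<close>, is independent modulo \<open>N\<close> and spans \<open>X\<close> modulo
  \<open>N\<close>. Finiteness supplies the maximal families.\<close>

lemma dim_mod_add:
  assumes "subspace X" "subspace N" "subspace M" "N \<subseteq> M" "dim_mod X N \<noteq> \<infinity>"
  shows "dim_mod X N = dim_mod X M + dim_mod (X \<inter> M) N"
proof -
  have "dim_mod X M \<le> dim_mod X N" "dim_mod (X \<inter> M) N \<le> dim_mod X N"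
    using assms by (auto intro!: dim_mod_mono)
  then obtain m k where m: "dim_mod X M = enat m" and k: "dim_mod (X \<inter> M) N = enat k"
    using assms(5) by (metis enat_ord_simps(5) not_infinity_eq)
  obtain x where x: "\<And>j. j < m \<Longrightarrow> x j \<in> X" "indep_mod M m x" using dim_mod_attained[OF m] by blast
  obtain y where y: "\<And>j. j < k \<Longrightarrow> y j \<in> X \<inter> M" "indep_mod N k y" using dim_mod_attained[OF k]
    by blast
  define w where "w = (\<lambda>j. if j < m then x j else y (j - m))"
  have split: "(\<Sum>j<m+k'. c j \<odot> w j) = (\<Sum>j<m. c j \<odot> x j) + (\<Sum>j<k'. c (m + j) \<odot> y j)" for c k'
    by (induction k') (simp_all add: w_def add.assoc)
  have yM: "(\<Sum>j<k. c j \<odot> y j) \<in> M" for c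
    using y assms(3) by (intro subspace_sum subspace_scale) auto
  have "enat (m + k) \<le> dim_mod X N"
  proof (rule dim_mod_ge)
    show "w j \<in> X" if "j < m + k" for j using that x y by (auto simp: w_def)
    show "indep_mod N (m + k) w" unfolding indep_mod_def
    proof (intro allI impI notI)
      fix c assume c: "\<exists>j<m+k. c j \<noteq> 0" "(\<Sum>j<m+k. c j \<odot> w j) \<in> N"
      have "(\<Sum>j<m. c j \<odot> x j) = (\<Sum>j<m+k. c j \<odot> w j) - (\<Sum>j<k. c (m + j) \<odot> y j)" by (simp add: split)
      then have "(\<Sum>j<m. c j \<odot> x j) \<in> M"
        using subspace_diff[OF assms(3) _ yM[of "\<lambda>j. c (m+j)"]] c(2) assms(4) by auto
      then have c0: "\<forall>j<m. c j = 0" using x(2) by (auto simp: indep_mod_def)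
      then have "(\<Sum>j<k. c (m + j) \<odot> y j) \<in> N" using c(2) split[of c] by simp
      then have "\<forall>j<k. c (m + j) = 0"
        using y(2)[unfolded indep_mod_def, rule_format, of "\<lambda>j. c (m+j)"] by auto
      then show False using c(1) c0 by (metis add_diff_inverse_nat nat_add_left_cancel_less)
    qed
  qed
  moreover have "dim_mod X N \<le> enat (m + k)"
  proof (rule dim_mod_le)
    fix n z assume z: "\<And>j. j < n \<Longrightarrow> z j \<in> X" "indep_mod N n z"
    have "\<exists>c. z j - (\<Sum>i<m+k. c i \<odot> w i) \<in> N" if jn: "j < n" for j
    proof -
      obtain c1 where c1: "z j - (\<Sum>i<m. c1 i \<odot> x i) \<in> M"
        using dim_mod_spanning[OF m x(1) x(2) assms(3) z(1)[OF jn]] by auto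
      have "z j - (\<Sum>i<m. c1 i \<odot> x i) \<in> X \<inter> M"
        using c1 z jn x assms(1) by (auto intro!: subspace_diff subspace_sum subspace_scale)
      then obtain c2 where c2: "z j - (\<Sum>i<m. c1 i \<odot> x i) - (\<Sum>i<k. c2 i \<odot> y i) \<in> N"
        using dim_mod_spanning[OF k y(1) y(2) assms(2)] by meson
      show ?thesis
        by (rule exI[of _ "\<lambda>i. if i < m then c1 i else c2 (i - m)"])
          (use c2 in \<open>simp only: split diff_diff_eq\<close>, simp)
    qed
    then obtain C where C: "\<And>j. j < n \<Longrightarrow> z j - (\<Sum>i<m+k. C j i \<odot> w i) \<in> N" by metis
    show "enat n \<le> enat (m + k)"
    proof (rule ccontr)
      assume "\<not> enat n \<le> enat (m + k)"
      then have "card {..<m+k} < n" by simp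
      \<comment> \<open>With more than \<open>m + k\<close> vectors the coordinate rows
        \<open>C j\<close> satisfy a linear relation, which then carries over to the
        \<open>z j\<close> modulo \<open>N\<close>.\<close>
      from dependent_combination[OF _ this, of C] obtain d where
        d: "\<exists>j<n. d j \<noteq> 0" "\<forall>i<m+k. (\<Sum>j<n. d j * C j i) = 0" by auto
      have "(\<Sum>j<n. d j \<odot> (z j - (\<Sum>i<m+k. C j i \<odot> w i))) \<in> N"
        using C assms(2) by (intro subspace_sum subspace_scale) auto
      also have "(\<Sum>j<n. d j \<odot> (z j - (\<Sum>i<m+k. C j i \<odot> w i))) =
          (\<Sum>j<n. d j \<odot> z j) - (\<Sum>j<n. \<Sum>i<m+k. (d j * C j i) \<odot> w i)"
        by (simp add: scale_right_diff_distrib scale_sum_right sum_subtractf)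
      also have "(\<Sum>j<n. \<Sum>i<m+k. (d j * C j i) \<odot> w i) = (\<Sum>i<m+k. (\<Sum>j<n. d j * C j i) \<odot> w i)"
        by (subst sum.swap) (simp add: scale_sum_left)
      also have "\<dots> = 0" using d by simp
      finally show False using z(2) d(1) by (auto simp: indep_mod_def)
    qed
  qed
  ultimately show ?thesis using m k by simp
qed

lemma subspace_set_plus:
  assumes "subspace X" "subspace Y"
  shows "subspace {x + y | x y. x \<in> X \<and> y \<in> Y}"
  using subspace_sums[OF assms] .

text \<open>Second isomorphism theorem: summands from \<open>Y \<subseteq> N\<close> do not change
  classes modulo \<open>N\<close>, so \<open>X' + Y\<close> and \<open>X'\<close> have the same
  dimension.\<close>

lemma dim_mod_absorb:
  assumes "subspace X" "subspace N" "subspace Y" "Y \<subseteq> N" "X' \<subseteq> X"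
    "X \<subseteq> {x + y | x y. x \<in> X' \<and> y \<in> Y}"
  shows "dim_mod X N = dim_mod X' N"
proof (rule order_antisym)
  show "dim_mod X' N \<le> dim_mod X N" using assms by (auto intro!: dim_mod_mono)
  show "dim_mod X N \<le> dim_mod X' N"
  proof (rule dim_mod_le)
    fix n z assume z: "\<And>j. j < n \<Longrightarrow> z j \<in> X" "indep_mod N n z"
    have "\<exists>z'. z' \<in> X' \<and> z j - z' \<in> N" if "j < n" for j
      using z(1)[OF that] assms by force
    then obtain z' where z': "\<And>j. j < n \<Longrightarrow> z' j \<in> X'" "\<And>j. j < n \<Longrightarrow> z j - z' j \<in> N" by metis
    show "enat n \<le> dim_mod X' N"
    proof (rule dim_mod_ge)
      show "z' j \<in> X'" if "j < n" for j using z' that by blast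
      show "indep_mod N n z'" unfolding indep_mod_def
      proof (intro allI impI notI)
        fix c assume c: "\<exists>j<n. c j \<noteq> 0" "(\<Sum>j<n. c j \<odot> z' j) \<in> N"
        have "(\<Sum>j<n. c j \<odot> (z j - z' j)) \<in> N"
          using z' assms(2) by (intro subspace_sum subspace_scale) auto
        then have "(\<Sum>j<n. c j \<odot> z' j) + (\<Sum>j<n. c j \<odot> (z j - z' j)) \<in> N"
          using c assms subspace_add by blast
        then have "(\<Sum>j<n. c j \<odot> z j) \<in> N" by (simp add: scale_right_diff_distrib sum_subtractf)
        then show False using z(2) c by (auto simp: indep_mod_def)
      qed
    qed
  qed
qed

text \<open>The last term consists of what is present in \<open>ZB\<close> but not in
  \<open>ZA\<close> and dies in \<open>ND\<close> but not in \<open>NC\<close>. Filtering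
  \<open>ZB\<close> by \<open>ZA + NC \<subseteq> ZA + ND\<close> and applying additivity on every
  step gives the identity; it is written with sums because subtraction is not faithful on
  \<open>enat\<close>.\<close>

lemma dim_mod_box:
  assumes "subspace ZA" "subspace ZB" "subspace NC" "subspace ND" "ZA \<subseteq> ZB" "NC \<subseteq> ND"
    and "dim_mod ZB NC \<noteq> \<infinity>"
  shows "dim_mod ZB NC + dim_mod ZA ND =
     dim_mod ZA NC + dim_mod ZB ND + dim_mod (ZB \<inter> ND) {x + y | x y. x \<in> ZA \<and> y \<in> NC}"
proof -
  let ?C = "{x + y | x y. x \<in> ZA \<and> y \<in> NC}" and ?D = "{x + y | x y. x \<in> ZA \<and> y \<in> ND}"
  have sC: "subspace ?C" and sD: "subspace ?D" using assms by (auto intro: subspace_set_plus)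
  have CD: "?C \<subseteq> ?D" using assms by blast
  have sum_left: "P \<subseteq> {x + y | x y. x \<in> P \<and> y \<in> Q}" if "subspace Q" for P Q
    using subspace_0[OF that] by force
  have sum_right: "Q \<subseteq> {x + y | x y. x \<in> P \<and> y \<in> Q}" if "subspace P" for P Q
    using subspace_0[OF that] by force
  note NC = sum_right[OF assms(1), of NC] and ND = sum_right[OF assms(1), of ND]
    and ZC = sum_left[OF assms(3), of ZA] and ZD = sum_left[OF assms(4), of ZA]
  have le: "dim_mod ZB ND \<le> dim_mod ZB NC" using assms by (intro dim_mod_mono) auto
  then have fD: "dim_mod ZB ND \<noteq> \<infinity>" using assms(7) by (metis enat_ord_simps(5))
  have "dim_mod ZB ?C \<le> dim_mod ZB NC" using NC by (intro dim_mod_mono) auto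
  then have fC: "dim_mod ZB ?C \<noteq> \<infinity>" using assms(7) by (metis enat_ord_simps(5))
  have 1: "dim_mod ZB NC = dim_mod ZB ?C + dim_mod (ZB \<inter> ?C) NC"
    using assms sC NC by (intro dim_mod_add) auto
  have 2: "dim_mod (ZB \<inter> ?C) NC = dim_mod ZA NC"
    by (rule dim_mod_absorb[where Y = NC]) (use assms sC ZC in \<open>auto intro: subspace_inter\<close>)
  have 3: "dim_mod ZB ND = dim_mod ZB ?D + dim_mod (ZB \<inter> ?D) ND"
    using assms sD ND fD by (intro dim_mod_add) auto
  have 4: "dim_mod (ZB \<inter> ?D) ND = dim_mod ZA ND"
    by (rule dim_mod_absorb[where Y = ND]) (use assms sD ZD in \<open>auto intro: subspace_inter\<close>)
  have 5: "dim_mod ZB ?C = dim_mod ZB ?D + dim_mod (ZB \<inter> ?D) ?C"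
    using assms sC sD CD fC by (intro dim_mod_add) auto
  have 6: "dim_mod (ZB \<inter> ?D) ?C = dim_mod (ZB \<inter> ND) ?C"
  proof (rule dim_mod_absorb[where Y = ZA])
    \<comment> \<open>Modular law: since \<open>ZA \<subseteq> ZB\<close>, an element
      \<open>x + y\<close> of \<open>ZB\<close> with \<open>x\<close> in \<open>ZA\<close> has
      \<open>y\<close> in \<open>ZB\<close> as well.\<close>
    show "ZB \<inter> ?D \<subseteq> {x + y |x y. x \<in> ZB \<inter> ND \<and> y \<in> ZA}"
    proof
      fix z assume "z \<in> ZB \<inter> ?D"
      then obtain x y where xy: "z \<in> ZB" "z = x + y" "x \<in> ZA" "y \<in> ND" by blast
      then have "y = z - x" by simp
      then have "y \<in> ZB" using xy assms(2,5) subspace_diff by blast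
      then show "z \<in> {x + y |x y. x \<in> ZB \<inter> ND \<and> y \<in> ZA}" using xy add.commute[of x y] by blast
    qed
  qed (use assms sC sD ND ZC in \<open>auto intro: subspace_inter\<close>)
  show ?thesis unfolding 1 2 3 4 5 6 by (simp add: add_ac)
qed

end

section \<open>Ordered chains and barycentric subdivision\<close>

type_synonym ('x, 'f) chain = "'x list \<Rightarrow>\<^sub>0 'f"

abbreviation keys :: "('x \<Rightarrow>\<^sub>0 'f::zero) \<Rightarrow> 'x set" where "keys \<equiv> Poly_Mapping.keys"

abbreviation lookup :: "('x \<Rightarrow>\<^sub>0 'f::zero) \<Rightarrow> 'x \<Rightarrow> 'f" where "lookup \<equiv> Poly_Mapping.lookup"

definition smul :: "'f::field \<Rightarrow> ('x \<Rightarrow>\<^sub>0 'f) \<Rightarrow> ('x \<Rightarrow>\<^sub>0 'f)" where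
  "smul a c = Poly_Mapping.map ((*) a) c"

lemma lookup_smul [simp]: "lookup (smul a c) k = a * lookup c k"
  by (auto simp: smul_def Poly_Mapping.map.rep_eq when_def)

lemma smul_simps [simp]: "smul 0 c = 0" "smul a 0 = 0" "smul 1 c = c"
  by (auto intro!: poly_mapping_eqI)

lemma smul_add: "smul a (c + d) = smul a c + smul a d" "smul (a + b) c = smul a c + smul b c"
  and smul_diff: "smul a (c - d) = smul a c - smul a d" "smul (a - b) c = smul a c - smul b c"
  and smul_smul: "smul a (smul b c) = smul (a * b) c"
  by (auto intro!: poly_mapping_eqI simp: lookup_add lookup_minus algebra_simps)

lemma smul_sum: "smul a (sum f S) = (\<Sum>i\<in>S. smul a (f i))"
  by (induction S rule: infinite_finite_induct) (auto simp: smul_add)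

lemma keys_smul: "keys (smul a c) \<subseteq> keys c"
  by (auto simp: in_keys_iff)

abbreviation sgl :: "'x \<Rightarrow> ('x \<Rightarrow>\<^sub>0 'f::field)" where
  "sgl l \<equiv> Poly_Mapping.single l 1"

definition lext :: "('x \<Rightarrow> 'y \<Rightarrow>\<^sub>0 'f::field) \<Rightarrow> ('x \<Rightarrow>\<^sub>0 'f) \<Rightarrow> ('y \<Rightarrow>\<^sub>0 'f)" where
  "lext \<phi> c = (\<Sum>l\<in>keys c. smul (lookup c l) (\<phi> l))"

lemma lext_superset: "finite S \<Longrightarrow> keys c \<subseteq> S \<Longrightarrow> lext \<phi> c = (\<Sum>l\<in>S. smul (lookup c l) (\<phi> l))"
  unfolding lext_def by (rule sum.mono_neutral_left) (auto simp: in_keys_iff)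

lemma lookup_sum: "lookup (sum f S) m = (\<Sum>i\<in>S. lookup (f i) m)"
  by (induction S rule: infinite_finite_induct) (auto simp: lookup_add)

lemma lookup_lext: "lookup (lext \<phi> c) m = (\<Sum>l\<in>keys c. lookup c l * lookup (\<phi> l) m)"
  by (simp add: lext_def lookup_sum)

lemma lext_zero [simp]: "lext \<phi> 0 = 0" "lext (\<lambda>_. 0) c = 0"
  by (simp_all add: lext_def)

lemma lext_add: "lext \<phi> (c + d) = lext \<phi> c + lext \<phi> d"
proof -
  have "lext \<phi> (c + d) = (\<Sum>l\<in>keys c \<union> keys d. smul (lookup (c + d) l) (\<phi> l))"
    by (rule lext_superset) (auto dest: keys_add[THEN subsetD])
  also have "\<dots> = lext \<phi> c + lext \<phi> d"
    by (simp add: lookup_add smul_add sum.distrib lext_superset[of "keys c \<union> keys d"])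
  finally show ?thesis .
qed

lemma lext_smul: "lext \<phi> (smul a c) = smul a (lext \<phi> c)"
proof -
  have "lext \<phi> (smul a c) = (\<Sum>l\<in>keys c. smul (lookup (smul a c) l) (\<phi> l))"
    by (rule lext_superset) (auto dest: keys_smul[THEN subsetD])
  then show ?thesis by (simp add: lext_def smul_sum smul_smul)
qed

lemma lext_diff: "lext \<phi> (c - d) = lext \<phi> c - lext \<phi> d"
  using lext_add[of \<phi> "c - d" d] by simp

lemma lext_sum: "lext \<phi> (sum f S) = (\<Sum>i\<in>S. lext \<phi> (f i))"
  by (induction S rule: infinite_finite_induct) (auto simp: lext_add)

lemma lext_sgl [simp]: "lext \<phi> (sgl l) = \<phi> l" "lext sgl c = c"
  by (auto intro!: poly_mapping_eqI simp: lookup_lext lookup_single when_def in_keys_iff if_distrib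
    cong: if_cong)

lemma lext_cong: "(\<And>l. l \<in> keys c \<Longrightarrow> \<phi> l = \<psi> l) \<Longrightarrow> lext \<phi> c = lext \<psi> c"
  by (simp add: lext_def)

text \<open>Every chain operator below is \<open>lext\<close> of a map on simplices, so this rule
  reduces identities between composites to identities on one simplex.\<close>

lemma lext_lext: "lext \<psi> (lext \<phi> c) = lext (\<lambda>l. lext \<psi> (\<phi> l)) c"
  by (simp add: lext_def[of \<phi>] lext_def[of "\<lambda>l. lext \<psi> (\<phi> l)"] lext_sum lext_smul)

lemma lext_fun_diff: "lext (\<lambda>l. \<phi> l - \<psi> l) c = lext \<phi> c - lext \<psi> c"
  by (simp add: lext_def smul_diff sum_subtractf)

lemma keys_lext: "m \<in> keys (lext \<phi> c) \<Longrightarrow> \<exists>l\<in>keys c. m \<in> keys (\<phi> l)"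
  by (auto simp: in_keys_iff lookup_lext elim!: sum.not_neutral_contains_not_neutral)

lemma keys_diff_cases: "m \<in> keys (c - d) \<Longrightarrow> m \<in> keys c \<or> m \<in> keys d"
  and keys_add_cases: "m \<in> keys (c + d) \<Longrightarrow> m \<in> keys c \<or> m \<in> keys d"
  for c d :: "'x \<Rightarrow>\<^sub>0 'f::field"
  by (auto simp: in_keys_iff lookup_add lookup_minus)

section \<open>Cones, boundary and pushforward\<close>

text \<open>Simplices are lists that may repeat vertices, so coning is prefixing, without
  orientations or degenerate cases.\<close>

definition lcone :: "'x \<Rightarrow> ('x, 'f::field) chain \<Rightarrow> ('x, 'f) chain" where
  "lcone x = lext (\<lambda>m. sgl (x # m))"

text \<open>The complex is augmented: the boundary of a vertex is the empty simplex. This makes the cone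
  formula and the homotopies below uniform in all degrees.\<close>

primrec bdb :: "'x list \<Rightarrow> ('x, 'f::field) chain" where
  "bdb [] = 0"
| "bdb (x # xs) = sgl xs - lcone x (bdb xs)"

definition bnd :: "('x, 'f::field) chain \<Rightarrow> ('x, 'f) chain" where
  "bnd = lext bdb"

definition pushf :: "('x \<Rightarrow> 'y) \<Rightarrow> ('x, 'f::field) chain \<Rightarrow> ('y, 'f) chain" where
  "pushf p = lext (\<lambda>l. sgl (map p l))"

lemma cone_simps [simp]: "lcone x 0 = 0" "lcone x (sgl l) = sgl (x # l)"
  "lcone x (c + d) = lcone x c + lcone x d" "lcone x (c - d) = lcone x c - lcone x d"
  by (simp_all add: lcone_def lext_add lext_diff)

lemma bnd_simps [simp]: "bnd 0 = 0" "bnd (sgl l) = bdb l"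
  "bnd (c + d) = bnd c + bnd d" "bnd (c - d) = bnd c - bnd d"
  by (simp_all add: bnd_def lext_add lext_diff)

lemma pushf_simps [simp]: "pushf p 0 = 0" "pushf p (sgl l) = sgl (map p l)"
  "pushf p (c + d) = pushf p c + pushf p d" "pushf p (c - d) = pushf p c - pushf p d"
  by (simp_all add: pushf_def lext_add lext_diff)

lemma lext_cone: "lext \<phi> (lcone x c) = lext (\<lambda>m. \<phi> (x # m)) c"
  by (simp add: lcone_def lext_lext)

lemma cone_lext: "lcone x (lext \<phi> c) = lext (\<lambda>l. lcone x (\<phi> l)) c"
  by (simp add: lcone_def lext_lext)

lemma bnd_cone: "bnd (lcone x c) = c - lcone x (bnd c)"
  unfolding bnd_def by (simp add: lext_cone cone_lext lext_fun_diff)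

lemma bnd_bdb [simp]: "bnd (bdb l) = 0"
  by (induction l) (simp_all add: bnd_cone)

lemma bnd_lext: "bnd (lext \<phi> c) = lext (\<lambda>l. bnd (\<phi> l)) c"
  by (simp add: bnd_def lext_lext)

lemma pushf_cone: "pushf p (lcone x c) = lcone (p x) (pushf p c)"
  unfolding pushf_def by (simp add: lext_cone cone_lext)

lemma pushf_bdb: "pushf p (bdb l) = bdb (map p l)"
  by (induction l) (simp_all add: pushf_cone)

lemma pushf_bnd: "pushf p (bnd c) = bnd (pushf p c)"
  by (simp add: bnd_def pushf_def lext_lext) (simp add: pushf_bdb flip: pushf_def)

lemma pushf_pushf: "pushf p (pushf p' c) = pushf (p \<circ> p') c"
  by (simp add: pushf_def lext_lext)

lemma pushf_cong: "(\<And>l x. l \<in> keys c \<Longrightarrow> x \<in> set l \<Longrightarrow> p x = p' x) \<Longrightarrow> pushf p c = pushf p' c"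
  unfolding pushf_def by (rule lext_cong) (metis map_ext)

lemma keys_pushf: "m \<in> keys (pushf p c) \<Longrightarrow> \<exists>l\<in>keys c. m = map p l"
  unfolding pushf_def by (drule keys_lext) auto

lemma keys_cone: "m \<in> keys (lcone x c) \<Longrightarrow> \<exists>l\<in>keys c. m = x # l"
  unfolding lcone_def by (drule keys_lext) auto

lemma keys_bdb: "m \<in> keys (bdb l) \<Longrightarrow> length l = Suc (length m) \<and> set m \<subseteq> set l"
proof (induction l arbitrary: m)
  case (Cons x l)
  then show ?case by (fastforce dest!: keys_diff_cases keys_cone)
qed simp

text \<open>\<open>cycles\<close> tests the boundary on nonempty lists only, so the augmented
  boundary of a cycle may be a multiple of the empty simplex. \<open>prism\<close> and
  \<open>tdb\<close> vanish there, and their homotopy formulas lose the boundary term as for true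
  cycles.\<close>

lemma lext_augmentation: "keys c \<subseteq> {[]} \<Longrightarrow> \<phi> [] = 0 \<Longrightarrow> lext \<phi> c = 0"
  unfolding lext_def by (rule sum.neutral) auto

section \<open>The prism homotopy\<close>

text \<open>The usual prism operator: a term follows \<open>p\<close> up to some vertex, repeats
  that vertex, and follows \<open>p'\<close> from there. Recursion on the first vertex leaves the
  signs to \<open>bnd_cone\<close>.\<close>

primrec prism :: "('x \<Rightarrow> 'y) \<Rightarrow> ('x \<Rightarrow> 'y) \<Rightarrow> 'x list \<Rightarrow> ('y, 'f::field) chain" where
  "prism p p' [] = 0"
| "prism p p' (x # xs) = sgl (p x # p' x # map p' xs) - lcone (p x) (prism p p' xs)"

lemma bnd_prism:
  "bnd (prism p p' l :: ('y, 'f::field) chain) =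
    sgl (map p' l) - sgl (map p l) - lext (prism p p') (bdb l)"
proof (induction l)
  case (Cons x xs)
  have "lext (prism p p') (lcone x c) =
    lcone (p x) (lcone (p' x) (pushf p' c)) - lcone (p x) (lext (prism p p') c)"
    for c :: "(_, 'f) chain"
    by (simp add: lext_cone lext_fun_diff cone_lext pushf_def)
  then show ?case using Cons by (simp add: bnd_cone lext_diff pushf_bdb)
qed simp

lemma keys_prism: "m \<in> keys (prism p p' l) \<Longrightarrow>
  length m = Suc (length l) \<and> set m \<subseteq> p ` set l \<union> p' ` set l"
proof (induction l arbitrary: m)
  case (Cons x l)
  then show ?case by (fastforce dest!: keys_diff_cases keys_cone)
qed simp

section \<open>Barycentric subdivision, its homotopy to the identity, and its mesh\<close>

definition bary :: "'a::real_vector list \<Rightarrow> 'a" where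
  "bary l = (1 / real (length l)) *\<^sub>R sum_list l"

text \<open>In \<open>sd_aux n l\<close> and \<open>td_aux n l\<close> the number \<open>n\<close> is the length of \<open>l\<close>; it
  makes the recursion over the faces of \<open>l\<close> primitive.\<close>

primrec sd_aux :: "nat \<Rightarrow> 'a::real_vector list \<Rightarrow> ('a, 'f::field) chain" where
  "sd_aux 0 l = sgl l"
| "sd_aux (Suc n) l = lcone (bary l) (lext (sd_aux n) (bdb l))"

primrec td_aux :: "nat \<Rightarrow> 'a::real_vector list \<Rightarrow> ('a, 'f::field) chain" where
  "td_aux 0 l = 0"
| "td_aux (Suc n) l = lcone (bary l) (sgl l - lext (td_aux n) (bdb l))"

definition sdb :: "'a::real_vector list \<Rightarrow> ('a, 'f::field) chain" where
  "sdb l = sd_aux (length l) l"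

definition tdb :: "'a::real_vector list \<Rightarrow> ('a, 'f::field) chain" where
  "tdb l = td_aux (length l) l"

lemma sdb_simps [simp]: "sdb [] = sgl []"
  "(sdb (x # xs) :: ('a::real_vector, 'f::field) chain) =
    lcone (bary (x # xs)) (lext sdb (bdb (x # xs)))"
proof -
  have "lext (sd_aux (length xs)) (bdb (x # xs)) = lext sdb (bdb (x # xs) :: ('a, 'f) chain)"
    by (rule lext_cong) (auto simp: sdb_def simp del: bdb.simps dest!: keys_bdb)
  then show "(sdb (x # xs) :: ('a, 'f) chain) = lcone (bary (x # xs)) (lext sdb (bdb (x # xs)))"
    by (simp add: sdb_def del: bdb.simps)
qed (simp add: sdb_def)

lemma tdb_simps [simp]: "tdb [] = 0"
  "(tdb (x # xs) :: ('a::real_vector, 'f::field) chain) =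
     lcone (bary (x # xs)) (sgl (x # xs) - lext tdb (bdb (x # xs)))"
proof -
  have "lext (td_aux (length xs)) (bdb (x # xs)) = lext tdb (bdb (x # xs) :: ('a, 'f) chain)"
    by (rule lext_cong) (auto simp: tdb_def simp del: bdb.simps dest!: keys_bdb)
  then show "(tdb (x # xs) :: ('a, 'f) chain) =
    lcone (bary (x # xs)) (sgl (x # xs) - lext tdb (bdb (x # xs)))"
    by (simp add: tdb_def del: bdb.simps)
qed (simp add: tdb_def)

text \<open>The cone formula leaves an error term, the cone over the boundary of
  \<open>lext sdb (bdb l)\<close>. By induction on the faces this is the subdivision of a double
  boundary, hence 0.\<close>

lemma bnd_sdb: "bnd (sdb l :: ('a::real_vector, 'f::field) chain) = lext sdb (bdb l)"
proof (induction l rule: length_induct)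
  case (1 l)
  show ?case
  proof (cases l)
    case (Cons x xs)
    have "bnd (lext sdb (bdb l)) = lext (\<lambda>m. bnd (sdb m)) (bdb l :: ('a, 'f) chain)"
      by (simp add: bnd_lext)
    also have "\<dots> = lext (\<lambda>m. lext sdb (bdb m)) (bdb l)"
      by (rule lext_cong) (use 1 in \<open>auto dest!: keys_bdb\<close>)
    also have "\<dots> = lext sdb (bnd (bdb l))" by (simp add: bnd_def lext_lext del: bnd_bdb)
    finally show ?thesis using Cons by (simp add: bnd_cone del: bdb.simps)
  qed simp
qed

text \<open>By induction the chain coned off in \<open>tdb l\<close> has boundary
  \<open>lext sdb (bdb l)\<close>, and the cone over that from \<open>bary l\<close> is
  \<open>sdb l\<close>.\<close>

lemma bnd_tdb: "bnd (tdb l :: ('a::real_vector, 'f::field) chain) =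
  sgl l - sdb l - lext tdb (bdb l)"
proof (induction l rule: length_induct)
  case (1 l)
  show ?case
  proof (cases l)
    case (Cons x xs)
    have "bnd (lext tdb (bdb l)) = lext (\<lambda>m. bnd (tdb m)) (bdb l :: ('a, 'f) chain)"
      by (simp add: bnd_lext)
    also have "\<dots> = lext (\<lambda>m. sgl m - sdb m - lext tdb (bdb m)) (bdb l)"
      by (rule lext_cong) (use 1 in \<open>auto dest!: keys_bdb\<close>)
    also have "\<dots> = bdb l - lext sdb (bdb l) - lext tdb (bnd (bdb l))"
      by (simp add: bnd_def lext_lext lext_fun_diff del: bnd_bdb)
    finally show ?thesis using Cons
      by (simp add: bnd_cone bdb.simps(2)[of "bary (x # xs)"] del: bdb.simps)
  qed simp
qed

lemma bary_in_hull: "l \<noteq> [] \<Longrightarrow> bary l \<in> convex hull (set l)"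
proof -
  assume l: "l \<noteq> []"
  have "bary l = (\<Sum>i<length l. (1 / real (length l)) *\<^sub>R l ! i)"
    by (simp add: bary_def sum_list_sum_nth scaleR_sum_right lessThan_atLeast0)
  also have "\<dots> \<in> convex hull (set l)"
    by (rule convex_sum) (use l in \<open>auto intro!: hull_inc\<close>)
  finally show ?thesis .
qed

text \<open>One of the averaged vertices is \<open>x\<close> itself, at distance 0; this gains the
  \<open>1 / length l\<close>.\<close>

lemma dist_bary:
  fixes l :: "'a::real_normed_vector list"
  assumes "\<And>x y. x \<in> set l \<Longrightarrow> y \<in> set l \<Longrightarrow> dist x y \<le> d" "x \<in> set l"
  shows "dist (bary l) x \<le> (1 - 1 / real (length l)) * d"
proof -
  let ?n = "length l"
  obtain j where j: "j < ?n" "x = l ! j" using assms(2) by (metis in_set_conv_nth)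
  have n: "real ?n > 0" using j by auto
  have "bary l - x = (1 / real ?n) *\<^sub>R (\<Sum>i<?n. l ! i - x)"
    using n by (simp add: bary_def sum_list_sum_nth sum_subtractf lessThan_atLeast0
      scaleR_diff_right sum_constant_scaleR)
  then have "dist (bary l) x = (1 / real ?n) * norm (\<Sum>i<?n. l ! i - x)"
    by (simp add: dist_norm)
  also have "norm (\<Sum>i<?n. l ! i - x) = norm (\<Sum>i\<in>{..<?n} - {j}. l ! i - x)"
    using j by (subst sum.remove[of _ j]) auto
  also have "\<dots> \<le> of_nat (card ({..<?n} - {j})) * d"
    by (rule order_trans[OF norm_sum], rule sum_bounded_above)
      (use assms in \<open>auto simp flip: dist_norm\<close>)
  also have "of_nat (card ({..<?n} - {j})) = real ?n - 1" using j by (simp add: of_nat_diff)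
  finally have "dist (bary l) x \<le> (1 / real ?n) * ((real ?n - 1) * d)" using n
    by (simp add: divide_right_mono)
  also have "\<dots> = (1 - 1 / real ?n) * d" using n by (simp add: field_simps)
  finally show ?thesis .
qed

lemma keys_sdb: "m \<in> keys (sdb l :: ('a::real_vector, 'f::field) chain) \<Longrightarrow>
  length m = length l \<and> set m \<subseteq> convex hull (set l)"
proof (induction l arbitrary: m rule: length_induct)
  case (1 l)
  show ?case
  proof (cases l)
    case (Cons x xs)
    then have "m \<in> keys (lcone (bary l) (lext sdb (bdb l :: ('a, 'f) chain)))"
      using 1(2) by (simp only: sdb_simps)
    from keys_cone[OF this]
    obtain m1 where m1: "m = bary l # m1" "m1 \<in> keys (lext sdb (bdb l :: ('a, 'f) chain))"
      by blast
    from keys_lext[OF m1(2)]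
    obtain l1 where l1: "l1 \<in> keys (bdb l :: ('a, 'f) chain)" "m1 \<in> keys (sdb l1 :: ('a, 'f) chain)"
      by blast
    have l1': "length l = Suc (length l1)" "set l1 \<subseteq> set l" using keys_bdb[OF l1(1)] by auto
    then have "length m1 = length l1" "set m1 \<subseteq> convex hull (set l1)"
      using 1(1)[rule_format, OF _ l1(2)] by simp_all
    moreover have "convex hull (set l1) \<subseteq> convex hull (set l)" using l1' by (simp add: hull_mono)
    ultimately show ?thesis using m1 l1' Cons bary_in_hull[of l] by auto
  qed (use 1 in auto)
qed

lemma keys_tdb: "m \<in> keys (tdb l :: ('a::real_vector, 'f::field) chain) \<Longrightarrow>
  length m = Suc (length l) \<and> set m \<subseteq> convex hull (set l)"
proof (induction l arbitrary: m rule: length_induct)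
  case (1 l)
  show ?case
  proof (cases l)
    case (Cons x xs)
    then have "m \<in> keys (lcone (bary l) (sgl l - lext tdb (bdb l :: ('a, 'f) chain)))"
      using 1(2) by (simp only: tdb_simps)
    from keys_cone[OF this]
    obtain m1 where m1: "m = bary l # m1" "m1 \<in> keys (sgl l - lext tdb (bdb l :: ('a, 'f) chain))"
      by blast
    from keys_diff_cases[OF m1(2)] have "length m1 = length l \<and> set m1 \<subseteq> convex hull (set l)"
    proof
      assume "m1 \<in> keys (sgl l :: ('a, 'f) chain)"
      then show ?thesis by (auto intro: hull_inc)
    next
      assume "m1 \<in> keys (lext tdb (bdb l :: ('a, 'f) chain))"
      from keys_lext[OF this]
      obtain l1 where l1: "l1 \<in> keys (bdb l :: ('a, 'f) chain)"
        "m1 \<in> keys (tdb l1 :: ('a, 'f) chain)"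
        by blast
      have l1': "length l = Suc (length l1)" "set l1 \<subseteq> set l" using keys_bdb[OF l1(1)] by auto
      then have "length m1 = Suc (length l1)" "set m1 \<subseteq> convex hull (set l1)"
        using 1(1)[rule_format, OF _ l1(2)] by simp_all
      moreover have "convex hull (set l1) \<subseteq> convex hull (set l)" using l1' by (simp add: hull_mono)
      ultimately show ?thesis using l1' by auto
    qed
    then show ?thesis using m1 Cons bary_in_hull[of l] by auto
  qed (use 1 in auto)
qed

lemma dist_hull_le:
  fixes S :: "'a::real_normed_vector set"
  assumes "\<And>y. y \<in> S \<Longrightarrow> dist z y \<le> d" "x \<in> convex hull S"
  shows "dist z x \<le> d"
proof -
  have "convex hull S \<subseteq> cball z d" using assms(1) by (intro hull_minimal) auto
  then show ?thesis using assms(2) by auto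
qed

lemma dist_hull_hull_le:
  fixes S :: "'a::real_normed_vector set"
  assumes "\<And>x y. x \<in> S \<Longrightarrow> y \<in> S \<Longrightarrow> dist x y \<le> d" "x \<in> convex hull S" "y \<in> convex hull S"
  shows "dist x y \<le> d"
  by (rule dist_hull_le[OF _ assms(3)], subst dist_commute, rule dist_hull_le[OF _ assms(2)])
    (use assms(1) in auto)

text \<open>Two vertices of a simplex of the subdivision either lie in a subdivided face, where
  induction applies, or one of them is \<open>bary l\<close> and \<open>dist_bary\<close> applies.
  The bound \<open>L\<close> replaces the length because the factor must not depend on the
  face.\<close>

lemma sdb_mesh:
  fixes l :: "'a::real_normed_vector list"
  assumes "m \<in> keys (sdb l :: ('a, 'f::field) chain)" "length l \<le> L"
    and "\<And>x y. x \<in> set l \<Longrightarrow> y \<in> set l \<Longrightarrow> dist x y \<le> d" "x \<in> set m" "y \<in> set m"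
  shows "dist x y \<le> (1 - 1 / real L) * d"
  using assms
proof (induction l arbitrary: m x y rule: length_induct)
  case (1 l)
  show ?case
  proof (cases l)
    case (Cons a xs)
    then have "m \<in> keys (lcone (bary l) (lext sdb (bdb l :: ('a, 'f) chain)))"
      using 1(2) by (simp only: sdb_simps)
    from keys_cone[OF this]
    obtain m1 where m1: "m = bary l # m1" "m1 \<in> keys (lext sdb (bdb l :: ('a, 'f) chain))"
      by blast
    from keys_lext[OF m1(2)]
    obtain l1 where l1: "l1 \<in> keys (bdb l :: ('a, 'f) chain)" "m1 \<in> keys (sdb l1 :: ('a, 'f) chain)"
      by blast
    have l1': "length l = Suc (length l1)" "set l1 \<subseteq> set l" using keys_bdb[OF l1(1)] by auto
    have d0: "0 \<le> d" using 1(4)[of a a] Cons by simp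
    have len: "0 < length l" "length l \<le> L" using Cons 1 by auto
    then have "Suc 0 \<le> length l" "Suc 0 \<le> L" by linarith+
    with len have "1 / real L \<le> 1 / real (length l)" "1 \<le> real (length l)" "1 \<le> real L"
      by (auto intro!: frac_le)
    then have L: "1 - 1 / real (length l) \<le> 1 - 1 / real L" "0 \<le> 1 - 1 / real L"
      by auto
    have B: "dist (bary l) y \<le> (1 - 1 / real L) * d" if "y \<in> convex hull (set l)" for y
    proof (rule dist_hull_le[OF _ that])
      fix z assume "z \<in> set l"
      then have "dist (bary l) z \<le> (1 - 1 / real (length l)) * d" using 1(4)
        by (intro dist_bary) auto
      also have "\<dots> \<le> (1 - 1 / real L) * d" using L d0 by (intro mult_right_mono) auto
      finally show "dist (bary l) z \<le> (1 - 1 / real L) * d" .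
    qed
    have M: "dist x y \<le> (1 - 1 / real L) * d" if "x \<in> set m1" "y \<in> set m1" for x y
    proof (rule 1(1)[rule_format, OF _ l1(2) _ _ that])
      show "dist x y \<le> d" if "x \<in> set l1" "y \<in> set l1" for x y using 1(4) that l1' by auto
    qed (use l1' len in auto)
    have sub: "set m1 \<subseteq> convex hull (set l)"
      using keys_sdb[OF l1(2)] l1'(2) hull_mono[of "set l1" "set l" convex] by auto
    have "bary l \<in> convex hull (set l)" using Cons by (intro bary_in_hull) simp
    then show ?thesis using 1(5,6) M B sub m1 by (auto simp: dist_commute)
  qed (use 1 in auto)
qed

abbreviation Sd :: "('a::real_vector, 'f::field) chain \<Rightarrow> ('a, 'f) chain" where
  "Sd \<equiv> lext sdb"

lemma bnd_Sd: "bnd (Sd c) = Sd (bnd c)"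
  by (simp add: bnd_lext bnd_sdb) (simp add: bnd_def lext_lext)

lemma bnd_Sd_iter: "bnd ((Sd ^^ k) c) = (Sd ^^ k) (bnd c)"
  by (induction k) (simp_all add: bnd_Sd)

lemma Sd_iter_diff: "(Sd ^^ k) (c - d) = (Sd ^^ k) c - (Sd ^^ k) d"
  by (induction k) (simp_all add: lext_diff)

lemma keys_Sd_iter:
  assumes "m \<in> keys ((Sd ^^ k) c)"
  shows "\<exists>l\<in>keys c. length m = length l \<and> set m \<subseteq> convex hull (set l)"
  using assms
proof (induction k arbitrary: m)
  case 0
  then show ?case by (auto intro!: bexI[of _ m] hull_inc)
next
  case (Suc k)
  then obtain m1 where m1: "m1 \<in> keys ((Sd ^^ k) c)" "m \<in> keys (sdb m1 :: ('a, 'b) chain)"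
    by (auto dest!: keys_lext)
  from Suc.IH[OF m1(1)] obtain l where l: "l \<in> keys c" "length m1 = length l"
    "set m1 \<subseteq> convex hull (set l)"
    by blast
  have "convex hull (set m1) \<subseteq> convex hull (set l)" using l(3) by (simp add: hull_minimal)
  then show ?case using keys_sdb[OF m1(2)] l by auto
qed

lemma Sd_iter_mesh:
  fixes c :: "('a::real_normed_vector, 'f::field) chain"
  assumes "\<And>l. l \<in> keys c \<Longrightarrow> length l \<le> L"
    and "\<And>l x y. l \<in> keys c \<Longrightarrow> x \<in> set l \<Longrightarrow> y \<in> set l \<Longrightarrow> dist x y \<le> d"
    and "m \<in> keys ((Sd ^^ k) c)" "x \<in> set m" "y \<in> set m"
  shows "dist x y \<le> (1 - 1 / real L) ^ k * d"
  using assms(3-)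
proof (induction k arbitrary: m x y)
  case 0
  then show ?case using assms by auto
next
  case (Suc k)
  then obtain m1 where m1: "m1 \<in> keys ((Sd ^^ k) c)" "m \<in> keys (sdb m1 :: ('a, 'f) chain)"
    by (auto dest!: keys_lext)
  have "length m1 \<le> L" using keys_Sd_iter[OF m1(1)] assms(1) by auto
  then have "dist x y \<le> (1 - 1 / real L) * ((1 - 1 / real L) ^ k * d)"
    using Suc m1 by (intro sdb_mesh[OF m1(2)]) auto
  then show ?case by (simp add: mult.assoc)
qed

text \<open>The homotopies \<open>lext tdb\<close> of the successive subdivisions add up. Hulls are
  nested, so no simplex of the sum leaves the hull of a simplex of \<open>c\<close>.\<close>

lemma Sd_iter_homotopic:
  assumes "keys (bnd c) \<subseteq> {[]}"
  shows "\<exists>w. bnd w = c - (Sd ^^ k) c \<and>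
    (\<forall>m\<in>keys w. \<exists>l\<in>keys c. length m = Suc (length l) \<and> set m \<subseteq> convex hull (set l))"
proof (induction k)
  case 0
  then show ?case by (intro exI[of _ 0]) auto
next
  case (Suc k)
  then obtain w where w: "bnd w = c - (Sd ^^ k) c"
    "\<forall>m\<in>keys w. \<exists>l\<in>keys c. length m = Suc (length l) \<and> set m \<subseteq> convex hull (set l)" by blast
  let ?c = "(Sd ^^ k) c"
  have "keys (bnd ?c) \<subseteq> {[]}"
  proof
    fix m assume "m \<in> keys (bnd ?c)"
    then show "m \<in> {[]}" using assms keys_Sd_iter[of m k "bnd c"] by (auto simp: bnd_Sd_iter)
  qed
  then have "lext tdb (bnd ?c) = 0" by (rule lext_augmentation) simp
  then have "bnd (lext tdb ?c) = ?c - Sd ?c"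
    by (simp add: bnd_lext bnd_tdb lext_fun_diff) (simp add: bnd_def lext_lext)
  then have "bnd (w + lext tdb ?c) = c - (Sd ^^ Suc k) c" using w(1) by simp
  moreover have "\<exists>l\<in>keys c. length m = Suc (length l) \<and> set m \<subseteq> convex hull (set l)"
    if "m \<in> keys (w + lext tdb ?c)" for m
    using keys_add_cases[OF that]
  proof
    assume "m \<in> keys (lext tdb ?c)"
    from keys_lext[OF this] obtain m1 where m1: "m1 \<in> keys ?c" "m \<in> keys (tdb m1 :: ('a, 'b) chain)"
      by blast
    obtain l where l: "l \<in> keys c" "length m1 = length l" "set m1 \<subseteq> convex hull (set l)"
      using keys_Sd_iter[OF m1(1)] by blast
    have "convex hull (set m1) \<subseteq> convex hull (set l)" using l(3) by (simp add: hull_minimal)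
    then show ?thesis using keys_tdb[OF m1(2)] l by auto
  qed (use w in blast)
  ultimately show ?case by blast
qed

section \<open>Agreement with the boundary and pushforward of the definitions\<close>

lemma lookup_cone: "lookup (lcone x c) m = (if m \<noteq> [] \<and> hd m = x then lookup c (tl m) else 0)"
proof (cases m)
  case (Cons y m')
  have "lookup (lcone x c) (y # m') = (if y = x then lookup c m' else 0)"
    by (auto simp: lcone_def lookup_lext lookup_single when_def in_keys_iff if_distrib
      cong: if_cong)
  then show ?thesis using Cons by simp
qed (simp add: lcone_def lookup_lext lookup_single when_def)

lemma lookup_bdb: "lookup (bdb l :: ('x, 'f::field) chain) m =
    (\<Sum>i<length l. if take i l @ drop (Suc i) l = m then (-1) ^ i else 0)"
proof (induction l arbitrary: m)
  case (Cons x l)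
  have "(\<Sum>i<length (x # l). if take i (x # l) @ drop (Suc i) (x # l) =
    m then (-1) ^ i else (0::'f)) =
     (if l = m then 1 else 0) + (\<Sum>i<length l.
       if x # take i l @ drop (Suc i) l = m then - ((-1) ^ i) else 0)"
    by (simp add: sum.lessThan_Suc_shift del: sum.lessThan_Suc cong: if_cong)
  also have "(\<Sum>i<length l. if x # take i l @ drop (Suc i) l = m then - ((-1) ^ i) else (0::'f)) =
     - (if m \<noteq> [] \<and> hd m = x then \<Sum>i<length l.
       if take i l @ drop (Suc i) l = tl m then (-1) ^ i else 0 else 0)"
    by (cases m) (auto simp: sum_negf[symmetric] intro!: sum.cong)
  finally show ?case by (simp add: Cons lookup_minus lookup_cone lookup_single when_def)
qed simp

lemma bd_lookup: "bd (lookup c) = lookup (bnd c)"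
proof
  fix m
  show "bd (lookup c) m = lookup (bnd c) m"
    unfolding bd_def bnd_def lookup_lext lookup_bdb sum_distrib_left
    by (rule sum.cong) (auto simp: in_keys_iff if_distrib mult.commute intro!: sum.cong)
qed

lemma push_lookup: "push p (lookup c) = lookup (pushf p c)"
proof
  fix m
  show "push p (lookup c) m = lookup (pushf p c) m"
    unfolding push_def pushf_def lookup_lext
    by (rule sum.cong) (auto simp: in_keys_iff lookup_single when_def)
qed

section \<open>A finite cover controls the Cech cycles of a sublevel set\<close>

type_synonym ('a, 'f) cech_family = "'a set set \<Rightarrow> 'a set list \<Rightarrow> 'f"

definition nerve_keys :: "'a set \<Rightarrow> 'a set set \<Rightarrow> int \<Rightarrow> 'a set list set" where
  "nerve_keys X U q = {l. nerve_simplex X U l \<and> int (length l) = q + 1}"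

lemma chains_lookup: "(chains X U q :: ('a set list \<Rightarrow> 'f::field) set) =
  lookup ` {c. keys c \<subseteq> nerve_keys X U q}"
proof (intro subset_antisym subsetI)
  fix c :: "'a set list \<Rightarrow> 'f" assume c: "c \<in> chains X U q"
  then have "lookup (Abs_poly_mapping c) = c" by (simp add: chains_def lookup_Abs_poly_mapping)
  moreover from this have "keys (Abs_poly_mapping c) \<subseteq> nerve_keys X U q"
    using c by (auto simp: chains_def nerve_keys_def in_keys_iff)
  ultimately show "c \<in> lookup ` {c. keys c \<subseteq> nerve_keys X U q}"
    by (metis (mono_tags) image_eqI mem_Collect_eq)
next
  fix c assume "c \<in> lookup ` {c :: ('a set, 'f) chain. keys c \<subseteq> nerve_keys X U q}"
  then show "c \<in> chains X U q"
    by (auto simp: chains_def nerve_keys_def in_keys_iff subset_iff finite_lookup)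
qed

lemma boundaries_lookup: "boundaries X U q =
  (\<lambda>c. lookup (bnd c)) ` {c. keys c \<subseteq> nerve_keys X U (q + 1)}"
  unfolding boundaries_def chains_lookup by (simp add: image_image bd_lookup)

lemma cycle_lookup:
  assumes "c \<in> cycles X U q"
  obtains C where "c = lookup C" "keys C \<subseteq> nerve_keys X U q" "keys (bnd C) \<subseteq> {[]}"
  using assms unfolding cycles_def chains_lookup by (auto simp: bd_lookup in_keys_iff) blast

lemma nerve_keys_mono: "X \<subseteq> Y \<Longrightarrow> nerve_keys X U q \<subseteq> nerve_keys Y U q"
  by (auto simp: nerve_keys_def nerve_simplex_def)

lemma nerve_simplex_witness:
  assumes "l \<in> nerve_keys X U q"
  obtains x where "x \<in> X" "\<And>u. u \<in> set l \<Longrightarrow> x \<in> u" "set l \<subseteq> U" "l \<noteq> []" "int (length l) = q + 1"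
  using assms by (auto simp: nerve_keys_def nerve_simplex_def)

text \<open>Choose a vertex in every member of the cover \<open>U\<close> and of a fine cover \<open>W\<close>. The two
  resulting images of \<open>z W\<close> differ by a prism whose simplices are only small at the scale of
  \<open>U\<close>. After iterated subdivision and retraction into \<open>B\<close> they are small at the scale of
  \<open>V\<close>, so they have a vertex map into the nerve of \<open>V\<close> over \<open>B\<close>.\<close>

lemma cech_kernel_finite_cover:
  fixes A B :: "'a::euclidean_space set" and \<rho> :: "'a \<Rightarrow> 'a"
  assumes "compact A" "compact B" "A \<subseteq> B" "e0 > 0"
    and \<rho>_id: "\<And>x. x \<in> A \<Longrightarrow> \<rho> x = x"
    and \<rho>_hull: "\<And>C x. C \<subseteq> A \<Longrightarrow> (\<And>x y. x \<in> C \<Longrightarrow> y \<in> C \<Longrightarrow> dist x y \<le> e0) \<Longrightarrow> x \<in> convex hull C \<Longrightarrow> \<rho> x \<in> B"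
    and \<rho>_cont: "\<And>e. e > 0 \<Longrightarrow> \<exists>d>0. \<forall>C x y. C \<subseteq> A \<longrightarrow> (\<forall>x\<in>C. \<forall>y\<in>C. dist x y \<le> e0) \<longrightarrow>
        x \<in> convex hull C \<longrightarrow> y \<in> convex hull C \<longrightarrow> dist x y \<le> d \<longrightarrow> dist (\<rho> x) (\<rho> y) < e"
  obtains U where "finite U" "is_cover A U"
    "\<And>z V. z \<in> (cech_cycles A q :: ('a, 'f::field) cech_family set) \<Longrightarrow> z U = (\<lambda>_. 0) \<Longrightarrow> is_cover B V \<Longrightarrow>
      z V \<in> boundaries B V q"
proof -
  \<comment> \<open>Vertices chosen in members of \<open>U\<close> that share a point
    \<open>y\<close> are less than \<open>2 * e1\<close> from \<open>y\<close>, so the simplices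
    they span have diameter at most \<open>4 * e1 = e0\<close>.\<close>
  define e1 where "e1 = e0 / 4"
  have e1: "e1 > 0" "4 * e1 = e0" using assms(4) by (auto simp: e1_def)
  obtain P where P: "finite P" "P \<subseteq> A" "A \<subseteq> (\<Union>p\<in>P. ball p e1)"
    using compactE_image[OF assms(1), of A "\<lambda>p. ball p e1"] e1
    by (metis (no_types, lifting) UN_iff centre_in_ball open_ball subsetI)
  define U where "U = (\<lambda>p. ball p e1) ` P"
  have U: "finite U" "is_cover A U" using P by (auto simp: U_def is_cover_def)
  have Udist: "dist x y < 2 * e1" if "u \<in> U" "x \<in> u" "y \<in> u" for u x y
    using that dist_triangle_half_r[of _ x "2*e1" y] by (auto simp: U_def)
  obtain leb where leb: "leb > 0" "\<And>x. x \<in> A \<Longrightarrow> \<exists>u\<in>U. ball x leb \<subseteq> u"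
    using Heine_Borel_lemma[OF assms(1), of U] U by (auto simp: is_cover_def)
  show thesis
  proof (rule that[OF U])
    fix z V assume z: "z \<in> (cech_cycles A q :: ('a, 'f) cech_family set)"
      and zU: "z U = (\<lambda>_. 0)" and V: "is_cover B V"
    obtain e where e: "e > 0" "\<And>x. x \<in> B \<Longrightarrow> \<exists>v\<in>V. ball x e \<subseteq> v"
      using Heine_Borel_lemma[OF assms(2), of V] V by (auto simp: is_cover_def)
    obtain d where d: "d > 0" "\<And>C x y. C \<subseteq> A \<Longrightarrow> (\<forall>x\<in>C. \<forall>y\<in>C. dist x y \<le> e0) \<Longrightarrow>
        x \<in> convex hull C \<Longrightarrow> y \<in> convex hull C \<Longrightarrow> dist x y \<le> d \<Longrightarrow> dist (\<rho> x) (\<rho> y) < e"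
      using \<rho>_cont[OF e(1)] by blast
    \<comment> \<open>The four bounds in turn: prisms between the two choices of vertices stay of
      size \<open>e0\<close>; \<open>W\<close> refines \<open>U\<close>; simplices of
      \<open>pushf pt Z\<close>, of diameter at most \<open>4 * \<eta>\<close>, are fine at scale
      \<open>d\<close> already without subdivision; a member \<open>w\<close> of \<open>W\<close>
      lies in \<open>ball (pt w) e\<close>, so that \<open>v \<circ> pt\<close> is a refinement
      map.\<close>
    define \<eta> where "\<eta> = Min {e1, leb, d / 4, e / 2}"
    have \<eta>: "\<eta> > 0" "\<eta> \<le> e1" "\<eta> \<le> leb" "4 * \<eta> \<le> d" "2 * \<eta> \<le> e"
      using e1 leb(1) d(1) e(1) by (auto simp: \<eta>_def min_def)
    define W where "W = (\<lambda>x. ball x \<eta>) ` A"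
    have W: "is_cover A W" using \<eta> by (auto simp: W_def is_cover_def)
    have Wdist: "dist x y < 2 * \<eta>" if "w \<in> W" "x \<in> w" "y \<in> w" for w x y
      using that dist_triangle_half_r[of _ x "2*\<eta>" y] by (auto simp: W_def)
    have "\<forall>w\<in>W. \<exists>x\<in>A. x \<in> w" using \<eta> by (auto simp: W_def intro!: bexI)
    then obtain pt where pt: "\<And>w. w \<in> W \<Longrightarrow> pt w \<in> A \<and> pt w \<in> w" by metis
    have "\<forall>w\<in>W. \<exists>u\<in>U. w \<subseteq> u"
    proof
      fix w assume "w \<in> W"
      then obtain x where x: "w = ball x \<eta>" "x \<in> A" by (auto simp: W_def)
      from leb(2)[OF x(2)] obtain u where "u \<in> U" "ball x leb \<subseteq> u" by blast
      then show "\<exists>u\<in>U. w \<subseteq> u" using subset_ball[OF \<eta>(3), of x] x(1) by blast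
    qed
    then obtain \<pi> where \<pi>: "\<And>w. w \<in> W \<Longrightarrow> \<pi> w \<in> U \<and> w \<subseteq> \<pi> w" by metis
    define pu where "pu = (\<lambda>u. SOME x. x \<in> A \<and> x \<in> u)"
    have pu: "pu u \<in> A \<and> pu u \<in> u" if "x \<in> A" "x \<in> u" for u x
      unfolding pu_def using that by (intro someI[of "\<lambda>x. x \<in> A \<and> x \<in> u" x]) auto
    obtain v where v: "\<And>x. x \<in> B \<Longrightarrow> v x \<in> V \<and> ball x e \<subseteq> v x" using e(2) by metis
    have refU: "is_refinement A W U \<pi>" using \<pi> by (auto simp: is_refinement_def)
    have refV: "is_refinement A W V (v \<circ> pt)" unfolding is_refinement_def
    proof
      fix w assume w: "w \<in> W"
      have "w \<subseteq> ball (pt w) e" using Wdist[OF w] pt[OF w] \<eta>(5) by fastforce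
      then show "(v \<circ> pt) w \<in> V \<and> A \<inter> w \<subseteq> (v \<circ> pt) w" using v[of "pt w"] pt[OF w] assms(3) by auto
    qed
    have VA: "is_cover A V" using V assms(3) by (auto simp: is_cover_def)
    have zW: "z W \<in> cycles A W q" using z W by (auto simp: cech_cycles_def)
    then obtain Z where Z: "z W = lookup Z" "keys Z \<subseteq> nerve_keys A W q" "keys (bnd Z) \<subseteq> {[]}"
      using cycle_lookup by blast
    have "(\<lambda>m. push \<pi> (z W) m - z U m) \<in> boundaries A U q"
      using z W U(2) refU unfolding cech_cycles_def by blast
    then obtain Y where Y: "pushf \<pi> Z = bnd Y" "keys Y \<subseteq> nerve_keys A U (q + 1)"
      unfolding zU Z push_lookup boundaries_lookup by (auto simp: lookup_inject)
    have "(\<lambda>m. push (v \<circ> pt) (z W) m - z V m) \<in> boundaries A V q"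
      using z W VA refV unfolding cech_cycles_def by blast
    then obtain Y' where Y': "(\<lambda>m. lookup (pushf (v \<circ> pt) Z) m - z V m) = lookup (bnd Y')"
      "keys Y' \<subseteq> nerve_keys A V (q + 1)"
      unfolding Z push_lookup boundaries_lookup by auto
    \<comment> \<open>The lists to be subdivided have \<open>q + 2\<close> entries.
      \<open>Suc L\<close> bounds this for every integer \<open>q\<close> and keeps the denominator
      positive.\<close>
    define L where "L = nat (q + 3)"
    define c1 c2 where "c1 = pushf pt Z" and "c2 = pushf (pu \<circ> \<pi>) Z"
    define H where "H = lext (prism pt (pu \<circ> \<pi>)) Z"
    have c2: "c2 = bnd (pushf pu Y)" by (simp add: c2_def Y flip: pushf_pushf pushf_bnd)
    have "lext (prism pt (pu \<circ> \<pi>)) (bnd Z) = 0" by (rule lext_augmentation[OF Z(3)]) simp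
    then have bH: "bnd H = c2 - c1"
      by (simp add: H_def bnd_lext bnd_prism lext_fun_diff c1_def c2_def pushf_def)
         (simp add: bnd_def lext_lext)
    have "keys (bnd c1) \<subseteq> {[]}"
      using Z(3) by (auto simp: c1_def dest!: keys_pushf simp flip: pushf_bnd)
    then obtain w1 where w1: "\<And>k. bnd (w1 k) = c1 - (Sd ^^ k) c1"
      "\<And>k m. m\<in>keys (w1 k) \<Longrightarrow> \<exists>l\<in>keys c1. length m = Suc (length l) \<and> set m \<subseteq> convex hull (set l)"
      using Sd_iter_homotopic[of c1] by metis
    have "(\<lambda>k. (1 - 1 / real (Suc L)) ^ k * e0) \<longlonglongrightarrow> 0"
      by (intro tendsto_mult_left_zero LIMSEQ_power_zero) auto
    from order_tendstoD(2)[OF this d(1)] obtain k where k: "(1 - 1 / real (Suc L)) ^ k * e0 < d"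
      by (auto simp: eventually_sequentially)
    \<comment> \<open>Telescoping: \<open>w1 k\<close> bounds the difference of \<open>c1\<close>
      and its subdivision, and the subdivision of \<open>c1\<close> bounds because
      \<open>c1 = c2 - bnd H\<close> and \<open>c2\<close> is the boundary of
      \<open>pushf pu Y\<close>.\<close>
    define Q where "Q = w1 k + (Sd ^^ k) (pushf pu Y) - (Sd ^^ k) H"
    have bQ: "bnd Q = c1"
    proof -
      have "bnd Q = bnd (w1 k) + bnd ((Sd ^^ k) (pushf pu Y)) - bnd ((Sd ^^ k) H)"
        by (simp only: Q_def bnd_simps)
      also have "bnd (w1 k) = c1 - (Sd ^^ k) c1" by (rule w1(1))
      also have "bnd ((Sd ^^ k) (pushf pu Y)) = (Sd ^^ k) c2" by (simp only: bnd_Sd_iter c2)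
      also have "bnd ((Sd ^^ k) H) = (Sd ^^ k) c2 - (Sd ^^ k) c1"
        by (simp only: bnd_Sd_iter bH Sd_iter_diff)
      also have "c1 - (Sd ^^ k) c1 + (Sd ^^ k) c2 - ((Sd ^^ k) c2 - (Sd ^^ k) c1) = c1"
      proof -
        have "a - b + c - (c - b) = a" for a b c :: "('a, 'f) chain" by simp
        then show ?thesis .
      qed
      finally show ?thesis .
    qed
    define small where "small = (\<lambda>C. C \<subseteq> A \<and> (\<forall>x\<in>C. \<forall>y\<in>C. dist x y \<le> e0))"
    \<comment> \<open>Two scales are recorded: the hull of a set of diameter \<open>e0\<close>,
      which is where \<open>\<rho>\<close> is controlled, and diameter \<open>d\<close>, which makes
      the image under \<open>\<rho>\<close> fit into a member of \<open>V\<close>. Subdivision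
      provides the second one, except for \<open>w1 k\<close>, whose simplices lie in hulls of
      diameter at most \<open>4 * \<eta>\<close>.\<close>
    have keysQ: "\<exists>C. small C \<and> set m \<subseteq> convex hull C \<and> (\<forall>x\<in>set m. \<forall>y\<in>set m. dist x y \<le> d)
      \<and> int (length m) = q + 2 \<and> m \<noteq> []"
      if mQ: "m \<in> keys Q" for m
    proof -
      consider "m \<in> keys (w1 k)" | "m \<in> keys ((Sd ^^ k) (pushf pu Y))" | "m \<in> keys ((Sd ^^ k) H)"
        using keys_diff_cases[OF mQ[unfolded Q_def]] keys_add_cases[of m "w1 k"
          "(Sd ^^ k) (pushf pu Y)"]
        by argo
      then show ?thesis
      proof cases
        case 1
        then obtain l where l: "l \<in> keys c1" "length m = Suc (length l)"
          "set m \<subseteq> convex hull (set l)"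
          using w1(2) by blast
        obtain l' where l': "l = map pt l'" "l' \<in> nerve_keys A W q"
          using keys_pushf[OF l(1)[unfolded c1_def]] Z(2) by blast
        obtain y where y: "y \<in> A" "\<And>u. u \<in> set l' \<Longrightarrow> y \<in> u" "set l' \<subseteq> W" "int (length l') = q + 1"
          using l'(2) nerve_simplex_witness by metis
        have D: "dist a b \<le> 4 * \<eta>" if "a \<in> set l" "b \<in> set l" for a b
        proof -
          have "dist x y \<le> 2 * \<eta>" if "x \<in> set l" for x
            using that l' y(2,3) Wdist[of _ x y] pt by fastforce
          from this[OF that(1)] this[OF that(2)] show ?thesis using dist_triangle2[of a b y] by simp
        qed
        have "small (set l)" unfolding small_def using D \<eta>(2) e1 l' y(3) pt by fastforce
        moreover have "dist a b \<le> d" if "a \<in> set m" "b \<in> set m" for a b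
          using dist_hull_hull_le[of "set l" "4 * \<eta>" a b] D l(3) that \<eta>(4) by force
        ultimately show ?thesis using l l' y(4) by (intro exI[of _ "set l"]) auto
      next
        case 2
        have pY: "small (set l) \<and> int (length l) = q + 2 \<and> l \<noteq> []" if lY: "l \<in> keys (pushf pu Y)"
          for l
        proof -
          obtain l' where l': "l = map pu l'" "l' \<in> nerve_keys A U (q + 1)"
            using keys_pushf[OF lY] Y(2) by blast
          obtain y where y: "y \<in> A" "\<And>u. u \<in> set l' \<Longrightarrow> y \<in> u" "set l' \<subseteq> U" "l' \<noteq> []"
            "int (length l') = q + 1 + 1"
            using l'(2) nerve_simplex_witness by metis
          have 1: "dist x y \<le> 2 * e1" if "x \<in> set l" for x
            using that l' y(1,2,3) Udist[of _ x y] pu by fastforce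
          have "dist a b \<le> e0" if "a \<in> set l" "b \<in> set l" for a b
            using 1[OF that(1)] 1[OF that(2)] dist_triangle2[of a b y] e1 by simp
          moreover have "set l \<subseteq> A" using l' y(1,2) pu by auto
          ultimately show ?thesis using l' y(4,5) by (auto simp: small_def)
        qed
        obtain l where l: "l \<in> keys (pushf pu Y)" "length m = length l"
          "set m \<subseteq> convex hull (set l)"
          using keys_Sd_iter[OF 2] by blast
        have bounds: "length l \<le> Suc L \<and> (\<forall>x\<in>set l. \<forall>y\<in>set l. dist x y \<le> e0)"
          if "l \<in> keys (pushf pu Y)" for l
          using pY[OF that] by (auto simp: small_def L_def)
        have "dist x y \<le> (1 - 1 / real (Suc L)) ^ k * e0" if "x \<in> set m" "y \<in> set m" for x y
          by (rule Sd_iter_mesh[OF _ _ 2 that]) (use bounds in auto)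
        then show ?thesis using pY[OF l(1)] l k by (intro exI[of _ "set l"]) fastforce
      next
        case 3
        have pH: "small (set l) \<and> int (length l) = q + 2 \<and> l \<noteq> []" if lH: "l \<in> keys H" for l
        proof -
          obtain l' where l': "l \<in> keys (prism pt (pu \<circ> \<pi>) l' :: ('a, 'f) chain)"
            "l' \<in> nerve_keys A W q"
            using keys_lext[OF lH[unfolded H_def]] Z(2) by blast
          have len: "length l = Suc (length l')" "set l \<subseteq> pt ` set l' \<union> (pu \<circ> \<pi>) ` set l'"
            using keys_prism[OF l'(1)] by auto
          obtain y where y: "y \<in> A" "\<And>u. u \<in> set l' \<Longrightarrow> y \<in> u" "set l' \<subseteq> W" "int (length l') = q + 1"
            using l'(2) nerve_simplex_witness by metis
          have 1: "dist x y \<le> 2 * e1 \<and> x \<in> A" if x: "x \<in> set l" for x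
          proof -
            obtain w where w: "w \<in> set l'" "x = pt w \<or> x = pu (\<pi> w)" using x len(2) by auto
            then have "w \<in> W" "y \<in> w" using y by auto
            from w(2) show ?thesis
            proof
              assume "x = pt w"
              then show ?thesis using Wdist[of w x y] pt[of w] \<open>w \<in> W\<close> \<open>y \<in> w\<close> \<eta>(2) by auto
            next
              assume "x = pu (\<pi> w)"
              then show ?thesis using Udist[of "\<pi> w" x y] \<pi>[of w] pu[of y "\<pi> w"] y(1) \<open>w \<in> W\<close>
                \<open>y \<in> w\<close> by auto
            qed
          qed
          have "dist a b \<le> e0" if "a \<in> set l" "b \<in> set l" for a b
            using 1[OF that(1)] 1[OF that(2)] dist_triangle2[of a b y] e1 by simp
          then show ?thesis using 1 len(1) y(4) by (auto simp: small_def)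
        qed
        obtain l where l: "l \<in> keys H" "length m = length l" "set m \<subseteq> convex hull (set l)"
          using keys_Sd_iter[OF 3] by blast
        have bounds: "length l \<le> Suc L \<and> (\<forall>x\<in>set l. \<forall>y\<in>set l. dist x y \<le> e0)" if "l \<in> keys H" for l
          using pH[OF that] by (auto simp: small_def L_def)
        have "dist x y \<le> (1 - 1 / real (Suc L)) ^ k * e0" if "x \<in> set m" "y \<in> set m" for x y
          by (rule Sd_iter_mesh[OF _ _ 3 that]) (use bounds in auto)
        then show ?thesis using pH[OF l(1)] l k by (intro exI[of _ "set l"]) fastforce
      qed
    qed
    have "pushf (v \<circ> \<rho>) c1 = pushf (v \<circ> pt) Z"
    proof -
      have "pushf (v \<circ> \<rho> \<circ> pt) Z = pushf (v \<circ> pt) Z"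
      proof (rule pushf_cong)
        fix l w assume "l \<in> keys Z" "w \<in> set l"
        then have "w \<in> W" using Z(2) by (auto simp: nerve_keys_def nerve_simplex_def)
        then show "(v \<circ> \<rho> \<circ> pt) w = (v \<circ> pt) w" using pt \<rho>_id by simp
      qed
      then show ?thesis by (simp add: c1_def pushf_pushf)
    qed
    then have eq: "pushf (v \<circ> pt) Z = bnd (pushf (v \<circ> \<rho>) Q)" by (simp add: bQ flip: pushf_bnd)
    have keysQ': "keys (pushf (v \<circ> \<rho>) Q) \<subseteq> nerve_keys B V (q + 1)"
    proof
      fix m assume "m \<in> keys (pushf (v \<circ> \<rho>) Q)"
      from keys_pushf[OF this] obtain l where l: "l \<in> keys Q" "m = map (v \<circ> \<rho>) l" by blast
      obtain C where C: "small C" "set l \<subseteq> convex hull C" "\<forall>x\<in>set l. \<forall>y\<in>set l. dist x y \<le> d"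
        "int (length l) = q + 2" "l \<noteq> []" using keysQ[OF l(1)] by blast
      have B: "\<rho> x \<in> B" if "x \<in> set l" for x
        using \<rho>_hull[of C x] C(1,2) that by (auto simp: small_def)
      have near: "dist (\<rho> x) (\<rho> y) < e" if "x \<in> set l" "y \<in> set l" for x y
        using d(2)[of C x y] C that by (auto simp: small_def)
      \<comment> \<open>The image of the first vertex is a common point: it is within
        \<open>e\<close> of every \<open>\<rho> x\<close>, and \<open>v (\<rho> x)\<close> contains
        the ball of radius \<open>e\<close> around \<open>\<rho> x\<close>.\<close>
      have hd: "hd l \<in> set l" using C(5) by simp
      have "\<rho> (hd l) \<in> v (\<rho> x)" if "x \<in> set l" for x
        using v[OF B[OF that]] near[OF that hd] by auto
      then have "B \<inter> \<Inter> (set m) \<noteq> {}" using B[OF hd] l(2) by auto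
      then show "m \<in> nerve_keys B V (q + 1)" using l(2) C v[OF B]
        by (auto simp: nerve_keys_def nerve_simplex_def)
    qed
    have "z V = lookup (bnd (pushf (v \<circ> \<rho>) Q - Y'))"
    proof
      fix m show "z V m = lookup (bnd (pushf (v \<circ> \<rho>) Q - Y')) m"
        using fun_cong[OF Y'(1), of m] by (simp add: lookup_minus algebra_simps flip: eq)
    qed
    moreover have "keys (pushf (v \<circ> \<rho>) Q - Y') \<subseteq> nerve_keys B V (q + 1)"
      using keysQ' Y'(2) nerve_keys_mono[OF assms(3)] by (blast dest: keys_diff_cases)
    ultimately show "z V \<in> boundaries B V q" unfolding boundaries_lookup by blast
  qed
qed

section \<open>Finiteness of the rank\<close>

lemma boundaries_lincomb:
  assumes "b \<in> (boundaries X V q :: ('a set list \<Rightarrow> 'f::field) set)" "b' \<in> boundaries X V q"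
  shows "(\<lambda>m. a * b m + b' m) \<in> boundaries X V q"
proof -
  obtain c c' where c: "keys c \<subseteq> nerve_keys X V (q + 1)" "b = lookup (bnd c)"
    and c': "keys c' \<subseteq> nerve_keys X V (q + 1)" "b' = lookup (bnd c')"
    using assms unfolding boundaries_lookup by blast
  have "(\<lambda>m. a * b m + b' m) = lookup (bnd (smul a c + c'))"
    by (rule ext) (simp add: c c' bnd_def lext_add lext_smul lookup_add)
  moreover have "keys (smul a c + c') \<subseteq> nerve_keys X V (q + 1)"
    using c(1) c'(1) keys_smul[of a c] by (blast dest: keys_add_cases)
  ultimately show ?thesis unfolding boundaries_lookup by blast
qed

lemma boundaries_zero: "(\<lambda>_. 0) \<in> (boundaries X V q :: ('a set list \<Rightarrow> 'f::field) set)"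
  unfolding boundaries_lookup by (rule image_eqI[of _ _ 0]) auto

lemma cycles_lincomb:
  assumes "b \<in> (cycles X V q :: ('a set list \<Rightarrow> 'f::field) set)" "b' \<in> cycles X V q"
  shows "(\<lambda>m. a * b m + b' m) \<in> cycles X V q"
    and "push \<pi> (\<lambda>m. a * b m + b' m) m = a * push \<pi> b m + push \<pi> b' m"
proof -
  obtain c c' where c: "b = lookup c" "keys c \<subseteq> nerve_keys X V q" "keys (bnd c) \<subseteq> {[]}"
    and c': "b' = lookup c'" "keys c' \<subseteq> nerve_keys X V q" "keys (bnd c') \<subseteq> {[]}"
    using assms cycle_lookup by metis
  have eq: "(\<lambda>m. a * b m + b' m) = lookup (smul a c + c')"
    by (rule ext) (simp add: c c' lookup_add)
  have "keys (smul a c + c') \<subseteq> nerve_keys X V q"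
    using c(2) c'(2) keys_smul[of a c] by (blast dest: keys_add_cases)
  moreover have "lookup (bnd (smul a c + c')) m = 0" if "m \<noteq> []" for m
  proof -
    have "lookup (bnd c) m = 0" "lookup (bnd c') m = 0" using that c(3) c'(3)
      by (auto simp: in_keys_iff)
    then show ?thesis by (simp add: bnd_def lext_add lext_smul lookup_add)
  qed
  ultimately show "(\<lambda>m. a * b m + b' m) \<in> cycles X V q"
    unfolding eq cycles_def chains_lookup by (auto simp: bd_lookup)
  show "push \<pi> (\<lambda>m. a * b m + b' m) m = a * push \<pi> b m + push \<pi> b' m"
    unfolding eq by (simp add: c c' push_lookup pushf_def lext_add lext_smul lookup_add)
qed

lemma cycles_zero: "(\<lambda>_. 0) \<in> (cycles X V q :: ('a set list \<Rightarrow> 'f::field) set)"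
  by (auto simp: cycles_def chains_def bd_def)

lemma boundaries_mono: "X \<subseteq> Y \<Longrightarrow>
  (boundaries X V q :: ('a set list \<Rightarrow> 'f::field) set) \<subseteq> boundaries Y V q"
  unfolding boundaries_lookup using nerve_keys_mono[of X Y V "q + 1"] by blast

lemma cycles_mono: "X \<subseteq> Y \<Longrightarrow> (cycles X V q :: ('a set list \<Rightarrow> 'f::field) set) \<subseteq> cycles Y V q"
  by (fastforce simp: cycles_def chains_def nerve_simplex_def)

definition fscale :: "'f::field \<Rightarrow> ('a, 'f) cech_family \<Rightarrow> ('a, 'f) cech_family" where
  "fscale a z = (\<lambda>U m. a * z U m)"

text \<open>The vectors are arbitrary families over all sets of sets, so a single space contains the
  cycles and the null families of every subspace. Values at non-covers stay unconstrained, and null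
  families ignore them too.\<close>

interpretation family: mod_dimension fscale
  by unfold_locales (auto simp: fscale_def fun_eq_iff algebra_simps)

definition cech_null :: "'a::topological_space set \<Rightarrow> int \<Rightarrow> ('a, 'f::field) cech_family set" where
  "cech_null B q = {z. \<forall>V. is_cover B V \<longrightarrow> z V \<in> boundaries B V q}"

lemma subspace_lincombI:
  assumes "0 \<in> S" "\<And>a x y. x \<in> S \<Longrightarrow> y \<in> S \<Longrightarrow> fscale a x + y \<in> S"
  shows "family.subspace S"
proof (rule family.subspaceI)
  show "x + y \<in> S" if "x \<in> S" "y \<in> S" for x y using assms(2)[OF that, of 1] by simp
  show "fscale c x \<in> S" if "x \<in> S" for c x using assms(2)[OF that assms(1), of c] by simp
qed (use assms in auto)

lemma subspace_cech_null: "family.subspace (cech_null B q)"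
  by (rule subspace_lincombI)
    (auto simp: cech_null_def fscale_def plus_fun_def zero_fun_def boundaries_zero
      boundaries_lincomb)

lemma subspace_cech_cycles:
  "family.subspace (cech_cycles X q :: ('a::topological_space set set \<Rightarrow> 'a set list \<Rightarrow>
    'f::field) set)"
proof (rule subspace_lincombI)
  show "0 \<in> cech_cycles X q"
    by (auto simp: cech_cycles_def zero_fun_def cycles_zero push_def boundaries_zero)
next
  fix a :: 'f and x y :: "('a, 'f) cech_family"
  assume x: "x \<in> cech_cycles X q" and y: "y \<in> cech_cycles X q"
  show "fscale a x + y \<in> cech_cycles X q"
    unfolding cech_cycles_def
  proof (clarify, intro conjI allI impI)
    fix U assume U: "is_cover X U"
    have c: "x U \<in> cycles X U q" "y U \<in> cycles X U q" using x y U by (auto simp: cech_cycles_def)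
    show "(fscale a x + y) U \<in> cycles X U q"
      using cycles_lincomb(1)[OF c, of a] by (simp add: fscale_def plus_fun_def)
    fix V \<pi> assume V: "is_cover X V \<and> is_refinement X U V \<pi>"
    have "(\<lambda>m. push \<pi> (x U) m - x V m) \<in> boundaries X V q"
      "(\<lambda>m. push \<pi> (y U) m - y V m) \<in> boundaries X V q"
      using x y U V unfolding cech_cycles_def by blast+
    from boundaries_lincomb[OF this, of a]
    have "(\<lambda>m. a * (push \<pi> (x U) m - x V m) + (push \<pi> (y U) m - y V m)) \<in> boundaries X V q" .
    moreover have "push \<pi> ((fscale a x + y) U) m - (fscale a x + y) V m =
        a * (push \<pi> (x U) m - x V m) + (push \<pi> (y U) m - y V m)" for m
    proof -
      have "(fscale a x + y) U = (\<lambda>m. a * x U m + y U m)" by (auto simp: fscale_def)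
      then have "push \<pi> ((fscale a x + y) U) m = a * push \<pi> (x U) m + push \<pi> (y U) m"
        using cycles_lincomb(2)[OF c, of \<pi> a m] by simp
      then show ?thesis by (simp add: fscale_def algebra_simps)
    qed
    ultimately show "(\<lambda>m. push \<pi> ((fscale a x + y) U) m - (fscale a x + y) V m) \<in> boundaries X V q"
      by (simp only:)
  qed
qed

lemma cech_cycles_mono:
  assumes "X \<subseteq> Y"
  shows "(cech_cycles X q :: ('a::topological_space set set \<Rightarrow> 'a set list \<Rightarrow> 'f::field) set) \<subseteq>
    cech_cycles Y q"
proof
  fix z :: "('a, 'f) cech_family" assume z: "z \<in> cech_cycles X q"
  show "z \<in> cech_cycles Y q" unfolding cech_cycles_def
  proof (clarify, intro conjI allI impI)
    fix U assume "is_cover Y U"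
    then have U: "is_cover X U" using assms by (auto simp: is_cover_def)
    then have "z U \<in> cycles X U q" using z unfolding cech_cycles_def by blast
    then show "z U \<in> cycles Y U q" using cycles_mono[OF assms] by blast
    fix V \<pi> assume "is_cover Y V \<and> is_refinement Y U V \<pi>"
    then have "is_cover X V \<and> is_refinement X U V \<pi>" 
      using assms unfolding is_cover_def is_refinement_def by blast
    then have "(\<lambda>m. push \<pi> (z U) m - z V m) \<in> boundaries X V q" using z U unfolding cech_cycles_def
      by blast
    then show "(\<lambda>m. push \<pi> (z U) m - z V m) \<in> boundaries Y V q" using boundaries_mono[OF assms]
      by blast
  qed
qed

lemma cech_null_mono:
  "X \<subseteq> Y \<Longrightarrow> (cech_null X q :: ('a::topological_space set set \<Rightarrow> 'a set list \<Rightarrow> 'f::field) set) \<subseteq>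
    cech_null Y q"
proof
  fix z :: "('a, 'f) cech_family" assume "X \<subseteq> Y" and z: "z \<in> cech_null X q"
  show "z \<in> cech_null Y q" unfolding cech_null_def
  proof clarify
    fix V assume "is_cover Y V"
    then have "is_cover X V" using \<open>X \<subseteq> Y\<close> by (auto simp: is_cover_def)
    then have "z V \<in> boundaries X V q" using z by (simp add: cech_null_def)
    then show "z V \<in> boundaries Y V q" using boundaries_mono[OF \<open>X \<subseteq> Y\<close>] by blast
  qed
qed

lemma family_sum_apply: "(\<Sum>j<n. fscale (c j) (z j)) V m = (\<Sum>j<n. c j * z j V m)" for n :: nat
  by (induction n) (auto simp: fscale_def)

lemma cech_rank_dim_mod:
  "cech_rank (F :: 'f::field itself) A B q =
    family.dim_mod (cech_cycles A q) (cech_null B q :: (_ \<Rightarrow> _ \<Rightarrow> 'f) set)"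
proof -
  have "(\<Sum>j<n. fscale (c j) (z j)) \<notin> cech_null B q \<longleftrightarrow>
     (\<exists>V. is_cover B V \<and> (\<lambda>m. \<Sum>j<n. c j * z j V m) \<notin> boundaries B V q)" for n and c :: "nat \<Rightarrow>
       'f" and z
  proof -
    have "(\<Sum>j<n. fscale (c j) (z j)) V = (\<lambda>m. \<Sum>j<n. c j * z j V m)" for V
      by (rule ext) (rule family_sum_apply)
    then show ?thesis by (simp add: cech_null_def)
  qed
  then show ?thesis unfolding cech_rank_def family.dim_mod_def family.indep_mod_def by simp
qed

text \<open>At the finite cover \<open>U\<close> a cycle is supported on the finite set
  \<open>S\<close> of lists. Among more than \<open>card S\<close> families some nontrivial
  combination vanishes at \<open>U\<close>, and such a combination dies in \<open>B\<close>.\<close>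

lemma cech_rank_finite:
  fixes A B :: "'a::euclidean_space set" and \<rho> :: "'a \<Rightarrow> 'a"
  assumes "compact A" "compact B" "A \<subseteq> B" "e0 > 0"
    and "\<And>x. x \<in> A \<Longrightarrow> \<rho> x = x"
    and "\<And>C x. C \<subseteq> A \<Longrightarrow> (\<And>x y. x \<in> C \<Longrightarrow> y \<in> C \<Longrightarrow> dist x y \<le> e0) \<Longrightarrow> x \<in> convex hull C \<Longrightarrow> \<rho> x \<in> B"
    and "\<And>e. e > 0 \<Longrightarrow> \<exists>d>0. \<forall>C x y. C \<subseteq> A \<longrightarrow> (\<forall>x\<in>C. \<forall>y\<in>C. dist x y \<le> e0) \<longrightarrow>
        x \<in> convex hull C \<longrightarrow> y \<in> convex hull C \<longrightarrow> dist x y \<le> d \<longrightarrow> dist (\<rho> x) (\<rho> y) < e"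
  shows "cech_rank (F :: 'f::field itself) A B q \<noteq> \<infinity>"
proof -
  obtain U where U: "finite U" "is_cover A U"
    "\<And>z V. z \<in> (cech_cycles A q :: ('a, 'f::field) cech_family set) \<Longrightarrow> z U = (\<lambda>_. 0) \<Longrightarrow> is_cover B V \<Longrightarrow>
      z V \<in> boundaries B V q"
    by (rule cech_kernel_finite_cover[OF assms, where q = q and 'f = 'f]) blast+
  define S where "S = {l. set l \<subseteq> U \<and> length l = nat (q + 1)}"
  have S: "finite S" unfolding S_def by (rule finite_lists_length_eq[OF U(1)])
  have "family.dim_mod (cech_cycles A q) (cech_null B q :: (_ \<Rightarrow> _ \<Rightarrow> 'f) set) \<le> enat (card S)"
  proof (rule family.dim_mod_le)
    fix n and z :: "nat \<Rightarrow> ('a, 'f) cech_family"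
    assume z: "\<And>j. j < n \<Longrightarrow> z j \<in> cech_cycles A q" "family.indep_mod (cech_null B q) n z"
    show "enat n \<le> enat (card S)"
    proof (rule ccontr)
      assume "\<not> ?thesis"
      then have "card S < n" by simp
      from dependent_combination[OF S this, of "\<lambda>j. z j U"] obtain c where
        c: "\<exists>j<n. c j \<noteq> 0" "\<forall>s\<in>S. (\<Sum>j<n. c j * z j U s) = 0" by blast
      let ?z = "\<Sum>j<n. fscale (c j) (z j)"
      have "?z \<in> cech_cycles A q"
        by (intro family.subspace_sum family.subspace_scale subspace_cech_cycles) (use z in auto)
      moreover have "?z U = (\<lambda>_. 0)"
      proof
        fix m
        show "?z U m = 0"
        proof (cases "m \<in> S")
          case False
          have "z j U m = 0" if "j < n" for j
          proof (rule ccontr)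
            assume nz: "z j U m \<noteq> 0"
            have "z j U \<in> chains A U q" using z(1)[OF that] U(2)
              by (auto simp: cech_cycles_def cycles_def)
            then have "nerve_simplex A U m" "int (length m) = q + 1" using nz
              by (auto simp: chains_def)
            then show False using False by (auto simp: S_def nerve_simplex_def)
          qed
          then show ?thesis by (simp add: family_sum_apply)
        qed (use c in \<open>simp add: family_sum_apply\<close>)
      qed
      ultimately have "?z \<in> cech_null B q" using U(3) by (auto simp: cech_null_def)
      then show False using z(2) c(1) by (auto simp: family.indep_mod_def)
    qed
  qed
  then show ?thesis unfolding cech_rank_dim_mod by (auto dest: antisym)
qed

section \<open>Polyhedra are neighbourhood retracts\<close>

lemma closed_support_subset:
  "closed {p :: nat \<Rightarrow> real. (\<forall>i. 0 \<le> p i) \<and> (\<forall>i. i \<notin> \<sigma> \<longrightarrow> p i = 0) \<and> (\<Sum>i\<in>\<sigma>. p i) = 1}"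
proof -
  have c: "continuous_on UNIV (\<lambda>p :: nat \<Rightarrow> real. p i)" for i
    by (rule continuous_on_product_coordinates)
  have "closed {p :: nat \<Rightarrow> real. i \<notin> \<sigma> \<longrightarrow> p i = 0}" for i
    by (cases "i \<in> \<sigma>") (auto intro!: closed_Collect_eq c continuous_intros)
  moreover have "closed {p :: nat \<Rightarrow> real. (\<Sum>i\<in>\<sigma>. p i) = 1}"
    by (intro closed_Collect_eq continuous_on_sum c continuous_intros)
  moreover have "closed {p :: nat \<Rightarrow> real. 0 \<le> p i}" for i
    by (intro closed_Collect_le c continuous_intros)
  ultimately show ?thesis by (intro closed_Collect_conj closed_Collect_all)
qed

text \<open>The pieces of exact support \<open>\<sigma>\<close> are not closed in general. Allowing
  smaller support gives closed faces, and there are finitely many of them.\<close>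

lemma polyhedron_of_eq_Union:
  assumes "abs_simplicial_complex S"
  shows "polyhedron_of S =
    (\<Union>\<sigma>\<in>S. {p. (\<forall>i. 0 \<le> p i) \<and> (\<forall>i. i \<notin> \<sigma> \<longrightarrow> p i = 0) \<and> (\<Sum>i\<in>\<sigma>. p i) = 1})" (is "_ = (\<Union>\<sigma>\<in>S. ?F \<sigma>)")
proof (intro subset_antisym subsetI)
  fix p assume "p \<in> polyhedron_of S"
  then show "p \<in> (\<Union>\<sigma>\<in>S. ?F \<sigma>)" by (auto simp: polyhedron_of_def intro!: bexI[of _ "{i. p i \<noteq> 0}"])
next
  fix p assume "p \<in> (\<Union>\<sigma>\<in>S. ?F \<sigma>)"
  then obtain \<sigma> where \<sigma>: "\<sigma> \<in> S" "\<forall>i. 0 \<le> p i" "\<forall>i. i \<notin> \<sigma> \<longrightarrow> p i = 0" "(\<Sum>i\<in>\<sigma>. p i) = 1" by auto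
  have sub: "{i. p i \<noteq> 0} \<subseteq> \<sigma>" using \<sigma> by auto
  have fin: "finite \<sigma>" using \<sigma> assms by (auto simp: abs_simplicial_complex_def)
  have eq: "(\<Sum>i\<in>{i. p i \<noteq> 0}. p i) = (\<Sum>i\<in>\<sigma>. p i)"
    by (rule sum.mono_neutral_left) (use fin sub in auto)
  have "{i. p i \<noteq> 0} \<noteq> {}"
  proof
    assume e: "{i. p i \<noteq> 0} = {}"
    from eq[unfolded e] \<sigma>(4) show False by simp
  qed
  then have "{i. p i \<noteq> 0} \<in> S" using \<sigma>(1) sub assms unfolding abs_simplicial_complex_def by blast
  then show "p \<in> polyhedron_of S" using eq \<sigma> by (simp add: polyhedron_of_def)
qed

text \<open>A closed subset of the cube of functions into \<open>{0..1}\<close>, which is compact by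
  Tychonoff.\<close>

lemma compact_polyhedron_of:
  assumes "abs_simplicial_complex S"
  shows "compact (polyhedron_of S)"
proof -
  have "finite S" using assms by (simp add: abs_simplicial_complex_def)
  then have cl: "closed (polyhedron_of S)"
    unfolding polyhedron_of_eq_Union[OF assms] using closed_support_subset by (intro closed_UN) auto
  have "compactin (product_topology (\<lambda>i. euclidean) UNIV) (\<Pi>\<^sub>E i\<in>(UNIV :: nat set). {0..1::real})"
    by (simp add: compactin_PiE)
  then have "compact ((\<Pi>\<^sub>E i\<in>(UNIV :: nat set). {0..1::real}))"
    by (simp add: euclidean_product_topology)
  moreover have "polyhedron_of S \<subseteq> (\<Pi>\<^sub>E i\<in>UNIV. {0..1})"
  proof
    fix p assume p: "p \<in> polyhedron_of S"
    have "p i \<le> 1" for i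
    proof (cases "p i = 0")
      case False
      have "{i. p i \<noteq> 0} \<in> S" using p by (simp add: polyhedron_of_def)
      then have "finite {i. p i \<noteq> 0}" using assms unfolding abs_simplicial_complex_def by blast
      then have "p i \<le> (\<Sum>i\<in>{i. p i \<noteq> 0}. p i)"
        using False p by (intro member_le_sum) (auto simp: polyhedron_of_def)
      then show ?thesis using p by (simp add: polyhedron_of_def)
    qed simp
    then show "p \<in> (\<Pi>\<^sub>E i\<in>UNIV. {0..1})" using p by (auto simp: polyhedron_of_def PiE_def)
  qed
  ultimately show ?thesis using cl compact_Int_closed by (metis inf.absorb2)
qed

lemma triangulable_compact: "triangulable D \<Longrightarrow> compact D"
  unfolding triangulable_def using compact_polyhedron_of homeomorphic_compactness by blast

lemma continuous_on_Min_image: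
  fixes m :: "'i \<Rightarrow> 'a::topological_space \<Rightarrow> real"
  assumes "finite S" "S \<noteq> {}" "\<And>\<sigma>. continuous_on X (m \<sigma>)"
  shows "continuous_on X (\<lambda>x. Min ((\<lambda>\<sigma>. m \<sigma> x) ` S))"
  using assms(1,2)
proof (induction S rule: finite_ne_induct)
  case (insert \<sigma> S)
  then show ?case using assms(3) by (auto intro!: continuous_on_min)
qed (use assms in auto)

text \<open>The coordinates of a triangulation extend to the whole space. Subtracting the distance
  \<open>\<theta>\<close> to the nearest simplex and normalising brings them back into the polyhedron.\<close>

lemma triangulable_neighbourhood_retract:
  fixes D :: "'a::euclidean_space set"
  assumes "triangulable D"
  obtains N \<rho> where "open N" "D \<subseteq> N" "continuous_on N \<rho>" "\<rho> ` N \<subseteq> D" "\<And>x. x \<in> D \<Longrightarrow> \<rho> x = x"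
proof (cases "D = {}")
  case True
  then show thesis using that[of "{}" id] by auto
next
  case False
  obtain S h k where S: "abs_simplicial_complex S" and hk: "homeomorphism D (polyhedron_of S) h k"
    using assms unfolding triangulable_def homeomorphic_def by blast
  have finS: "finite S" and finsimplex: "\<And>\<sigma>. \<sigma> \<in> S \<Longrightarrow> finite \<sigma>"
    using S by (auto simp: abs_simplicial_complex_def)
  define V where "V = \<Union>S"
  have V: "finite V" using finS finsimplex by (auto simp: V_def)
  have h: "continuous_on D h" "\<And>x. x \<in> D \<Longrightarrow> h x \<in> polyhedron_of S" "\<And>x. x \<in> D \<Longrightarrow> k (h x) = x"
    and k: "continuous_on (polyhedron_of S) k" "\<And>p. p \<in> polyhedron_of S \<Longrightarrow> k p \<in> D"
    using hk by (auto simp: homeomorphism_def)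
  have Sne: "S \<noteq> {}" using False h(2) by (auto simp: polyhedron_of_def)
  have "\<exists>g. continuous_on UNIV g \<and> (\<forall>x\<in>D. g x = h x i)" for i
  proof -
    have "continuous_on D (\<lambda>x. h x i)" by (rule continuous_on_product_then_coordinatewise[OF h(1)])
    moreover have "closedin (top_of_set UNIV) D"
      using triangulable_compact[OF assms] by (auto simp: compact_imp_closed)
    ultimately show ?thesis using Tietze_unbounded by metis
  qed
  then obtain g where g: "\<And>i. continuous_on UNIV (g i)" "\<And>i x. x \<in> D \<Longrightarrow> g i x = h x i" by metis
  define m where "m = (\<lambda>\<sigma> x. \<Sum>i\<in>V - \<sigma>. max 0 (g i x))"
  define \<theta> where "\<theta> = (\<lambda>x. Min ((\<lambda>\<sigma>. m \<sigma> x) ` S))"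
  define p where "p = (\<lambda>x i. if i \<in> V then max 0 (g i x - \<theta> x) else 0)"
  define P where "P = (\<lambda>x. \<Sum>i\<in>V. p x i)"
  define \<phi> where "\<phi> = (\<lambda>x i. p x i / P x)"
  define N where "N = {x. P x > 0}"
  have cm: "continuous_on UNIV (m \<sigma>)" for \<sigma> unfolding m_def by (intro continuous_intros g)
  have c\<theta>: "continuous_on UNIV \<theta>" unfolding \<theta>_def by (rule continuous_on_Min_image[OF finS Sne cm])
  have cp: "continuous_on UNIV (\<lambda>x. p x i)" for i
    by (cases "i \<in> V") (auto simp: p_def intro!: continuous_intros g c\<theta>)
  have cP: "continuous_on UNIV P" unfolding P_def by (intro continuous_intros cp)
  have p0: "0 \<le> p x i" for x i by (simp add: p_def)
  have m0: "0 \<le> m \<sigma> x" for \<sigma> x by (auto simp: m_def intro: sum_nonneg)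
  \<comment> \<open>The support of \<open>h x\<close> is a simplex \<open>\<sigma>\<close> with
    \<open>m \<sigma> x = 0\<close>. So nothing is subtracted, and the coordinates already sum to
    1.\<close>
  have onD: "P x = 1 \<and> \<phi> x = h x" if x: "x \<in> D" for x
  proof -
    define \<sigma> where "\<sigma> = {i. h x i \<noteq> 0}"
    have \<sigma>: "\<sigma> \<in> S" "\<forall>i. 0 \<le> h x i" "(\<Sum>i\<in>\<sigma>. h x i) = 1"
      using h(2)[OF x] by (auto simp: polyhedron_of_def \<sigma>_def)
    have "m \<sigma> x = 0" by (auto simp: m_def g(2)[OF x] \<sigma>_def)
    then have \<theta>: "\<theta> x = 0" unfolding \<theta>_def using finS \<sigma>(1) m0
      by (intro Min_eqI) (auto intro: rev_image_eqI)
    have out: "h x i = 0" if "i \<notin> V" for i using that \<sigma>(1) by (auto simp: V_def \<sigma>_def)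
    have px: "p x = h x" by (rule ext) (auto simp: p_def \<theta> g(2)[OF x] \<sigma>(2) out)
    have "P x = (\<Sum>i\<in>V. h x i)" by (simp add: P_def px)
    also have "\<dots> = (\<Sum>i\<in>\<sigma>. h x i)"
      by (rule sum.mono_neutral_right) (use V \<sigma>(1) in \<open>auto simp: V_def \<sigma>_def\<close>)
    finally have "P x = 1" using \<sigma> by simp
    then show ?thesis using px by (simp add: \<phi>_def)
  qed
  have inN: "\<phi> x \<in> polyhedron_of S" if x: "x \<in> N" for x
  proof -
    have Px: "P x > 0" using x by (simp add: N_def)
    have "\<theta> x \<in> (\<lambda>\<sigma>. m \<sigma> x) ` S" unfolding \<theta>_def using finS Sne by (intro Min_in) auto
    then obtain \<sigma> where \<sigma>: "\<sigma> \<in> S" "\<theta> x = m \<sigma> x" by auto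
    \<comment> \<open>If \<open>\<sigma>\<close> realises the minimum, a coordinate outside
      \<open>\<sigma>\<close> is one summand of \<open>m \<sigma> x = \<theta> x\<close>;
      subtracting \<open>\<theta> x\<close> kills it. All surviving coordinates belong to a single
      simplex.\<close>
    have supp: "i \<in> \<sigma>" if "p x i \<noteq> 0" for i
    proof (rule ccontr)
      assume "i \<notin> \<sigma>"
      have i: "i \<in> V" "g i x > \<theta> x" using that by (auto simp: p_def split: if_splits)
      have "g i x \<le> max 0 (g i x)" by simp
      also have "\<dots> \<le> m \<sigma> x" unfolding m_def using i \<open>i \<notin> \<sigma>\<close> V
        by (intro member_le_sum[of i "V - \<sigma>" "\<lambda>i. max 0 (g i x)"]) auto
      finally show False using i \<sigma> by simp
    qed
    have supp': "{i. \<phi> x i \<noteq> 0} = {i. p x i \<noteq> 0}" using Px by (auto simp: \<phi>_def)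
    have "{i. p x i \<noteq> 0} \<noteq> {}"
    proof
      assume "{i. p x i \<noteq> 0} = {}"
      then have "P x = 0" by (simp add: P_def)
      then show False using Px by simp
    qed
    moreover have "{i. p x i \<noteq> 0} \<subseteq> \<sigma>" using supp by auto
    ultimately have "{i. \<phi> x i \<noteq> 0} \<in> S" using \<sigma>(1) S unfolding abs_simplicial_complex_def supp'
      by blast
    moreover have "(\<Sum>i\<in>{i. \<phi> x i \<noteq> 0}. \<phi> x i) = (\<Sum>i\<in>V. \<phi> x i)"
      by (rule sum.mono_neutral_left) (use V in \<open>auto simp: \<phi>_def p_def\<close>)
    moreover have "(\<Sum>i\<in>V. \<phi> x i) = 1" using Px
      by (simp add: \<phi>_def flip: sum_divide_distrib) (simp add: P_def)
    moreover have "0 \<le> \<phi> x i" for i using p0 Px by (simp add: \<phi>_def)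
    ultimately show ?thesis by (simp add: polyhedron_of_def)
  qed
  have "continuous_on N \<phi>"
  proof (rule continuous_on_coordinatewise_then_product)
    fix i show "continuous_on N (\<lambda>x. \<phi> x i)" unfolding \<phi>_def
      by (intro continuous_on_divide continuous_on_subset[OF cp] continuous_on_subset[OF cP])
        (auto simp: N_def)
  qed
  then have "continuous_on N (k \<circ> \<phi>)"
    by (rule continuous_on_compose) (rule continuous_on_subset[OF k(1)], use inN in auto)
  moreover have "open N" unfolding N_def by (intro open_Collect_less cP continuous_intros)
  ultimately show thesis
  proof (intro that[of N "k \<circ> \<phi>"])
    show "D \<subseteq> N" using onD by (auto simp: N_def)
    show "(k \<circ> \<phi>) ` N \<subseteq> D" using inN k(2) by auto
    show "(k \<circ> \<phi>) x = x" if "x \<in> D" for x using onD[OF that] h(3)[OF that] by simp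
  qed
qed

lemma compact_sublevel:
  fixes f :: "'a::t2_space \<Rightarrow> real"
  assumes "compact D" "continuous_on D f"
  shows "compact {x\<in>D. f x \<le> u}"
proof -
  have "closed (D \<inter> f -` {..u})"
    using assms by (intro continuous_closed_preimage) (auto intro: compact_imp_closed)
  from compact_Int_closed[OF assms(1) this] have "compact (D \<inter> (D \<inter> f -` {..u}))" .
  also have "D \<inter> (D \<inter> f -` {..u}) = {x\<in>D. f x \<le> u}" by auto
  finally show ?thesis .
qed

text \<open>On a compact tube around \<open>D\<close> both \<open>\<rho>\<close> and
  \<open>f \<circ> \<rho>\<close> are uniformly continuous. A point in the hull of a small set is
  close to a point of that set, which \<open>\<rho>\<close> fixes, so \<open>f\<close> rises by less
  than \<open>v - u\<close>.\<close>

lemma sublevel_retraction: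
  fixes D :: "'a::euclidean_space set" and f :: "'a \<Rightarrow> real"
  assumes tri: "triangulable D" and f: "continuous_on D f" and "u < v"
  obtains e0 \<rho> where "e0 > 0" "\<And>x. x \<in> D \<Longrightarrow> \<rho> x = x"
    "\<And>C x. C \<subseteq> {x\<in>D. f x \<le> u} \<Longrightarrow> (\<And>x y. x \<in> C \<Longrightarrow> y \<in> C \<Longrightarrow> dist x y \<le> e0) \<Longrightarrow>
      x \<in> convex hull C \<Longrightarrow> \<rho> x \<in> {x\<in>D. f x \<le> v}"
    "\<And>e. e > 0 \<Longrightarrow> \<exists>d>0. \<forall>C x y. C \<subseteq> {x\<in>D. f x \<le> u} \<longrightarrow> (\<forall>x\<in>C. \<forall>y\<in>C. dist x y \<le> e0) \<longrightarrow>
        x \<in> convex hull C \<longrightarrow> y \<in> convex hull C \<longrightarrow> dist x y \<le> d \<longrightarrow> dist (\<rho> x) (\<rho> y) < e"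
proof -
  obtain N \<rho> where N: "open N" "D \<subseteq> N" "continuous_on N \<rho>" "\<rho> ` N \<subseteq> D" "\<And>x. x \<in> D \<Longrightarrow> \<rho> x = x"
    using triangulable_neighbourhood_retract[OF tri] by blast
  have D: "compact D" using triangulable_compact[OF tri] .
  obtain \<delta> where \<delta>: "\<delta> > 0" "(\<Union>x\<in>D. cball x \<delta>) \<subseteq> N"
    using compact_subset_open_imp_cball_epsilon_subset[OF D N(1,2)] by blast
  define M where "M = (\<Union>x\<in>D. cball x \<delta>)"
  have M: "compact M" "M \<subseteq> N" unfolding M_def using \<delta>(2) compact_minkowski_sum_cball[OF D] by auto
  have cM: "c \<in> D \<Longrightarrow> dist c x \<le> \<delta> \<Longrightarrow> x \<in> M" for c x
    unfolding M_def by auto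
  have c\<rho>: "continuous_on M \<rho>" using continuous_on_subset[OF N(3) M(2)] .
  have "continuous_on M (f \<circ> \<rho>)"
    by (rule continuous_on_compose[OF c\<rho> continuous_on_subset[OF f]]) (use N(4) M(2) in blast)
  then have "uniformly_continuous_on M (f \<circ> \<rho>)" by (rule compact_uniformly_continuous) (rule M(1))
  then obtain d1 where d1: "d1 > 0"
    "\<And>x y. x \<in> M \<Longrightarrow> y \<in> M \<Longrightarrow> dist y x < d1 \<Longrightarrow> dist (f (\<rho> y)) (f (\<rho> x)) < v - u"
    using assms(3) unfolding uniformly_continuous_on_def by (metis comp_apply diff_gt_0_iff_gt)
  have uc: "uniformly_continuous_on M \<rho>" using compact_uniformly_continuous[OF c\<rho> M(1)] .
  \<comment> \<open>\<open>\<delta>\<close> keeps hulls inside the tube \<open>M\<close>; halving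
    \<open>d1\<close> yields the strict inequality of uniform continuity.\<close>
  define e0 where "e0 = min \<delta> (d1 / 2)"
  have e0: "e0 > 0" "e0 \<le> \<delta>" "e0 < d1" using \<delta>(1) d1(1) by (auto simp: e0_def min_def)
  have inM: "\<exists>c\<in>C. dist c x \<le> e0 \<and> c \<in> D \<and> c \<in> M \<and> x \<in> M"
    if C: "C \<subseteq> D" "\<And>x y. x \<in> C \<Longrightarrow> y \<in> C \<Longrightarrow> dist x y \<le> e0" "x \<in> convex hull C" for C x
  proof -
    have "C \<noteq> {}" using C(3) by auto
    then obtain c where c: "c \<in> C" by blast
    have "dist c x \<le> e0" by (rule dist_hull_le[OF C(2)[OF c] C(3)])
    then show ?thesis using c C(1) e0 \<delta>(1) cM[of c x] cM[of c c] by (intro bexI[of _ c]) auto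
  qed
  show thesis
  proof (rule that[OF e0(1) N(5)])
    fix C x assume C: "C \<subseteq> {x\<in>D. f x \<le> u}" "\<And>x y. x \<in> C \<Longrightarrow> y \<in> C \<Longrightarrow> dist x y \<le> e0" "x \<in> convex hull C"
    then obtain c where c: "c \<in> C" "dist c x \<le> e0" "c \<in> D" "c \<in> M" "x \<in> M" using inM[of C x]
      by blast
    have "dist x c < d1" using c(2) e0 by (simp add: dist_commute)
    from d1(2)[OF c(4,5) this] have "f (\<rho> x) < f c + (v - u)" using N(5)[OF c(3)]
      by (simp add: dist_real_def)
    moreover have "f c \<le> u" using C(1) c(1) by auto
    moreover have "\<rho> x \<in> D" using N(4) M(2) c(5) by auto
    ultimately show "\<rho> x \<in> {x\<in>D. f x \<le> v}" by auto
  next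
    fix e :: real assume "e > 0"
    then obtain d where d: "d > 0" "\<And>x y. x \<in> M \<Longrightarrow> y \<in> M \<Longrightarrow> dist y x < d \<Longrightarrow> dist (\<rho> y) (\<rho> x) < e"
      using uc unfolding uniformly_continuous_on_def by metis
    have "dist (\<rho> x) (\<rho> y) < e" if C: "C \<subseteq> {x\<in>D. f x \<le> u}" "\<forall>x\<in>C. \<forall>y\<in>C. dist x y \<le> e0"
        "x \<in> convex hull C" "y \<in> convex hull C" "dist x y \<le> d / 2" for C x y
    proof -
      have "C \<subseteq> D" using C(1) by auto
      then have "x \<in> M" "y \<in> M" using inM[of C x] inM[of C y] C by auto
      then show ?thesis using d(2)[of y x] C(5) d(1) by simp
    qed
    then show "\<exists>d>0. \<forall>C x y. C \<subseteq> {x\<in>D. f x \<le> u} \<longrightarrow> (\<forall>x\<in>C. \<forall>y\<in>C. dist x y \<le> e0) \<longrightarrow>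
        x \<in> convex hull C \<longrightarrow> y \<in> convex hull C \<longrightarrow> dist x y \<le> d \<longrightarrow> dist (\<rho> x) (\<rho> y) < e"
      using d(1) by (intro exI[of _ "d / 2"]) auto
  qed
qed

section \<open>Rank functions and their corner points\<close>

lemma exists_between_avoiding:
  fixes a b :: real
  assumes "finite S" "a < b"
  obtains x where "a < x" "x < b" "x \<notin> S"
  using infinite_Ioo[OF assms(2)] assms(1)
  by (metis (full_types) greaterThanLessThan_iff rev_finite_subset subsetI)

section \<open>Rectangle counts and multiplicities\<close>

text \<open>For a rank function this is the number of classes born between \<open>a\<close> and
  \<open>b\<close> and dying between \<open>c\<close> and \<open>d\<close>, by inclusion and
  exclusion.\<close>

definition rect_count :: "(real \<Rightarrow> real \<Rightarrow> int) \<Rightarrow> real \<Rightarrow> real \<Rightarrow> real \<Rightarrow> real \<Rightarrow> int" where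
  "rect_count r a b c d = r b c - r a c - r b d + r a d"

abbreviation square_count :: "(real \<Rightarrow> real \<Rightarrow> int) \<Rightarrow> real \<Rightarrow> real \<Rightarrow> real \<Rightarrow> int" where
  "square_count r s t e \<equiv> rect_count r (s - e) (s + e) (t - e) (t + e)"

definition corner_mult :: "(real \<Rightarrow> real \<Rightarrow> int) \<Rightarrow> real \<Rightarrow> real \<Rightarrow> nat" where
  "corner_mult r s t = Inf {nat (square_count r s t e) | e. e > 0 \<and> s + e < t - e}"

definition rect_nonneg :: "(real \<Rightarrow> real \<Rightarrow> int) \<Rightarrow> bool" where
  "rect_nonneg r \<longleftrightarrow> (\<forall>a b c d. a \<le> b \<and> b < c \<and> c \<le> d \<longrightarrow> 0 \<le> rect_count r a b c d)"

lemma rect_nonnegD: "rect_nonneg r \<Longrightarrow> a \<le> b \<Longrightarrow> b < c \<Longrightarrow> c \<le> d \<Longrightarrow> 0 \<le> rect_count r a b c d"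
  by (simp add: rect_nonneg_def)

text \<open>The larger rectangle is the smaller one together with four strips of nonnegative
  count.\<close>

lemma rect_mono:
  assumes "rect_nonneg r" "a' \<le> a" "a \<le> b" "b \<le> b'" "b' < c'" "c' \<le> c" "c \<le> d" "d \<le> d'"
  shows "rect_count r a b c d \<le> rect_count r a' b' c' d'"
proof -
  have "rect_count r a' b' c' d' =
    rect_count r a b c d + rect_count r a' a c' d' + rect_count r b b' c' d' + rect_count r a b c' c
    + rect_count r a b d d'"
    by (simp add: rect_count_def)
  moreover have "0 \<le> rect_count r a' a c' d'" "0 \<le> rect_count r b b' c' d'"
    "0 \<le> rect_count r a b c' c" "0 \<le> rect_count r a b d d'"
    using assms by (auto intro!: rect_nonnegD)
  ultimately show ?thesis by linarith
qed

text \<open>Counts of shrinking squares are natural numbers that never increase, so they become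
  constant; the infimum is the value on all small squares.\<close>

lemma corner_mult_attained:
  assumes "rect_nonneg r" "s < t"
  obtains e where "e > 0" "s + e < t - e"
    "\<And>e'. 0 < e' \<Longrightarrow> e' \<le> e \<Longrightarrow> square_count r s t e' = int (corner_mult r s t)"
proof -
  let ?S = "{nat (square_count r s t e) | e. e > 0 \<and> s + e < t - e}"
  have "\<exists>e. e > 0 \<and> s + e < t - e" using assms(2)
    by (intro exI[of _ "(t - s) / 4"]) (auto simp: field_simps)
  then have "?S \<noteq> {}" by auto
  then have "corner_mult r s t \<in> ?S" unfolding corner_mult_def by (rule Inf_nat_def1)
  then obtain e where e: "e > 0" "s + e < t - e" "corner_mult r s t = nat (square_count r s t e)"
    by auto
  have "square_count r s t e' = int (corner_mult r s t)" if "0 < e'" "e' \<le> e" for e'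
  proof (rule order_antisym)
    have "square_count r s t e' \<le> square_count r s t e"
      using that e assms by (intro rect_mono) auto
    also have "0 \<le> square_count r s t e" using e assms by (intro rect_nonnegD) auto
    then have "square_count r s t e = int (corner_mult r s t)" using e by simp
    finally show "square_count r s t e' \<le> int (corner_mult r s t)" .
    have "corner_mult r s t \<le> nat (square_count r s t e')"
      unfolding corner_mult_def using that e by (intro cInf_lower) auto
    moreover have "0 \<le> square_count r s t e'" using that e assms by (intro rect_nonnegD) auto
    ultimately show "int (corner_mult r s t) \<le> square_count r s t e'" by linarith
  qed
  with e show thesis using that by blast
qed

lemma corner_mult_le:
  assumes "rect_nonneg r" "a < s" "s < b" "b < c" "c < t" "t < d"
  shows "int (corner_mult r s t) \<le> rect_count r a b c d"
proof -
  have "s < t" using assms by simp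
  then obtain e where e: "e > 0" "s + e < t - e"
    "\<And>e'. 0 < e' \<Longrightarrow> e' \<le> e \<Longrightarrow> square_count r s t e' = int (corner_mult r s t)"
    using corner_mult_attained[OF assms(1)] by blast
  define e' where "e' = Min {e, s - a, b - s, t - c, d - t}"
  have e': "e' > 0" "e' \<le> e" "e' \<le> s - a" "e' \<le> b - s" "e' \<le> t - c" "e' \<le> d - t"
    using assms e unfolding e'_def by auto
  have "square_count r s t e' \<le> rect_count r a b c d"
    using e' assms by (intro rect_mono) auto
  then show ?thesis using e(3)[of e'] e' by simp
qed

text \<open>Counts add up when a rectangle is cut. As long as \<open>S\<close> has two points, some
  line parallel to an axis separates them and avoids \<open>S\<close>; a single point has a small
  square inside the rectangle.\<close>

lemma sum_corner_mult_le:
  assumes "rect_nonneg r" "a < b" "b < c" "c < d" "finite S" "S \<subseteq> {a<..<b} \<times> {c<..<d}"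
  shows "(\<Sum>(s,t)\<in>S. int (corner_mult r s t)) \<le> rect_count r a b c d"
  using assms(2-)
proof (induction "card S" arbitrary: S a b c d rule: less_induct)
  case less
  let ?sum = "\<lambda>S. \<Sum>(s,t)\<in>S. int (corner_mult r s t)"
  have sum_split: "?sum S = ?sum {u\<in>S. k u < x} + ?sum {u\<in>S. x < k u}"
      "card {u\<in>S. k u < x} < card S" "card {u\<in>S. x < k u} < card S"
    if "p \<in> S" "q \<in> S" "k p < x" "x < k q" "x \<notin> k ` S" for p q x and k :: "real \<times> real \<Rightarrow> real"
  proof -
    let ?L = "{u\<in>S. k u < x}" and ?R = "{u\<in>S. x < k u}"
    have "S = ?L \<union> ?R" using that(5) by (force simp: neq_iff)
    moreover have "?L \<inter> ?R = {}" "finite ?L" "finite ?R" using less.prems(4) by auto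
    ultimately show "?sum S = ?sum ?L + ?sum ?R" by (metis (no_types, lifting) sum.union_disjoint)
    have "q \<in> S - ?L" "p \<in> S - ?R" using that by auto
    then show "card ?L < card S" "card ?R < card S"
      using less.prems(4) by (auto intro!: psubset_card_mono)
  qed
  have split_birth: ?case if pq: "p \<in> S" "q \<in> S" "fst p < fst q" for p q
  proof -
    obtain x where x: "fst p < x" "x < fst q" "x \<notin> fst ` S"
      using exists_between_avoiding[of "fst ` S"] less.prems(4) pq(3) by blast
    note split = sum_split[of p q fst x, OF pq(1,2) x]
    have ab: "a < x" "x < b" using pq(1,2) x less.prems(5) by force+
    have "?sum {u\<in>S. fst u < x} \<le> rect_count r a x c d"
      by (rule less.hyps) (use split(2) ab less.prems in auto)
    moreover have "?sum {u\<in>S. x < fst u} \<le> rect_count r x b c d"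
      by (rule less.hyps) (use split(3) ab less.prems in auto)
    ultimately show ?thesis using split(1) by (simp add: rect_count_def)
  qed
  have split_death: ?case if pq: "p \<in> S" "q \<in> S" "snd p < snd q" for p q
  proof -
    obtain x where x: "snd p < x" "x < snd q" "x \<notin> snd ` S"
      using exists_between_avoiding[of "snd ` S"] less.prems(4) pq(3) by blast
    note split = sum_split[of p q snd x, OF pq(1,2) x]
    have cd: "c < x" "x < d" using pq(1,2) x less.prems(5) by force+
    have "?sum {u\<in>S. snd u < x} \<le> rect_count r a b c x"
      by (rule less.hyps) (use split(2) cd less.prems in auto)
    moreover have "?sum {u\<in>S. x < snd u} \<le> rect_count r a b x d"
      by (rule less.hyps) (use split(3) cd less.prems in auto)
    ultimately show ?thesis using split(1) by (simp add: rect_count_def)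
  qed
  show ?case
  proof (cases "\<exists>p\<in>S. \<exists>q\<in>S. p \<noteq> q")
    case True
    then obtain p q where "p \<in> S" "q \<in> S" "p \<noteq> q" by blast
    then show ?thesis
      using split_birth[of p q] split_birth[of q p] split_death[of p q] split_death[of q p]
      by (metis linorder_neqE_linordered_idom prod_eqI)
  next
    case False
    show ?thesis
    proof (cases "S = {}")
      case True
      then show ?thesis using less.prems assms(1) by (simp add: rect_nonnegD)
    next
      case nonempty: False
      then obtain s t where "S = {(s, t)}"
        using False by (metis is_singletonI' is_singleton_the_elem surj_pair)
      then show ?thesis using less.prems assms(1) by (auto intro!: corner_mult_le)
    qed
  qed
qed

lemma finite_points_open_rect:
  assumes "rect_nonneg r" "a < b" "b < c" "c < d"
  shows "finite {p \<in> {a<..<b} \<times> {c<..<d}. 0 < corner_mult r (fst p) (snd p)}" (is "finite ?P")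
proof (rule ccontr)
  assume "infinite ?P"
  then obtain S where S: "finite S" "card S = Suc (nat (rect_count r a b c d))" "S \<subseteq> ?P"
    using infinite_arbitrarily_large by blast
  have "int (card S) = (\<Sum>(s,t)\<in>S. 1)" by simp
  also have "\<dots> \<le> (\<Sum>(s,t)\<in>S. int (corner_mult r s t))" by (rule sum_mono) (use S in auto)
  also have "\<dots> \<le> rect_count r a b c d" using S assms by (intro sum_corner_mult_le) auto
  finally show False using S by linarith
qed

text \<open>The rectangle is closed here, in contrast to \<open>sum_corner_mult_le\<close>, so that
  it contains the limit point of nested rectangles in
  \<open>rect_count_le_point_sum\<close>.\<close>

definition points_in :: "(real \<Rightarrow> real \<Rightarrow> int) \<Rightarrow> real \<Rightarrow> real \<Rightarrow> real \<Rightarrow> real \<Rightarrow> (real \<times> real) set" where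
  "points_in r a b c d = {p \<in> {a..b} \<times> {c..d}. 0 < corner_mult r (fst p) (snd p)}"

lemma finite_points_in:
  assumes "rect_nonneg r" "b < c"
  shows "finite (points_in r a b c d)"
proof (cases "a \<le> b \<and> c \<le> d")
  case True
  define e where "e = (c - b) / 3"
  have e: "e > 0" "b + e < c - e" using assms by (auto simp: e_def field_simps)
  have "finite {p \<in> {a-e<..<b+e} \<times> {c-e<..<d+e}. 0 < corner_mult r (fst p) (snd p)}"
    by (rule finite_points_open_rect[OF assms(1)]) (use e True in auto)
  then show ?thesis by (rule rev_finite_subset) (use e in \<open>auto simp: points_in_def\<close>)
qed (auto simp: points_in_def)

definition point_sum :: "(real \<Rightarrow> real \<Rightarrow> int) \<Rightarrow> real \<Rightarrow> real \<Rightarrow> real \<Rightarrow> real \<Rightarrow> int" where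
  "point_sum r a b c d = (\<Sum>(s,t)\<in>points_in r a b c d. int (corner_mult r s t))"

lemma point_sum_split_birth:
  assumes "rect_nonneg r" "b < c" "a < x" "x < b" "x \<notin> fst ` points_in r a b c d"
  shows "point_sum r a b c d = point_sum r a x c d + point_sum r x b c d"
proof -
  have "points_in r a b c d = points_in r a x c d \<union> points_in r x b c d"
    using assms by (auto simp: points_in_def)
  moreover have "points_in r a x c d \<inter> points_in r x b c d = {}"
    using assms by (force simp: points_in_def)
  ultimately show ?thesis unfolding point_sum_def using assms
    by (metis finite_points_in finite_Un sum.union_disjoint)
qed

lemma point_sum_split_death:
  assumes "rect_nonneg r" "b < c" "c < x" "x < d" "x \<notin> snd ` points_in r a b c d"
  shows "point_sum r a b c d = point_sum r a b c x + point_sum r a b x d"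
proof -
  have "points_in r a b c d = points_in r a b c x \<union> points_in r a b x d"
    using assms by (auto simp: points_in_def)
  moreover have "points_in r a b c x \<inter> points_in r a b x d = {}"
    using assms by (force simp: points_in_def)
  ultimately show ?thesis unfolding point_sum_def using assms
    by (metis finite_points_in finite_Un sum.union_disjoint)
qed

text \<open>The closed quarters of a rectangle share their sides, so the lines of subdivision must avoid
  the corner points.\<close>

lemma excess_subdivide:
  assumes "rect_nonneg r" "a < b" "b < c" "c < d" "point_sum r a b c d < rect_count r a b c d"
  shows "\<exists>a' b' c' d'. a \<le> a' \<and> a' < b' \<and> b' \<le> b \<and> c \<le> c' \<and> c' < d' \<and> d' \<le> d \<and>
    b' - a' \<le> 2 / 3 * (b - a) \<and> d' - c' \<le> 2 / 3 * (d - c) \<and> point_sum r a' b' c' d' < rect_count r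
      a' b' c' d'"
proof -
  have fin: "finite (points_in r a b c d)" using assms finite_points_in by blast
  \<comment> \<open>Cutting in the middle third leaves an interval in which to avoid finitely many
    points, and keeps both parts below two thirds of the width.\<close>
  obtain x where x: "a + (b - a) / 3 < x" "x < a + 2 / 3 * (b - a)" "x \<notin> fst ` points_in r a b c d"
    using exists_between_avoiding[of "fst ` points_in r a b c d" "a + (b - a) / 3"
      "a + 2 / 3 * (b - a)"] fin assms
    by auto
  have x': "a < x" "x < b" using x assms by (auto simp: field_simps)
  have "point_sum r a x c d < rect_count r a x c d \<or> point_sum r x b c d < rect_count r x b c d"
    using point_sum_split_birth[OF assms(1,3) x' x(3)] assms(5) by (auto simp: rect_count_def)
  then obtain a' b' where ab: "a \<le> a'" "a' < b'" "b' \<le> b" "b' - a' \<le> 2 / 3 * (b - a)"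
    "point_sum r a' b' c d < rect_count r a' b' c d"
  proof
    assume "point_sum r a x c d < rect_count r a x c d"
    then show thesis using x x' by (intro that[of a x]) (auto simp: field_simps)
  next
    assume "point_sum r x b c d < rect_count r x b c d"
    then show thesis using x x' by (intro that[of x b]) (auto simp: field_simps)
  qed
  have bc: "b' < c" using ab assms by simp
  have fin: "finite (points_in r a' b' c d)" using assms(1) bc finite_points_in by blast
  obtain y where y: "c + (d - c) / 3 < y" "y < c + 2 / 3 * (d - c)"
    "y \<notin> snd ` points_in r a' b' c d"
    using exists_between_avoiding[of "snd ` points_in r a' b' c d" "c + (d - c) / 3"
      "c + 2 / 3 * (d - c)"] fin assms
    by auto
  have y': "c < y" "y < d" using y assms by (auto simp: field_simps)
  have "point_sum r a' b' c y < rect_count r a' b' c y \<or> point_sum r a' b' y d <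
    rect_count r a' b' y d"
    using point_sum_split_death[OF assms(1) bc y' y(3)] ab(5) by (auto simp: rect_count_def)
  then show ?thesis
  proof
    assume "point_sum r a' b' c y < rect_count r a' b' c y"
    then show ?thesis using y y' ab
      by (intro exI[of _ a'] exI[of _ b'] exI[of _ c] exI[of _ y]) (auto simp: field_simps)
  next
    assume "point_sum r a' b' y d < rect_count r a' b' y d"
    then show ?thesis using y y' ab
      by (intro exI[of _ a'] exI[of _ b'] exI[of _ y] exI[of _ d]) (auto simp: field_simps)
  qed
qed

lemma shrinking_intervals:
  fixes a b :: "nat \<Rightarrow> real"
  assumes "\<And>n. a n \<le> a (Suc n)" "\<And>n. b (Suc n) \<le> b n" "\<And>n. a n \<le> b n"
    and "\<And>n. b (Suc n) - a (Suc n) \<le> 2 / 3 * (b n - a n)"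
  obtains l where "\<And>n. a n \<le> l" "\<And>n. l \<le> b n" "(\<lambda>n. b n - a n) \<longlonglongrightarrow> 0"
proof -
  have le: "b n - a n \<le> (2 / 3) ^ n * (b 0 - a 0)" for n
  proof (induction n)
    case (Suc n)
    then show ?case using assms(4)[of n] by simp
  qed simp
  have lim: "(\<lambda>n. b n - a n) \<longlonglongrightarrow> 0"
  proof (rule tendsto_sandwich[where f = "\<lambda>_. 0" and h = "\<lambda>n. (2 / 3) ^ n * (b 0 - a 0)"])
    show "(\<lambda>n. (2 / 3) ^ n * (b 0 - a 0)) \<longlonglongrightarrow> 0"
      by (intro tendsto_mult_left_zero LIMSEQ_power_zero) auto
  qed (use assms le in auto)
  then have "(\<lambda>n. a n - b n) \<longlonglongrightarrow> 0" using tendsto_minus[OF lim] by simp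
  then obtain l where "\<forall>n. a n \<le> l" "\<forall>n. l \<le> b n"
    using nested_sequence_unique[of a b] assms by blast
  then show thesis using that lim by blast
qed

text \<open>Rectangles whose count exceeds their points can be nested so as to shrink to some
  \<open>(s, t)\<close>. Eventually they fit into a square on which the count is
  \<open>corner_mult r s t\<close>, which is already part of the sum: a contradiction.\<close>

lemma rect_count_le_point_sum:
  assumes r: "rect_nonneg r" and "a < b" "b < c" "c < d"
  shows "rect_count r a b c d \<le> point_sum r a b c d"
proof (rule ccontr)
  assume neg: "\<not> ?thesis"
  define bad where "bad = (\<lambda>(A, B, C, D). a \<le> A \<and> A < B \<and> B \<le> b \<and> c \<le> C \<and> C < D \<and> D \<le> d \<and>
    point_sum r A B C D < rect_count r A B C D)"
  define finer where "finer = (\<lambda>(A::real, B::real, C::real, D::real) (A', B', C', D'). A \<le> A' \<and> B' \<le>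
    B \<and> C \<le> C' \<and> D' \<le> D \<and>
    B' - A' \<le> 2 / 3 * (B - A) \<and> D' - C' \<le> 2 / 3 * (D - C))"
  have "\<exists>f. \<forall>n::nat. bad (f n) \<and> finer (f n) (f (Suc n))"
  proof (rule dependent_nat_choice)
    show "\<exists>x. bad x" using neg assms by (intro exI[of _ "(a, b, c, d)"]) (auto simp: bad_def)
  next
    fix x and n :: nat assume "bad x"
    then show "\<exists>y. bad y \<and> finer x y"
    proof (cases x)
      case (fields A B C D)
      have "\<exists>a' b' c' d'. A \<le> a' \<and> a' < b' \<and> b' \<le> B \<and> C \<le> c' \<and> c' < d' \<and> d' \<le> D \<and>
        b' - a' \<le> 2 / 3 * (B - A) \<and> d' - c' \<le> 2 / 3 * (D - C) \<and> point_sum r a' b' c' d' < rect_count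
          r a' b' c' d'"
        by (rule excess_subdivide[OF r]) (use \<open>bad x\<close> fields assms in \<open>auto simp: bad_def\<close>)
      then obtain a' b' c' d' where "A \<le> a'" "a' < b'" "b' \<le> B" "C \<le> c'" "c' < d'" "d' \<le> D"
        "b' - a' \<le> 2 / 3 * (B - A)" "d' - c' \<le> 2 / 3 * (D - C)"
          "point_sum r a' b' c' d' < rect_count r a' b' c' d'"
        by blast
      then show ?thesis using \<open>bad x\<close> fields
        by (intro exI[of _ "(a', b', c', d')"]) (auto simp: bad_def finer_def)
    qed
  qed
  then obtain f where f: "\<And>n. bad (f n)" "\<And>n. finer (f n) (f (Suc n))" by blast
  define A B C D where "A = (\<lambda>n. fst (f n))" and "B = (\<lambda>n. fst (snd (f n)))"
    and "C = (\<lambda>n. fst (snd (snd (f n))))" and "D = (\<lambda>n. snd (snd (snd (f n))))"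
  have bad: "a \<le> A n" "A n < B n" "B n \<le> b" "c \<le> C n" "C n < D n" "D n \<le> d"
    "point_sum r (A n) (B n) (C n) (D n) < rect_count r (A n) (B n) (C n) (D n)" for n
    using f(1)[of n] by (auto simp: bad_def A_def B_def C_def D_def split: prod.splits)
  have fin: "A n \<le> A (Suc n)" "B (Suc n) \<le> B n" "C n \<le> C (Suc n)" "D (Suc n) \<le> D n"
    "B (Suc n) - A (Suc n) \<le> 2 / 3 * (B n - A n)" "D (Suc n) - C (Suc n) \<le> 2 / 3 * (D n - C n)"
      for n
    using f(2)[of n] by (auto simp: finer_def A_def B_def C_def D_def split: prod.splits)
  obtain s where s: "\<And>n. A n \<le> s" "\<And>n. s \<le> B n" "(\<lambda>n. B n - A n) \<longlonglongrightarrow> 0"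
    by (rule shrinking_intervals[of A B]) (use fin bad in \<open>auto simp: less_imp_le\<close>)
  obtain t where t: "\<And>n. C n \<le> t" "\<And>n. t \<le> D n" "(\<lambda>n. D n - C n) \<longlonglongrightarrow> 0"
    by (rule shrinking_intervals[of C D]) (use fin bad in \<open>auto simp: less_imp_le\<close>)
  have "s < t" using s(2)[of 0] t(1)[of 0] bad(3,4)[of 0] assms by simp
  then obtain e where e: "e > 0" "s + e < t - e"
    "\<And>e'. 0 < e' \<Longrightarrow> e' \<le> e \<Longrightarrow> square_count r s t e' = int (corner_mult r s t)"
    using corner_mult_attained[OF r] by blast
  have "\<forall>\<^sub>F n in sequentially. B n - A n < e \<and> D n - C n < e"
    using order_tendstoD(2)[OF s(3) e(1)] order_tendstoD(2)[OF t(3) e(1)] by eventually_elim auto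
  then obtain n where n: "B n - A n < e" "D n - C n < e" by (auto simp: eventually_sequentially)
  have "rect_count r (A n) (B n) (C n) (D n) \<le> square_count r s t e"
    using n e s(1,2)[of n] t(1,2)[of n] bad[of n] by (intro rect_mono[OF r]) auto
  also have "\<dots> = int (corner_mult r s t)" using e by simp
  also have "\<dots> \<le> point_sum r (A n) (B n) (C n) (D n)"
  proof (cases "corner_mult r s t = 0")
    case True
    then show ?thesis by (auto simp: point_sum_def intro!: sum_nonneg)
  next
    case False
    have "finite (points_in r (A n) (B n) (C n) (D n))"
      using bad[of n] assms by (intro finite_points_in[OF r]) auto
    moreover have "(s, t) \<in> points_in r (A n) (B n) (C n) (D n)"
      using False s(1,2)[of n] t(1,2)[of n] by (auto simp: points_in_def)
    ultimately show ?thesis unfolding point_sum_def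
      using member_le_sum[of "(s,t)" "points_in r (A n) (B n) (C n) (D n)"
        "\<lambda>(s,t). int (corner_mult r s t)"] by auto
  qed
  finally show False using bad[of n] by simp
qed


section \<open>Partial matchings of corner points\<close>

type_synonym corner = "(real \<times> real) \<times> nat"

definition corners :: "(real \<Rightarrow> real \<Rightarrow> int) \<Rightarrow> corner set" where
  "corners r = {((s, t), i) | s t i. s < t \<and> i < corner_mult r s t}"

definition persistence :: "corner \<Rightarrow> real" where
  "persistence p = snd (fst p) - fst (fst p)"

definition near :: "real \<Rightarrow> corner \<Rightarrow> corner \<Rightarrow> bool" where
  "near \<epsilon> p q \<longleftrightarrow> \<bar>fst (fst p) - fst (fst q)\<bar> \<le> \<epsilon> \<and> \<bar>snd (fst p) - snd (fst q)\<bar> \<le> \<epsilon>"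

text \<open>Corner points of persistence at most \<open>2 * \<eta>\<close> are treated as if they were on the
  diagonal. Each function of a path then has only finitely many relevant corner points, and
  composing matchings does not accumulate \<open>\<eta>\<close>.\<close>

definition matched :: "real \<Rightarrow> real \<Rightarrow> (real \<Rightarrow> real \<Rightarrow> int) \<Rightarrow> (real \<Rightarrow> real \<Rightarrow> int) \<Rightarrow> bool" where
  "matched \<eta> \<epsilon> r r' \<longleftrightarrow> (\<exists>R \<subseteq> corners r \<times> corners r'. single_valued R \<and> single_valued (R\<inverse>) \<and>
     (\<forall>(p, q)\<in>R. near \<epsilon> p q) \<and>
     (\<forall>p\<in>corners r - Domain R. persistence p \<le> 2 * (\<eta> + \<epsilon>)) \<and>
     (\<forall>q\<in>corners r' - Range R. persistence q \<le> 2 * (\<eta> + \<epsilon>)))"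

text \<open>One direction of the inequality known as the box lemma in persistence theory.\<close>

definition interleaved :: "real \<Rightarrow> (real \<Rightarrow> real \<Rightarrow> int) \<Rightarrow> (real \<Rightarrow> real \<Rightarrow> int) \<Rightarrow> bool" where
  "interleaved \<epsilon> r r' \<longleftrightarrow> (\<forall>a b c d. a < b \<and> b + \<epsilon> < c - \<epsilon> \<and> c < d \<longrightarrow>
     rect_count r a b c d \<le> rect_count r' (a - \<epsilon>) (b + \<epsilon>) (c - \<epsilon>) (d + \<epsilon>))"

lemma interleavedD:
  "interleaved \<epsilon> r r' \<Longrightarrow> a < b \<Longrightarrow> b + \<epsilon> < c - \<epsilon> \<Longrightarrow> c < d \<Longrightarrow>
     rect_count r a b c d \<le> rect_count r' (a - \<epsilon>) (b + \<epsilon>) (c - \<epsilon>) (d + \<epsilon>)"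
  by (simp add: interleaved_def)

lemma near_persistence: "near \<epsilon> p q \<Longrightarrow> \<bar>persistence p - persistence q\<bar> \<le> 2 * \<epsilon>"
  by (auto simp: near_def persistence_def)

lemma matched_refl: "0 \<le> \<epsilon> \<Longrightarrow> matched \<eta> \<epsilon> r r"
  unfolding matched_def
  by (intro exI[of _ "Id_on (corners r)"]) (auto simp: single_valued_def near_def)

lemma matched_sym: "matched \<eta> \<epsilon> r r' \<Longrightarrow> matched \<eta> \<epsilon> r' r"
  unfolding matched_def
proof (elim exE conjE)
  fix R assume R: "R \<subseteq> corners r \<times> corners r'" "single_valued R" "single_valued (R\<inverse>)"
    "\<forall>(p, q)\<in>R. near \<epsilon> p q" "\<forall>p\<in>corners r - Domain R. persistence p \<le> 2 * (\<eta> + \<epsilon>)"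
    "\<forall>q\<in>corners r' - Range R. persistence q \<le> 2 * (\<eta> + \<epsilon>)"
  show "\<exists>R\<subseteq>corners r' \<times> corners r. single_valued R \<and> single_valued (R\<inverse>) \<and> (\<forall>(p, q)\<in>R. near \<epsilon> p q) \<and>
        (\<forall>p\<in>corners r' - Domain R. persistence p \<le> 2 * (\<eta> + \<epsilon>)) \<and>
        (\<forall>q\<in>corners r - Range R. persistence q \<le> 2 * (\<eta> + \<epsilon>))"
  proof (intro exI[of _ "R\<inverse>"] conjI)
    show "\<forall>(p, q)\<in>R\<inverse>. near \<epsilon> p q" using R(4) by (auto simp: near_def abs_minus_commute)
  qed (use R in \<open>simp_all, blast\<close>)
qed

text \<open>A point unmatched by the composite is unmatched in one factor, or has a partner that is
  unmatched in the other. In the latter case the persistence changes by at most twice the parameter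
  of the matching used, so the two parameters add up while \<open>\<eta>\<close> enters
  once.\<close>

lemma matched_trans:
  assumes "matched \<eta> \<epsilon> r r'" "matched \<eta> \<delta> r' r''" "0 \<le> \<epsilon>" "0 \<le> \<delta>"
  shows "matched \<eta> (\<epsilon> + \<delta>) r r''"
proof -
  obtain R where R: "R \<subseteq> corners r \<times> corners r'" "single_valued R" "single_valued (R\<inverse>)"
    "\<And>p q. (p, q)\<in>R \<Longrightarrow> near \<epsilon> p q" "\<And>p. p\<in>corners r - Domain R \<Longrightarrow> persistence p \<le> 2 * (\<eta> + \<epsilon>)"
    "\<And>q. q\<in>corners r' - Range R \<Longrightarrow> persistence q \<le> 2 * (\<eta> + \<epsilon>)"
    using assms(1) unfolding matched_def by fast
  obtain S where S: "S \<subseteq> corners r' \<times> corners r''" "single_valued S" "single_valued (S\<inverse>)"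
    "\<And>p q. (p, q)\<in>S \<Longrightarrow> near \<delta> p q" "\<And>p. p\<in>corners r' - Domain S \<Longrightarrow> persistence p \<le> 2 * (\<eta> + \<delta>)"
    "\<And>q. q\<in>corners r'' - Range S \<Longrightarrow> persistence q \<le> 2 * (\<eta> + \<delta>)"
    using assms(2) unfolding matched_def by fast
  show ?thesis unfolding matched_def
  proof (intro exI[of _ "R O S"] conjI ballI)
    show "R O S \<subseteq> corners r \<times> corners r''" using R S by blast
    show "single_valued (R O S)" using R S by (simp add: single_valued_relcomp)
    show "single_valued ((R O S)\<inverse>)" using R S by (simp add: single_valued_relcomp converse_relcomp)
  next
    fix x assume "x \<in> R O S"
    then obtain p q u where "x = (p, u)" "(p, q) \<in> R" "(q, u) \<in> S" by blast
    then show "case x of (p, q) \<Rightarrow> near (\<epsilon> + \<delta>) p q" using R(4)[of p q] S(4)[of q u]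
      by (auto simp: near_def)
  next
    fix p assume p: "p \<in> corners r - Domain (R O S)"
    show "persistence p \<le> 2 * (\<eta> + (\<epsilon> + \<delta>))"
    proof (cases "p \<in> Domain R")
      case True
      then obtain q where q: "(p, q) \<in> R" by blast
      then have "q \<in> corners r' - Domain S" using p R(1) by blast
      from S(5)[OF this] near_persistence[OF R(4)[OF q]] show ?thesis by (simp add: abs_le_iff)
    qed (use R(5)[of p] p assms in auto)
  next
    fix p assume p: "p \<in> corners r'' - Range (R O S)"
    show "persistence p \<le> 2 * (\<eta> + (\<epsilon> + \<delta>))"
    proof (cases "p \<in> Range S")
      case True
      then obtain q where q: "(q, p) \<in> S" by blast
      then have "q \<in> corners r' - Range R" using p S(1) by blast
      from R(6)[OF this] near_persistence[OF S(4)[OF q]] show ?thesis by (simp add: abs_le_iff)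
    qed (use S(6)[of p] p assms in auto)
  qed
qed

text \<open>Infinitely many such points would accumulate in a compact region away from the diagonal,
  but every point of that region has a neighbourhood with finitely many corner points.\<close>

lemma finite_persistent_points:
  assumes "rect_nonneg r" "\<eta> > 0"
    and bounded: "\<And>s t. s < t \<Longrightarrow> 0 < corner_mult r s t \<Longrightarrow> lo \<le> s \<and> t \<le> hi"
  shows "finite {(s, t). 2 * \<eta> \<le> t - s \<and> 0 < corner_mult r s t}" (is "finite ?P")
proof (rule ccontr)
  assume inf: "infinite ?P"
  let ?K = "{lo..hi} \<times> {lo..hi} \<inter> {p. 2 * \<eta> \<le> snd p - fst p}"
  have "compact ?K" by (intro compact_Int_closed compact_Times closed_Collect_le continuous_intros)
    auto
  moreover have "?P \<subseteq> ?K"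
  proof clarify
    fix s t assume st: "2 * \<eta> \<le> t - s" "0 < corner_mult r s t"
    then have "s < t" using assms(2) by simp
    from bounded[OF this st(2)] st this show "(s, t) \<in> ?K" by auto
  qed
  ultimately obtain p where p: "p \<in> ?K" "p islimpt ?P"
    using Heine_Borel_imp_Bolzano_Weierstrass[of ?K ?P] inf by blast
  obtain s t where "p = (s, t)" by fastforce
  with p have st: "(s, t) \<in> ?K" "(s, t) islimpt ?P" by auto
  define e where "e = \<eta> / 2"
  have e: "e > 0" "s + e < t - e" using st(1) assms(2) by (auto simp: e_def)
  have "open ({s-e<..<s+e} \<times> {t-e<..<t+e})" by (intro open_Times) auto
  moreover have "(s, t) \<in> {s-e<..<s+e} \<times> {t-e<..<t+e}" using e by auto
  ultimately have "infinite (({s-e<..<s+e} \<times> {t-e<..<t+e}) \<inter> ?P)"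
    using st(2)[unfolded islimpt_eq_acc_point, rule_format] by simp
  moreover have "finite {p \<in> {s-e<..<s+e} \<times> {t-e<..<t+e}. 0 < corner_mult r (fst p) (snd p)}"
    using e by (intro finite_points_open_rect[OF assms(1)]) auto
  then have "finite (({s-e<..<s+e} \<times> {t-e<..<t+e}) \<inter> ?P)" by (rule rev_finite_subset) auto
  ultimately show False by simp
qed

lemma uniform_isolation:
  assumes r: "rect_nonneg r" and "finite F" "\<And>s t. (s, t) \<in> F \<Longrightarrow> s < t"
  obtains d where "d > 0" "\<And>s t e. (s, t) \<in> F \<Longrightarrow> 0 < e \<Longrightarrow> e \<le> d \<Longrightarrow> s + e < t - e \<and>
      square_count r s t e = int (corner_mult r s t)"
proof -
  have "\<exists>d>0. \<forall>(s,t)\<in>F. \<forall>e. 0 < e \<longrightarrow> e \<le> d \<longrightarrow> s + e < t - e \<and>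
      square_count r s t e = int (corner_mult r s t)"
    using assms(2,3)
  proof (induction F rule: finite_induct)
    case empty
    then show ?case by (intro exI[of _ 1]) auto
  next
    case (insert p F)
    obtain s t where p: "p = (s, t)" by fastforce
    obtain d where d: "d > 0" "\<forall>(s,t)\<in>F. \<forall>e. 0 < e \<longrightarrow> e \<le> d \<longrightarrow> s + e < t - e \<and>
      square_count r s t e = int (corner_mult r s t)"
      using insert by blast
    obtain e where e: "e > 0" "s + e < t - e" "\<And>e'. 0 < e' \<Longrightarrow> e' \<le> e \<Longrightarrow>
        square_count r s t e' = int (corner_mult r s t)"
      using corner_mult_attained[OF r, of s t] insert.prems p by blast
    show ?case
      by (rule exI[of _ "min d e"]) (use d e p in auto)
  qed
  then show thesis using that by fast
qed

definition corners_in :: "(real \<Rightarrow> real \<Rightarrow> int) \<Rightarrow> real \<Rightarrow> real \<Rightarrow> real \<Rightarrow> corner set" where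
  "corners_in r s t e = {((u, v), i). \<bar>u - s\<bar> \<le> e \<and> \<bar>v - t\<bar> \<le> e \<and> i < corner_mult r u v}"

lemma card_corners_in:
  assumes "rect_nonneg r" "s + e < t - e"
  shows "finite (corners_in r s t e)"
    "int (card (corners_in r s t e)) = point_sum r (s - e) (s + e) (t - e) (t + e)"
proof -
  let ?P = "points_in r (s - e) (s + e) (t - e) (t + e)"
  have eq: "corners_in r s t e = Sigma ?P (\<lambda>p. {..<corner_mult r (fst p) (snd p)})"
    by (auto simp: corners_in_def points_in_def abs_le_iff)
  have fin: "finite ?P" using finite_points_in[OF assms] .
  then show "finite (corners_in r s t e)" unfolding eq by auto
  show "int (card (corners_in r s t e)) = point_sum r (s - e) (s + e) (t - e) (t + e)"
    unfolding eq point_sum_def using fin by (simp add: case_prod_beta)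
qed

lemma point_sum_le_rect_count:
  assumes "rect_nonneg r" "a' < a" "a \<le> b" "b < b'" "b' < c'" "c' < c" "c \<le> d" "d < d'"
  shows "point_sum r a b c d \<le> rect_count r a' b' c' d'"
  unfolding point_sum_def
  by (rule sum_corner_mult_le) (use assms finite_points_in[of r b c] in \<open>auto simp: points_in_def\<close>)

text \<open>The persistent points \<open>F\<close> of \<open>r\<close> are finitely many, hence
  uniformly isolated. If \<open>r'\<close> is close compared with the isolation radius, each square
  around a point of \<open>F\<close> contains corner points of \<open>r'\<close> of exactly the
  right total multiplicity. The gap \<open>\<epsilon>0 < \<epsilon>\<close> leaves squares of radius
  \<open>\<epsilon> - \<epsilon>0\<close> to start the comparison from.\<close>

lemma matched_near:
  assumes r: "rect_nonneg r" and \<eta>: "\<eta> > 0"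
    and bounded: "\<And>s t. s < t \<Longrightarrow> 0 < corner_mult r s t \<Longrightarrow> lo \<le> s \<and> t \<le> hi"
  obtains d where "d > 0" "\<And>r' \<epsilon>0 \<epsilon>. rect_nonneg r' \<Longrightarrow> 0 \<le> \<epsilon>0 \<Longrightarrow> \<epsilon>0 < \<epsilon> \<Longrightarrow> \<epsilon> < d \<Longrightarrow>
     interleaved \<epsilon>0 r r' \<Longrightarrow> interleaved \<epsilon>0 r' r \<Longrightarrow> matched \<eta> \<epsilon> r r'"
proof -
  define F where "F = {(s, t). 2 * \<eta> \<le> t - s \<and> 0 < corner_mult r s t}"
  have finF: "finite F" unfolding F_def by (rule finite_persistent_points[OF r \<eta> bounded])
  have "\<And>s t. (s, t) \<in> F \<Longrightarrow> s < t" using \<eta> by (auto simp: F_def)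
  then obtain d0 where d0: "d0 > 0" "\<And>s t e. (s, t) \<in> F \<Longrightarrow> 0 < e \<Longrightarrow> e \<le> d0 \<Longrightarrow> s + e < t - e \<and>
      square_count r s t e = int (corner_mult r s t)"
    using uniform_isolation[OF r finF] by blast
  \<comment> \<open>Squares around points of \<open>F\<close> occur with radius up to
    \<open>2 * d + \<epsilon>0\<close> in the count and \<open>4 * d\<close> in the disjointness
    argument; all of them must be isolating.\<close>
  define d where "d = min (d0 / 4) (\<eta> / 2)"
  have d: "d > 0" "4 * d \<le> d0" "2 * d \<le> \<eta>" using d0(1) \<eta> by (auto simp: d_def)
  show thesis
  proof (rule that[OF d(1)])
    fix r' \<epsilon>0 \<epsilon>
    assume r': "rect_nonneg r'" and \<epsilon>: "0 \<le> \<epsilon>0" "\<epsilon>0 < \<epsilon>" "\<epsilon> < d"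
      and il: "interleaved \<epsilon>0 r r'" "interleaved \<epsilon>0 r' r"
    define G where "G = (\<lambda>(s, t). corners_in r' s t \<epsilon>)"
    \<comment> \<open>Lower bound: the square of radius \<open>\<epsilon> - \<epsilon>0\<close> for
      \<open>r\<close> grows to radius \<open>\<epsilon>\<close> for \<open>r'\<close>. Upper bound:
      the closed square of radius \<open>\<epsilon>\<close> for \<open>r'\<close> lies in the one of
      radius \<open>2 * d\<close>, which grows to radius \<open>2 * d + \<epsilon>0\<close> for
      \<open>r\<close>, still isolating.\<close>
    have card: "finite (G (s, t)) \<and> card (G (s, t)) = corner_mult r s t" if st: "(s, t) \<in> F" for s t
    proof -
      have small: "s + 4 * d < t - 4 * d" using d0(2)[OF st, of "4*d"] d by auto
      have 1: "s + \<epsilon> < t - \<epsilon>" using small \<epsilon> by simp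
      have "int (corner_mult r s t) = square_count r s t (\<epsilon> - \<epsilon>0)"
        using d0(2)[OF st, of "\<epsilon> - \<epsilon>0"] \<epsilon> d by simp
      also have "\<dots> \<le> rect_count r' (s - (\<epsilon> - \<epsilon>0) - \<epsilon>0) (s + (\<epsilon> - \<epsilon>0) + \<epsilon>0) (t - (\<epsilon> - \<epsilon>0) - \<epsilon>0) (t
        + (\<epsilon> - \<epsilon>0) + \<epsilon>0)"
        using \<epsilon> small d(1) by (intro interleavedD[OF il(1)]) auto
      also have "\<dots> = square_count r' s t \<epsilon>" by simp
      also have "\<dots> \<le> point_sum r' (s - \<epsilon>) (s + \<epsilon>) (t - \<epsilon>) (t + \<epsilon>)"
        using 1 \<epsilon> by (intro rect_count_le_point_sum[OF r']) auto
      finally have ge: "int (corner_mult r s t) \<le> point_sum r' (s - \<epsilon>) (s + \<epsilon>) (t - \<epsilon>) (t + \<epsilon>)" .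
      have "point_sum r' (s - \<epsilon>) (s + \<epsilon>) (t - \<epsilon>) (t + \<epsilon>) \<le> square_count r' s t (2*d)"
        using \<epsilon> small by (intro point_sum_le_rect_count[OF r']) auto
      also have "\<dots> \<le> rect_count r (s - 2*d - \<epsilon>0) (s + 2*d + \<epsilon>0) (t - 2*d - \<epsilon>0) (t + 2*d + \<epsilon>0)"
        using \<epsilon> small d(1) by (intro interleavedD[OF il(2)]) auto
      also have "\<dots> = square_count r s t (2*d + \<epsilon>0)"
        by (simp add: algebra_simps)
      also have "\<dots> = int (corner_mult r s t)" using d0(2)[OF st, of "2*d+\<epsilon>0"] \<epsilon> d by simp
      finally show ?thesis using ge card_corners_in[OF r' 1] by (simp add: G_def)
    qed
    have "\<exists>\<beta>. bij_betw \<beta> {..<corner_mult r s t} (G (s, t))" if "(s, t) \<in> F" for s t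
      using card[OF that] by (intro finite_same_card_bij) auto
    then obtain \<beta> where \<beta>: "\<And>s t. (s, t) \<in> F \<Longrightarrow> bij_betw (\<beta> s t) {..<corner_mult r s t} (G (s, t))"
      by metis
    \<comment> \<open>Two points of \<open>F\<close> with a common candidate are so close that the
      isolating square of radius \<open>4 * d\<close> around one of them would count both.\<close>
    have disj: "p = q" if "p \<in> F" "q \<in> F" "x \<in> G p" "x \<in> G q" for p q x
    proof (rule ccontr)
      assume ne: "p \<noteq> q"
      obtain s t s' t' where pq: "p = (s, t)" "q = (s', t')" by fastforce
      have cl: "\<bar>s - s'\<bar> < 4 * d" "\<bar>t - t'\<bar> < 4 * d"
        using that(3,4) pq \<epsilon> by (auto simp: G_def corners_in_def abs_le_iff abs_less_iff)
      have small: "s + 4 * d < t - 4 * d" using d0(2)[of s t "4*d"] d that pq by auto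
      have "(\<Sum>(s,t)\<in>{p, q}. int (corner_mult r s t)) \<le> square_count r s t (4*d)"
        using cl small d(1) pq by (intro sum_corner_mult_le[OF r]) (auto simp: abs_less_iff)
      also have "\<dots> = int (corner_mult r s t)" using d0(2)[of s t "4*d"] d that pq by simp
      finally have "corner_mult r s' t' = 0" using ne pq by simp
      then show False using that(2) pq by (simp add: F_def)
    qed
    define R where "R = {(((s, t), i), \<beta> s t i) | s t i. (s, t) \<in> F \<and> i < corner_mult r s t}"
    have RG: "\<beta> s t i \<in> G (s, t)" if "(s, t) \<in> F" "i < corner_mult r s t" for s t i
      using \<beta>[OF that(1)] that(2) by (auto simp: bij_betw_def)
    show "matched \<eta> \<epsilon> r r'" unfolding matched_def
    proof (intro exI[of _ R] conjI ballI)
      show "R \<subseteq> corners r \<times> corners r'"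
      proof
        fix x assume "x \<in> R"
        then obtain s t i where x: "x = (((s, t), i), \<beta> s t i)" "(s, t) \<in> F" "i < corner_mult r s t"
          unfolding R_def by blast
        have "s + 4 * d < t - 4 * d" using d0(2)[OF x(2), of "4*d"] d by auto
        then show "x \<in> corners r \<times> corners r'" using x RG[OF x(2,3)] \<epsilon>
          by (cases "\<beta> s t i") (auto simp: corners_def G_def corners_in_def abs_le_iff)
      qed
      show "single_valued R" unfolding single_valued_def R_def by blast
      show "single_valued (R\<inverse>)"
      proof (rule single_valuedI)
        fix x p q assume "(x, p) \<in> R\<inverse>" "(x, q) \<in> R\<inverse>"
        then obtain s t i s' t' j where *: "p = ((s, t), i)" "q = ((s', t'), j)" "x = \<beta> s t i"
          "x = \<beta> s' t' j"
          "(s, t) \<in> F" "(s', t') \<in> F" "i < corner_mult r s t" "j < corner_mult r s' t'"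
          unfolding R_def by blast
        then have "(s, t) = (s', t')" using disj[of "(s,t)" "(s',t')" x] RG by metis
        moreover from this have "i = j" using * \<beta>[of s t] by (auto simp: bij_betw_def inj_on_def)
        ultimately show "p = q" using * by simp
      qed
    next
      fix x assume "x \<in> R"
      then obtain s t i where x: "x = (((s, t), i), \<beta> s t i)" "(s, t) \<in> F" "i < corner_mult r s t"
        unfolding R_def by blast
      then show "case x of (p, q) \<Rightarrow> near \<epsilon> p q" using RG[OF x(2,3)]
        by (cases "\<beta> s t i") (auto simp: G_def corners_in_def near_def abs_minus_commute)
    next
      fix p assume p: "p \<in> corners r - Domain R"
      obtain s t i where st: "p = ((s, t), i)" by (metis surj_pair)
      have "(s, t) \<notin> F" using p st by (auto simp: corners_def R_def)
      then show "persistence p \<le> 2 * (\<eta> + \<epsilon>)" using p st \<epsilon>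
        by (auto simp: F_def persistence_def corners_def)
    next
      fix p assume p: "p \<in> corners r' - Range R"
      obtain s t i where st: "p = ((s, t), i)" by (metis surj_pair)
      have stp: "s < t" "i < corner_mult r' s t" using p st by (auto simp: corners_def)
      \<comment> \<open>A point of \<open>r'\<close> of larger persistence forces a corner point
        \<open>(u, v)\<close> of \<open>r\<close> within \<open>\<epsilon>\<close>. Its persistence
        still exceeds \<open>2 * \<eta>\<close>, so it is in \<open>F\<close>, and \<open>p\<close>
        is one of its partners.\<close>
      show "persistence p \<le> 2 * (\<eta> + \<epsilon>)"
      proof (rule ccontr)
        assume "\<not> ?thesis"
        then have big: "t - s > 2 * (\<eta> + \<epsilon>)" by (simp add: st persistence_def)
        have "1 \<le> int (corner_mult r' s t)" using stp by simp
        also have "\<dots> \<le> square_count r' s t (\<epsilon> - \<epsilon>0)"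
          using \<epsilon> big \<eta> by (intro corner_mult_le[OF r']) auto
        also have "\<dots> \<le> rect_count r (s - (\<epsilon> - \<epsilon>0) - \<epsilon>0) (s + (\<epsilon> - \<epsilon>0) + \<epsilon>0) (t - (\<epsilon> - \<epsilon>0) - \<epsilon>0) (t
          + (\<epsilon> - \<epsilon>0) + \<epsilon>0)"
          using \<epsilon> big \<eta> by (intro interleavedD[OF il(2)]) auto
        also have "\<dots> = square_count r s t \<epsilon>" by simp
        also have "\<dots> \<le> point_sum r (s - \<epsilon>) (s + \<epsilon>) (t - \<epsilon>) (t + \<epsilon>)"
          using \<epsilon> big \<eta> by (intro rect_count_le_point_sum[OF r]) auto
        finally have "points_in r (s - \<epsilon>) (s + \<epsilon>) (t - \<epsilon>) (t + \<epsilon>) \<noteq> {}"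
          by (auto simp: point_sum_def)
        then obtain u v where "(u, v) \<in> points_in r (s - \<epsilon>) (s + \<epsilon>) (t - \<epsilon>) (t + \<epsilon>)" by auto
        then have uv: "\<bar>u - s\<bar> \<le> \<epsilon>" "\<bar>v - t\<bar> \<le> \<epsilon>" "0 < corner_mult r u v"
          by (auto simp: points_in_def abs_le_iff)
        then have F: "(u, v) \<in> F" using big by (auto simp: F_def abs_le_iff)
        have "p \<in> G (u, v)" using uv stp st by (auto simp: G_def corners_in_def abs_minus_commute)
        then obtain k where "k < corner_mult r u v" "p = \<beta> u v k" using \<beta>[OF F]
          by (auto simp: bij_betw_def)
        then show False using p F by (auto simp: R_def)
      qed
    qed
  qed
qed

text \<open>\<open>matched_near\<close> yields matchings of each time with all nearby times, over a
  range that depends on the time. Bolzano's bisection principle and \<open>matched_trans\<close>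
  join them, and the costs add up to the length of the path.\<close>

lemma matched_along_path:
  fixes h :: "real \<Rightarrow> real \<Rightarrow> real \<Rightarrow> int"
  assumes h: "\<And>\<tau>. 0 \<le> \<tau> \<Longrightarrow> \<tau> \<le> 1 \<Longrightarrow> rect_nonneg (h \<tau>)"
    and bounded: "\<And>\<tau> s t. 0 \<le> \<tau> \<Longrightarrow> \<tau> \<le> 1 \<Longrightarrow> s < t \<Longrightarrow> 0 < corner_mult (h \<tau>) s t \<Longrightarrow> lo \<le> s \<and> t \<le> hi"
    and lip: "\<And>\<sigma> \<tau>. 0 \<le> \<sigma> \<Longrightarrow> \<sigma> \<le> 1 \<Longrightarrow> 0 \<le> \<tau> \<Longrightarrow> \<tau> \<le> 1 \<Longrightarrow> interleaved (\<bar>\<sigma> - \<tau>\<bar> * \<delta>0) (h \<sigma>) (h \<tau>)"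
    and \<delta>: "0 \<le> \<delta>0" "\<delta>0 < \<delta>" and \<eta>: "\<eta> > 0"
  shows "matched \<eta> \<delta> (h 0) (h 1)"
proof -
  \<comment> \<open>The premise makes \<open>P\<close> vacuous on intervals that leave the unit
    interval; the local condition of the bisection principle also covers these.\<close>
  define P where "P = (\<lambda>a b. 0 \<le> a \<and> b \<le> 1 \<longrightarrow> matched \<eta> ((b - a) * \<delta>) (h a) (h b))"
  have "P 0 1"
  proof (rule Bolzano)
    fix a b c :: real assume ab: "P a b" "P b c" "a \<le> b" "b \<le> c"
    show "P a c" unfolding P_def
    proof
      assume ac: "0 \<le> a \<and> c \<le> 1"
      have "matched \<eta> ((b - a) * \<delta> + (c - b) * \<delta>) (h a) (h c)"
        using ab ac \<delta> by (intro matched_trans[of \<eta> _ "h a" "h b"]) (auto simp: P_def)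
      then show "matched \<eta> ((c - a) * \<delta>) (h a) (h c)" by (simp add: algebra_simps)
    qed
  next
    fix x :: real assume x: "0 \<le> x" "x \<le> 1"
    obtain d where d: "d > 0" "\<And>r' \<epsilon>0 \<epsilon>. rect_nonneg r' \<Longrightarrow> 0 \<le> \<epsilon>0 \<Longrightarrow> \<epsilon>0 < \<epsilon> \<Longrightarrow> \<epsilon> < d \<Longrightarrow>
      interleaved \<epsilon>0 (h x) r' \<Longrightarrow> interleaved \<epsilon>0 r' (h x) \<Longrightarrow> matched \<eta> \<epsilon> (h x) r'"
      using matched_near[OF h[OF x] \<eta> bounded[OF x]] by blast
    have loc: "matched \<eta> (\<bar>x - y\<bar> * \<delta>) (h x) (h y)" if y: "0 \<le> y" "y \<le> 1" "\<bar>x - y\<bar> < d / \<delta>" for y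
    proof (cases "x = y")
      case True
      then show ?thesis by (simp add: matched_refl)
    next
      case False
      show ?thesis
      proof (rule d(2))
        show "\<bar>x - y\<bar> * \<delta>0 < \<bar>x - y\<bar> * \<delta>" using False \<delta> by simp
        show "\<bar>x - y\<bar> * \<delta> < d" using y \<delta> by (simp add: pos_less_divide_eq)
        show "interleaved (\<bar>x - y\<bar> * \<delta>0) (h y) (h x)" using lip[of y x] x y
          by (simp add: abs_minus_commute)
      qed (use h lip x y \<delta> in auto)
    qed
    show "\<exists>d>0. \<forall>a b. a \<le> x \<and> x \<le> b \<and> b - a < d \<longrightarrow> P a b"
    proof (intro exI[of _ "d / \<delta>"] conjI allI impI)
      show "0 < d / \<delta>" using d \<delta> by simp
      fix a b assume ab: "a \<le> x \<and> x \<le> b \<and> b - a < d / \<delta>"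
      show "P a b" unfolding P_def
      proof
        assume ab': "0 \<le> a \<and> b \<le> 1"
        have "matched \<eta> (\<bar>x - a\<bar> * \<delta> + \<bar>x - b\<bar> * \<delta>) (h a) (h b)"
          using ab ab' x \<delta> by (intro matched_trans[of \<eta> _ "h a" "h x"] matched_sym[OF loc] loc) auto
        then show "matched \<eta> ((b - a) * \<delta>) (h a) (h b)" using ab by (simp add: algebra_simps)
      qed
    qed
  qed simp
  then show ?thesis by (simp add: P_def)
qed

section \<open>The persistence diagram of a continuous function\<close>

lemma rank1_finite:
  fixes D :: "'a::euclidean_space set"
  assumes "triangulable D" "continuous_on D f" "u < v"
  shows "rank1 (F :: 'f::field itself) D f q u v \<noteq> \<infinity>"
proof -
  obtain e0 \<rho> where *: "e0 > 0" "\<And>x. x \<in> D \<Longrightarrow> \<rho> x = x"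
    "\<And>C x. C \<subseteq> {x\<in>D. f x \<le> u} \<Longrightarrow> (\<And>x y. x \<in> C \<Longrightarrow> y \<in> C \<Longrightarrow> dist x y \<le> e0) \<Longrightarrow>
      x \<in> convex hull C \<Longrightarrow> \<rho> x \<in> {x\<in>D. f x \<le> v}"
    "\<And>e. e > 0 \<Longrightarrow> \<exists>d>0. \<forall>C x y. C \<subseteq> {x\<in>D. f x \<le> u} \<longrightarrow> (\<forall>x\<in>C. \<forall>y\<in>C. dist x y \<le> e0) \<longrightarrow>
        x \<in> convex hull C \<longrightarrow> y \<in> convex hull C \<longrightarrow> dist x y \<le> d \<longrightarrow> dist (\<rho> x) (\<rho> y) < e"
    by (rule sublevel_retraction[OF assms]) blast
  have D: "compact D" by (rule triangulable_compact[OF assms(1)])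
  show ?thesis unfolding rank1_def
    by (rule cech_rank_finite[OF compact_sublevel[OF D assms(2)] compact_sublevel[OF D assms(2)] _
      *(1) _ *(3,4)])
      (use assms(3) *(2) in auto)
qed

section \<open>Rectangle counts of ranks as dimensions, and their interleaving\<close>

abbreviation birth_space :: "'a::topological_space set \<Rightarrow> ('a \<Rightarrow> real) \<Rightarrow> int \<Rightarrow> real \<Rightarrow>
  ('a, 'f::field) cech_family set" where
  "birth_space D f q u \<equiv> cech_cycles {x\<in>D. f x \<le> u} q"

text \<open>Every class is declared to die at time \<open>T\<close>, which is chosen above the maximum of \<open>f\<close>.
  This turns a corner point at infinity \<open>(s, \<infinity>)\<close> into the proper corner point
  \<open>(s, T)\<close>.\<close>

definition death_space :: "real \<Rightarrow> 'a::topological_space set \<Rightarrow> ('a \<Rightarrow> real) \<Rightarrow> int \<Rightarrow> real \<Rightarrow>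
  ('a, 'f::field) cech_family set" where
  "death_space T D f q v = (if v < T then cech_null {x\<in>D. f x \<le> v} q else UNIV)"

definition cut_rank :: "'f::field itself \<Rightarrow> real \<Rightarrow> 'a::topological_space set \<Rightarrow> ('a \<Rightarrow> real) \<Rightarrow> int \<Rightarrow>
  real \<Rightarrow> real \<Rightarrow> int" where
  "cut_rank F T D f q u v = (if v < T then rk_int (rank1 F D f q u v) else 0)"

lemma subspace_birth_space: "family.subspace (birth_space D f q u)"
  by (rule subspace_cech_cycles)

lemma subspace_death_space: "family.subspace (death_space T D f q v)"
  by (simp add: death_space_def subspace_cech_null)

lemma birth_space_mono:
  fixes g :: "'a::topological_space \<Rightarrow> real"
  assumes "\<And>x. x \<in> D \<Longrightarrow> f x \<le> u \<Longrightarrow> g x \<le> u'"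
  shows "(birth_space D f q u :: ('a, 'f::field) cech_family set) \<subseteq> birth_space D g q u'"
  by (rule cech_cycles_mono) (use assms in auto)

lemma death_space_mono:
  fixes g :: "'a::topological_space \<Rightarrow> real"
  assumes "\<And>x. x \<in> D \<Longrightarrow> f x \<le> v \<Longrightarrow> g x \<le> v'" "v \<le> v'"
  shows "(death_space T D f q v :: ('a, 'f::field) cech_family set) \<subseteq> death_space T D g q v'"
  using cech_null_mono[of "{x\<in>D. f x \<le> v}" "{x\<in>D. g x \<le> v'}" q, where 'f = 'f] assms
  by (auto simp: death_space_def)

lemma cut_rank_dim_mod:
  "cut_rank (F :: 'f::field itself) T D f q u v =
    rk_int (family.dim_mod (birth_space D f q u) (death_space T D f q v :: (_ \<Rightarrow> _ \<Rightarrow> 'f) set))"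
  by (simp add: cut_rank_def death_space_def rank1_def cech_rank_dim_mod family.dim_mod_zero
    family.subspace_UNIV
      rk_int_def zero_enat_def)

lemma dim_mod_birth_death_finite:
  fixes D :: "'a::euclidean_space set"
  assumes "triangulable D" "continuous_on D f" "u < v"
  shows "family.dim_mod (birth_space D f q u) (death_space T D f q v :: (_ \<Rightarrow> _ \<Rightarrow> 'f::field) set) \<noteq>
    \<infinity>"
proof (cases "v < T")
  case True
  then show ?thesis using rank1_finite[OF assms, of "TYPE('f)" q]
    by (simp add: death_space_def rank1_def cech_rank_dim_mod)
next
  case False
  then show ?thesis by (simp add: death_space_def family.dim_mod_zero family.subspace_UNIV
    zero_enat_def)
qed

text \<open>The four dimensions are finite, which turns the additive identity
  \<open>dim_mod_box\<close> into an alternating sum of integers; the value of \<open>rk_int\<close>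
  at \<open>\<infinity>\<close> never enters.\<close>

lemma cut_rank_rect_count:
  fixes D :: "'a::euclidean_space set"
  assumes "triangulable D" "continuous_on D f" "a \<le> b" "b < c" "c \<le> d"
  obtains n where "rect_count (cut_rank (F :: 'f::field itself) T D f q) a b c d = int n"
    "family.dim_mod (birth_space D f q b \<inter> death_space T D f q d :: (_ \<Rightarrow> _ \<Rightarrow> 'f) set)
      {x + y | x y. x \<in> birth_space D f q a \<and> y \<in> death_space T D f q c} = enat n"
proof -
  let ?Z = "\<lambda>u. birth_space D f q u :: (_ \<Rightarrow> _ \<Rightarrow> 'f) set"
    and ?N = "\<lambda>v. death_space T D f q v :: (_ \<Rightarrow> _ \<Rightarrow> 'f) set"
  have fin: "family.dim_mod (?Z u) (?N v) \<noteq> \<infinity>" if "u < v" for u v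
    using dim_mod_birth_death_finite[OF assms(1,2) that] .
  have eq: "family.dim_mod (?Z b) (?N c) + family.dim_mod (?Z a) (?N d) =
     family.dim_mod (?Z a) (?N c) + family.dim_mod (?Z b) (?N d) +
     family.dim_mod (?Z b \<inter> ?N d) {x + y | x y. x \<in> ?Z a \<and> y \<in> ?N c}"
  proof (rule family.dim_mod_box)
    show "?Z a \<subseteq> ?Z b" by (rule birth_space_mono) (use assms in force)
    show "?N c \<subseteq> ?N d" by (rule death_space_mono) (use assms in force)+
    show "family.dim_mod (?Z b) (?N c) \<noteq> \<infinity>" using fin assms by blast
  qed (rule subspace_birth_space subspace_death_space)+
  obtain bc ad ac bd where n: "family.dim_mod (?Z b) (?N c) = enat bc"
    "family.dim_mod (?Z a) (?N d) = enat ad"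
    "family.dim_mod (?Z a) (?N c) = enat ac" "family.dim_mod (?Z b) (?N d) = enat bd"
    using fin[of b c] fin[of a d] fin[of a c] fin[of b d] assms(3-5) by (auto simp: not_infinity_eq)
  have "family.dim_mod (?Z b \<inter> ?N d) {x + y | x y. x \<in> ?Z a \<and> y \<in> ?N c} \<noteq> \<infinity>"
    using eq by (intro notI) (simp add: n)
  then obtain k where k: "family.dim_mod (?Z b \<inter> ?N d) {x + y | x y. x \<in> ?Z a \<and> y \<in> ?N c} = enat k"
    by (auto simp: not_infinity_eq)
  have "int bc + int ad = int ac + int bd + int k" using eq unfolding n k by (simp flip: of_nat_add)
  then have "rect_count (cut_rank F T D f q) a b c d = int k"
    by (simp add: rect_count_def cut_rank_dim_mod n rk_int_def)
  with k show thesis using that by blast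
qed

lemma cut_rank_nonneg:
  fixes D :: "'a::euclidean_space set"
  assumes "triangulable D" "continuous_on D f"
  shows "rect_nonneg (cut_rank (F :: 'f::field itself) T D f q)"
  unfolding rect_nonneg_def
proof (intro allI impI)
  fix a b c d :: real assume "a \<le> b \<and> b < c \<and> c \<le> d"
  then obtain n where "rect_count (cut_rank F T D f q) a b c d = int n"
    using cut_rank_rect_count[OF assms, of a b c d F T q] by metis
  then show "0 \<le> rect_count (cut_rank F T D f q) a b c d" by simp
qed

text \<open>All four spaces move in the favourable direction: those at \<open>b\<close> and
  \<open>d\<close> grow and those at \<open>a\<close> and \<open>c\<close> shrink, so the numerator
  of the subquotient grows and its denominator shrinks.\<close>

lemma cut_rank_interleaved:
  fixes D :: "'a::euclidean_space set"
  assumes "triangulable D" "continuous_on D f" "continuous_on D g"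
    and "0 \<le> \<epsilon>" "\<And>x. x \<in> D \<Longrightarrow> \<bar>f x - g x\<bar> \<le> \<epsilon>"
  shows "interleaved \<epsilon> (cut_rank (F :: 'f::field itself) T D f q) (cut_rank F T D g q)"
  unfolding interleaved_def
proof (intro allI impI)
  fix a b c d :: real assume *: "a < b \<and> b + \<epsilon> < c - \<epsilon> \<and> c < d"
  let ?Z = "\<lambda>f u. birth_space D f q u :: (_ \<Rightarrow> _ \<Rightarrow> 'f) set"
    and ?N = "\<lambda>f v. death_space T D f q v :: (_ \<Rightarrow> _ \<Rightarrow> 'f) set"
  have "a \<le> b" "b < c" "c \<le> d" using * assms(4) by auto
  then obtain n where n: "rect_count (cut_rank F T D f q) a b c d = int n"
    "family.dim_mod (?Z f b \<inter> ?N f d) {x + y | x y. x \<in> ?Z f a \<and> y \<in> ?N f c} = enat n"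
    by (rule cut_rank_rect_count[OF assms(1,2)])
  have "a - \<epsilon> \<le> b + \<epsilon>" "b + \<epsilon> < c - \<epsilon>" "c - \<epsilon> \<le> d + \<epsilon>" using * assms(4) by auto
  then obtain m where m: "rect_count (cut_rank F T D g q) (a - \<epsilon>) (b + \<epsilon>) (c - \<epsilon>) (d + \<epsilon>) = int m"
    "family.dim_mod (?Z g (b + \<epsilon>) \<inter> ?N g (d + \<epsilon>)) {x + y | x y. x \<in> ?Z g (a - \<epsilon>)
      \<and> y \<in> ?N g (c - \<epsilon>)} = enat m"
    by (rule cut_rank_rect_count[OF assms(1,3)])
  have fg: "f x \<le> g x + \<epsilon>" "g x \<le> f x + \<epsilon>" if "x \<in> D" for x using assms(5)[OF that]
    by (auto simp: abs_le_iff)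
  have "?Z f b \<subseteq> ?Z g (b + \<epsilon>)" by (rule birth_space_mono) (use fg in force)
  moreover have "?N f d \<subseteq> ?N g (d + \<epsilon>)" by (rule death_space_mono) (use fg assms(4) in force)+
  moreover have "?Z g (a - \<epsilon>) \<subseteq> ?Z f a" by (rule birth_space_mono) (use fg in force)
  moreover have "?N g (c - \<epsilon>) \<subseteq> ?N f c" by (rule death_space_mono) (use fg assms(4) in force)+
  ultimately have "enat n \<le> enat m" unfolding n(2)[symmetric] m(2)[symmetric]
    by (intro family.dim_mod_mono) blast+
  then show "rect_count (cut_rank F T D f q) a b c d \<le>
    rect_count (cut_rank F T D g q) (a - \<epsilon>) (b + \<epsilon>) (c - \<epsilon>) (d + \<epsilon>)"
    using n m by simp
qed

lemma corner_mult_zeroI: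
  assumes "e > 0" "s + e < t - e" "square_count r s t e = 0"
  shows "corner_mult r s t = 0"
proof -
  have "corner_mult r s t \<le> nat (square_count r s t e)"
    unfolding corner_mult_def using assms(1,2) by (intro cInf_lower CollectI exI[of _ e]) auto
  then show ?thesis using assms by simp
qed

lemma corner_mult_cong:
  assumes "rect_nonneg r" "rect_nonneg r'" "s < t" "d > 0"
    and eq: "\<And>u v. v < t + d \<Longrightarrow> r u v = r' u v"
  shows "corner_mult r s t = corner_mult r' s t"
proof -
  obtain e where e: "e > 0" "s + e < t - e" "\<And>e'. 0 < e' \<Longrightarrow> e' \<le> e \<Longrightarrow>
      square_count r s t e' = int (corner_mult r s t)"
    using corner_mult_attained[OF assms(1,3)] by blast
  obtain f where f: "f > 0" "s + f < t - f" "\<And>e'. 0 < e' \<Longrightarrow> e' \<le> f \<Longrightarrow>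
      square_count r' s t e' = int (corner_mult r' s t)"
    using corner_mult_attained[OF assms(2,3)] by blast
  define m where "m = min (min e f) (d / 2)"
  have m: "0 < m" "m \<le> e" "m \<le> f" "m < d" using e(1) f(1) assms(4) by (auto simp: m_def min_def)
  have "square_count r s t m = square_count r' s t m"
    using m by (simp add: rect_count_def eq)
  then show ?thesis using e(3)[OF m(1,2)] f(3)[OF m(1,3)] by simp
qed

lemma rank1_below:
  fixes D :: "'a::topological_space set"
  assumes "\<And>x. x \<in> D \<Longrightarrow> u < f x"
  shows "rank1 (F :: 'f::field itself) D f q u v = 0"
proof -
  have empty: "{x\<in>D. f x \<le> u} = {}" using assms by force
  have "(cech_cycles {} q :: ('a, 'f) cech_family set) \<subseteq> cech_null {x\<in>D. f x \<le> v} q"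
  proof
    fix z :: "('a, 'f) cech_family" assume z: "z \<in> cech_cycles {} q"
    show "z \<in> cech_null {x\<in>D. f x \<le> v} q" unfolding cech_null_def
    proof clarify
      fix V assume "is_cover {x\<in>D. f x \<le> v} V"
      then have "is_cover {} V" by (auto simp: is_cover_def)
      then have "z V \<in> cycles {} V q" using z unfolding cech_cycles_def by blast
      then have "z V = (\<lambda>_. 0)" by (auto simp: cycles_def chains_def nerve_simplex_def)
      then show "z V \<in> boundaries {x\<in>D. f x \<le> v} V q" by (simp add: boundaries_zero)
    qed
  qed
  then show ?thesis unfolding rank1_def cech_rank_dim_mod empty
    by (rule family.dim_mod_zero) (rule subspace_cech_null)
qed

lemma rank1_cong_birth: "(\<And>x. x \<in> D \<Longrightarrow> f x \<le> u \<longleftrightarrow> f x \<le> u') \<Longrightarrow> rank1 F D f q u v = rank1 F D f q u' v"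
  and rank1_cong_death: "(\<And>x. x \<in> D \<Longrightarrow> f x \<le> v \<longleftrightarrow> f x \<le> v') \<Longrightarrow> rank1 F D f q u v = rank1 F D f q u v'"
proof -
  show "rank1 F D f q u v = rank1 F D f q u' v" if "\<And>x. x \<in> D \<Longrightarrow> f x \<le> u \<longleftrightarrow> f x \<le> u'"
  proof -
    have "{x\<in>D. f x \<le> u} = {x\<in>D. f x \<le> u'}" using that by auto
    then show ?thesis by (simp add: rank1_def)
  qed
  show "rank1 F D f q u v = rank1 F D f q u v'" if "\<And>x. x \<in> D \<Longrightarrow> f x \<le> v \<longleftrightarrow> f x \<le> v'"
  proof -
    have "{x\<in>D. f x \<le> v} = {x\<in>D. f x \<le> v'}" using that by auto
    then show ?thesis by (simp add: rank1_def)
  qed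
qed

section \<open>Position and multiplicity of corner points, finite and infinite\<close>

locale filtered_space =
  fixes D :: "'a::euclidean_space set" and f :: "'a \<Rightarrow> real" and q :: int and lo hi T :: real
    and F :: "'f::field itself"
  assumes tri: "triangulable D" and cont: "continuous_on D f"
    and range: "\<And>x. x \<in> D \<Longrightarrow> lo \<le> f x \<and> f x \<le> hi" and T: "hi < T"
begin

abbreviation rk :: "real \<Rightarrow> real \<Rightarrow> int" where "rk u v \<equiv> rk_int (rank1 F D f q u v)"

abbreviation cr :: "real \<Rightarrow> real \<Rightarrow> int" where "cr \<equiv> cut_rank F T D f q"

lemma nonneg_cr: "rect_nonneg cr" using cut_rank_nonneg[OF tri cont] .

lemma nonneg_rk: "rect_nonneg rk"
  unfolding rect_nonneg_def
proof (intro allI impI)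
  fix a b c d :: real assume *: "a \<le> b \<and> b < c \<and> c \<le> d"
  \<comment> \<open>A cut-off above \<open>d\<close> is invisible on this rectangle.\<close>
  have "0 \<le> rect_count (cut_rank F (d + 1) D f q) a b c d"
    using cut_rank_nonneg[OF tri cont] * by (auto intro: rect_nonnegD)
  also have "\<dots> = rect_count rk a b c d" using * by (simp add: rect_count_def cut_rank_def)
  finally show "0 \<le> rect_count rk a b c d" .
qed

lemma mult_proper_eq: "mult_proper F D f q s t = corner_mult rk s t"
  by (simp add: mult_proper_def corner_mult_def rect_count_def)

lemma rk_below: "u < lo \<Longrightarrow> rk u v = 0"
  using range by (subst rank1_below) (auto simp: rk_int_def zero_enat_def dest: order_less_le_trans)

lemma rk_birth_above: "hi \<le> u \<Longrightarrow> hi \<le> u' \<Longrightarrow> rk u v = rk u' v"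
  using range by (subst rank1_cong_birth[of D f u u']) (auto intro: order_trans)

lemma rk_death_above: "hi \<le> v \<Longrightarrow> hi \<le> v' \<Longrightarrow> rk u v = rk u v'"
  using range by (subst rank1_cong_death[of D f v v']) (auto intro: order_trans)

lemma corner_mult_rk_death: assumes "s < t" "0 < corner_mult rk s t" shows "t \<le> hi"
proof (rule ccontr)
  assume "\<not> t \<le> hi"
  define e where "e = min ((t - hi) / 2) ((t - s) / 4)"
  have e: "e > 0" "s + e < t - e" "hi \<le> t - e" using \<open>\<not> t \<le> hi\<close> assms(1)
    by (auto simp: e_def min_def field_simps)
  have "square_count rk s t e = 0"
    using e rk_death_above[of "t - e" "t + e"] by (simp add: rect_count_def)
  from corner_mult_zeroI[OF e(1,2) this] assms(2) show False by simp
qed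

lemma corner_mult_cr_proper: "s < t \<Longrightarrow> t < T \<Longrightarrow> corner_mult cr s t = corner_mult rk s t"
  by (rule corner_mult_cong[OF nonneg_cr nonneg_rk, of s t "T - t"]) (auto simp: cut_rank_def)

text \<open>Multiplicity is positive only where the rank changes. Sublevel sets are empty below
  \<open>lo\<close> and constant from \<open>hi\<close> on, and the only later change is the cut-off
  at \<open>T\<close>.\<close>

lemma corner_mult_cr_bounds:
  assumes "s < t" "0 < corner_mult cr s t"
  shows "lo \<le> s" "s \<le> hi" "t \<le> hi \<or> t = T"
proof -
  show "lo \<le> s"
  proof (rule ccontr)
    assume "\<not> lo \<le> s"
    define e where "e = min ((lo - s) / 2) ((t - s) / 4)"
    have e: "e > 0" "s + e < t - e" "s + e < lo" using \<open>\<not> lo \<le> s\<close> assms(1)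
      by (auto simp: e_def min_def field_simps)
    have "square_count cr s t e = 0"
      using e by (simp add: rect_count_def cut_rank_def rk_below)
    from corner_mult_zeroI[OF e(1,2) this] assms(2) show False by simp
  qed
  show "s \<le> hi"
  proof (rule ccontr)
    assume "\<not> s \<le> hi"
    define e where "e = min ((s - hi) / 2) ((t - s) / 4)"
    have e: "e > 0" "s + e < t - e" "hi \<le> s - e" using \<open>\<not> s \<le> hi\<close> assms(1)
      by (auto simp: e_def min_def field_simps)
    have "square_count cr s t e = 0"
      using e rk_birth_above[of "s - e" "s + e"] by (simp add: rect_count_def cut_rank_def)
    from corner_mult_zeroI[OF e(1,2) this] assms(2) show False by simp
  qed
  show "t \<le> hi \<or> t = T"
  proof (rule ccontr)
    assume *: "\<not> (t \<le> hi \<or> t = T)"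
    show False
    proof (cases "t < T")
      case True
      then show ?thesis using corner_mult_rk_death[OF assms(1)] assms(2) corner_mult_cr_proper[OF
        assms(1) True] * by auto
    next
      case False
      define e where "e = min ((t - T) / 2) ((t - s) / 4)"
      have e: "e > 0" "s + e < t - e" "T \<le> t - e" using False * assms(1)
        by (auto simp: e_def min_def field_simps)
      have "square_count cr s t e = 0" using e by (simp add: rect_count_def cut_rank_def)
      from corner_mult_zeroI[OF e(1,2) this] assms(2) show False by simp
    qed
  qed
qed

lemma rk_mono_birth:
  assumes "u \<le> u'" "u' < v"
  shows "rk u v \<le> rk u' v"
proof -
  have le: "rank1 F D f q u v \<le> rank1 F D f q u' v"
    unfolding rank1_def cech_rank_dim_mod
    by (intro family.dim_mod_mono birth_space_mono) (use assms in auto)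
  have "rank1 F D f q u v \<noteq> \<infinity>" "rank1 F D f q u' v \<noteq> \<infinity>"
    by (intro rank1_finite[OF tri cont]; use assms in simp)+
  with le show ?thesis by (auto simp: rk_int_def)
qed

text \<open>Beyond \<open>T\<close> the cut rank is 0, so a small square at \<open>(s, T)\<close>
  counts the jump of the rank at \<open>s\<close> for death level \<open>T - e\<close>. Above
  \<open>hi\<close> the death level does not matter and may be replaced by
  \<open>1 / e\<close>.\<close>

lemma mult_inf_eq:
  assumes "s < T"
  shows "mult_inf F D f q s = corner_mult cr s T"
proof -
  let ?S = "{nat (rk (s+e) (1/e) - rk (s-e) (1/e)) | e. e > 0 \<and> s + e < 1/e}"
  obtain d where d: "d > 0" "s + d < T - d" "\<And>e'. 0 < e' \<Longrightarrow> e' \<le> d \<Longrightarrow>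
      square_count cr s T e' = int (corner_mult cr s T)"
    using corner_mult_attained[OF nonneg_cr assms] by blast
  have R: "rk (s + e) w - rk (s - e) w = int (corner_mult cr s T)"
    if "0 < e" "e \<le> d" "e \<le> T - hi" "hi \<le> w" for e w
    using d(3)[OF that(1,2)] rk_death_above[of "T - e" w] that T
    by (simp add: rect_count_def cut_rank_def)
  have "Inf ?S = corner_mult cr s T"
  proof (rule cInf_eq_minimum)
    \<comment> \<open>The last three bounds give \<open>hi \<le> T - e\<close>, then
      \<open>hi \<le> 1 / e\<close>, then \<open>e \<le> 1\<close> and
      \<open>s + e < 1 / e\<close>.\<close>
    define e where "e = Min {d, T - hi, 1 / (\<bar>hi\<bar> + 1), 1 / (\<bar>s\<bar> + 2)}"
    have e: "e > 0" "e \<le> d" "e \<le> T - hi" "e \<le> 1 / (\<bar>hi\<bar> + 1)" "e \<le> 1 / (\<bar>s\<bar> + 2)"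
    proof -
      show "e > 0" using d(1) T by (auto simp: e_def)
    qed (unfold e_def, rule Min_le; simp)+
    have "\<bar>hi\<bar> + 1 \<le> 1 / e" "\<bar>s\<bar> + 2 \<le> 1 / e" using e(1,4,5) by (auto simp: field_simps)
    moreover have "e \<le> 1" using e(5)
      by (rule order_trans) (use divide_left_mono[of 1 "\<bar>s\<bar> + 2" 1] in simp)
    ultimately have "s + e < 1 / e" "hi \<le> 1 / e" by auto
    moreover from R[OF e(1-3) this(2)] have "nat (rk (s+e) (1/e) - rk (s-e) (1/e)) =
      corner_mult cr s T" by simp
    ultimately show "corner_mult cr s T \<in> ?S" using e(1) by force
  next
    fix n assume "n \<in> ?S"
    then obtain e where n: "n = nat (rk (s+e) (1/e) - rk (s-e) (1/e))" and e: "e > 0"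
      "s + e < 1 / e" by auto
    define e' where "e' = Min {e, d, T - hi}"
    have e': "0 < e'" "e' \<le> e" "e' \<le> d" "e' \<le> T - hi" using e d(1) T by (auto simp: e'_def)
    \<comment> \<open>For a general \<open>e\<close> the level \<open>1 / e\<close> may lie below
      \<open>hi\<close>. Lowering the death level from \<open>w\<close> to \<open>1 / e\<close> can
      only increase the jump, by nonnegativity of rectangle counts; widening \<open>e'\<close> to
      \<open>e\<close> increases it again.\<close>
    define w where "w = max (1 / e) hi"
    have "int (corner_mult cr s T) = rk (s + e') w - rk (s - e') w"
      using R[OF e'(1,3,4), of w] by (simp add: w_def)
    also have "\<dots> \<le> rk (s + e') (1 / e) - rk (s - e') (1 / e)"
      using rect_nonnegD[OF nonneg_rk, of "s - e'" "s + e'" "1 / e" w] e e'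
        by (simp add: rect_count_def w_def)
    also have "\<dots> \<le> rk (s + e) (1 / e) - rk (s - e) (1 / e)"
      using rk_mono_birth[of "s + e'" "s + e" "1 / e"] rk_mono_birth[of "s - e" "s - e'"
        "1 / e"] e e' by auto
    finally show "corner_mult cr s T \<le> n" using n by simp
  qed
  then show ?thesis by (simp add: mult_inf_def)
qed

lemma mult_inf_above:
  assumes "hi < s"
  shows "mult_inf F D f q s = 0"
proof -
  let ?S = "{nat (rk (s+e) (1/e) - rk (s-e) (1/e)) | e. e > 0 \<and> s + e < 1/e}"
  define e where "e = min (s - hi) (1 / (\<bar>s\<bar> + 2))"
  have e: "e > 0" "e \<le> s - hi" "e \<le> 1 / (\<bar>s\<bar> + 2)" using assms by (auto simp: e_def)
  have "\<bar>s\<bar> + 2 \<le> 1 / e" using e(1,3) by (auto simp: field_simps)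
  moreover have "e \<le> 1" using e(3)
    by (rule order_trans) (use divide_left_mono[of 1 "\<bar>s\<bar> + 2" 1] in simp)
  ultimately have "s + e < 1 / e" by auto
  moreover have "rk (s + e) (1 / e) = rk (s - e) (1 / e)" using e assms
    by (intro rk_birth_above) auto
  ultimately have "0 \<in> ?S" using e(1) by (intro CollectI exI[of _ e]) simp
  then have "Inf ?S \<le> 0" by (rule cInf_lower) simp
  then show ?thesis by (simp add: mult_inf_def)
qed

text \<open>For each \<open>n\<close> only finitely many points have persistence at least
  \<open>2 / Suc n\<close>. Countability is what allows the diagonal to absorb leftover
  points.\<close>

lemma countable_corners: "countable (corners cr)"
proof -
  let ?P = "\<lambda>n::nat. {(s, t). 2 * (1 / real (Suc n)) \<le> t - s \<and> 0 < corner_mult cr s t}"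
  have "lo \<le> s \<and> t \<le> T" if "s < t" "0 < corner_mult cr s t" for s t
    using corner_mult_cr_bounds[OF that] T by auto
  then have "finite (?P n)" for n
    by (intro finite_persistent_points[OF nonneg_cr]) simp_all
  then have "countable ((\<Union>n. ?P n) \<times> (UNIV :: nat set))"
    by (intro countable_SIGMA countable_UN) (auto intro: countable_finite)
  moreover have "corners cr \<subseteq> (\<Union>n. ?P n) \<times> UNIV"
  proof
    fix p assume "p \<in> corners cr"
    then obtain s t i where p: "p = ((s, t), i)" "s < t" "i < corner_mult cr s t"
      by (auto simp: corners_def)
    then obtain n where "inverse (real (Suc n)) < (t - s) / 2"
      using reals_Archimedean[of "(t - s) / 2"] by auto
    then show "p \<in> (\<Union>n. ?P n) \<times> UNIV" using p by (auto simp: field_simps intro!: exI[of _ n])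
  qed
  ultimately show ?thesis by (rule countable_subset[rotated])
qed

end

section \<open>From partial matchings to bijections of persistence diagrams\<close>

abbreviation diagonal :: "((real \<times> ereal) \<times> nat) set" where
  "diagonal \<equiv> {((x, ereal x), i) | x i. True}"

definition to_pdiag :: "real \<Rightarrow> corner \<Rightarrow> (real \<times> ereal) \<times> nat" where
  "to_pdiag T p = ((fst (fst p), if snd (fst p) = T then \<infinity> else ereal (snd (fst p))), snd p)"

lemma inj_to_pdiag: "inj (to_pdiag T)"
  by (rule injI) (auto simp: to_pdiag_def prod_eq_iff split: if_splits)

lemma to_pdiag_diagonal: "p \<in> corners r \<Longrightarrow> to_pdiag T p \<notin> diagonal"
  by (auto simp: to_pdiag_def corners_def)

lemma (in filtered_space) pdiag_eq: "pdiag F D f q = to_pdiag T ` corners cr \<union> diagonal"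
proof -
  have "{((s, ereal t), i) | s t i. s < t \<and> i < mult_proper F D f q s t}
      \<union> {((s, \<infinity>), i) | s i. i < mult_inf F D f q s} = to_pdiag T ` corners cr" (is "?A \<union> ?B = ?C")
  proof (intro subset_antisym subsetI)
    fix x assume "x \<in> ?A \<union> ?B"
    then show "x \<in> ?C"
    proof
      assume "x \<in> ?A"
      then obtain s t i where x: "x = ((s, ereal t), i)" "s < t" "i < corner_mult rk s t"
        by (auto simp: mult_proper_eq)
      have "t < T" using corner_mult_rk_death[OF x(2)] x(3) T by simp
      then have "((s, t), i) \<in> corners cr" using x by (auto simp: corners_def corner_mult_cr_proper)
      moreover have "x = to_pdiag T ((s, t), i)" using x \<open>t < T\<close> by (simp add: to_pdiag_def)
      ultimately show ?thesis by blast
    next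
      assume "x \<in> ?B"
      then obtain s i where x: "x = ((s, \<infinity>), i)" "i < mult_inf F D f q s" by auto
      have "s < T" using mult_inf_above[of s] x(2) T by fastforce
      then have "((s, T), i) \<in> corners cr" using x by (auto simp: corners_def mult_inf_eq)
      moreover have "x = to_pdiag T ((s, T), i)" using x by (simp add: to_pdiag_def)
      ultimately show ?thesis by blast
    qed
  next
    fix x assume "x \<in> ?C"
    then obtain s t i where x: "x = to_pdiag T ((s, t), i)" "s < t" "i < corner_mult cr s t"
      by (auto simp: corners_def)
    have b: "s \<le> hi" "t \<le> hi \<or> t = T" using corner_mult_cr_bounds[OF x(2)] x(3) by auto
    from b(2) show "x \<in> ?A \<union> ?B"
    proof
      assume "t \<le> hi"
      then have "t < T" using T by simp
      then show ?thesis using x by (auto simp: to_pdiag_def mult_proper_eq corner_mult_cr_proper)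
    next
      assume "t = T"
      then show ?thesis using x b T by (auto simp: to_pdiag_def mult_inf_eq)
    qed
  qed
  then show ?thesis by (simp add: pdiag_def)
qed

text \<open>An infinite set absorbs a countable one, so both unions have the cardinality of
  \<open>C\<close>. The diagonal is uncountable, hence cardinal arithmetic instead of
  enumerations.\<close>

lemma bij_betw_countable_Un:
  fixes A B C :: "'a set"
  assumes "countable A" "countable B" "infinite C"
  shows "\<exists>\<tau>. bij_betw \<tau> (A \<union> C) (B \<union> C)"
proof -
  obtain g :: "nat \<Rightarrow> 'a" where g: "inj g" "range g \<subseteq> C" using infinite_countable_subset[OF assms(3)]
    by blast
  have absorb: "(card_of (A \<union> C), card_of C) \<in> ordIso" if "countable A" for A :: "'a set"
  proof -
    have "inj_on (g \<circ> to_nat_on A) A \<and> (g \<circ> to_nat_on A) ` A \<subseteq> C"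
      using g that by (auto intro!: comp_inj_on inj_on_to_nat_on intro: inj_on_subset)
    then have "(card_of A, card_of C) \<in> ordLeq" using card_of_ordLeq by blast
    from ordLeq_ordIso_trans[OF card_of_Un_Plus_ordLeq card_of_Plus_infinite2[OF assms(3) this]]
    show ?thesis using card_of_mono1[of C "A \<union> C"] by (simp add: ordIso_iff_ordLeq)
  qed
  have "(card_of (A \<union> C), card_of (B \<union> C)) \<in> ordIso"
    using absorb[OF assms(1)] absorb[OF assms(2)] ordIso_symmetric ordIso_transitive by blast
  then show ?thesis using card_of_ordIso by blast
qed

lemma infinite_diagonal: "infinite diagonal"
proof
  assume fin: "finite diagonal"
  have "range (\<lambda>i. ((0::real, ereal 0), i)) \<subseteq> diagonal" by auto
  then have "finite (range (\<lambda>i::nat. ((0::real, ereal 0), i)))" using fin finite_subset by blast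
  then show False by (simp add: finite_image_iff inj_on_def)
qed

text \<open>\<open>pdelta\<close> never exceeds the larger of the two half persistences. Therefore
  the points outside \<open>R\<close> and all diagonal points may be paired by an arbitrary
  bijection \<open>\<tau>\<close>; no point has to meet its own projection to the diagonal.\<close>

lemma dmatch_le:
  assumes "countable X" "countable Y" "X \<inter> diagonal = {}" "Y \<inter> diagonal = {}"
    and R: "R \<subseteq> X \<times> Y" "single_valued R" "single_valued (R\<inverse>)"
    and matched: "\<And>p q. (p, q) \<in> R \<Longrightarrow> pdelta (fst p) (fst q) \<le> K"
    and unmatched: "\<And>p. p \<in> X - Domain R \<Longrightarrow> (snd (fst p) - ereal (fst (fst p))) / 2 \<le> K"
      "\<And>q. q \<in> Y - Range R \<Longrightarrow> (snd (fst q) - ereal (fst (fst q))) / 2 \<le> K"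
    and "0 \<le> K"
  shows "dmatch (X \<union> diagonal) (Y \<union> diagonal) \<le> K"
proof -
  define m where "m = (\<lambda>p. SOME q. (p, q) \<in> R)"
  have m: "(p, m p) \<in> R" if "p \<in> Domain R" for p
    using that unfolding m_def by (auto intro: someI)
  have m': "m p = q" if "(p, q) \<in> R" for p q
    using single_valuedD[OF R(2) m[of p] that] that by auto
  have bm: "bij_betw m (Domain R) (Range R)"
  proof (rule bij_betw_imageI)
    show "inj_on m (Domain R)"
    proof (rule inj_onI)
      fix p p' assume "p \<in> Domain R" "p' \<in> Domain R" "m p = m p'"
      then have "(m p, p) \<in> R\<inverse>" "(m p, p') \<in> R\<inverse>" using m[of p] m[of p'] by auto
      then show "p = p'" by (rule single_valuedD[OF R(3)])
    qed
    show "m ` Domain R = Range R" using m m' by force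
  qed
  obtain \<tau> where \<tau>: "bij_betw \<tau> ((X - Domain R) \<union> diagonal) ((Y - Range R) \<union> diagonal)"
    using bij_betw_countable_Un[OF _ _ infinite_diagonal, of "X - Domain R"
      "Y - Range R"] assms(1,2) by auto
  define \<sigma> where "\<sigma> = (\<lambda>p. if p \<in> Domain R then m p else \<tau> p)"
  have DX: "Domain R \<subseteq> X" "Range R \<subseteq> Y" using R(1) by auto
  have "bij_betw \<sigma> (Domain R \<union> ((X - Domain R) \<union> diagonal)) (Range R \<union> ((Y - Range R) \<union> diagonal))"
  proof (rule bij_betw_combine)
    show "bij_betw \<sigma> (Domain R) (Range R)" using bm
      by (subst bij_betw_cong[of _ _ m]) (auto simp: \<sigma>_def)
    have "diagonal \<inter> Domain R = {}" using DX(1) assms(3) by blast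
    then have "p \<notin> Domain R" if "p \<in> (X - Domain R) \<union> diagonal" for p
      using that by blast
    then have "\<sigma> p = \<tau> p" if "p \<in> (X - Domain R) \<union> diagonal" for p
      unfolding \<sigma>_def using that by (simp only: if_False)
    from bij_betw_cong[of "(X - Domain R) \<union> diagonal" \<sigma> \<tau>, OF this]
    show "bij_betw \<sigma> ((X - Domain R) \<union> diagonal) ((Y - Range R) \<union> diagonal)"
      using \<tau> by (simp only:)
    show "Range R \<inter> ((Y - Range R) \<union> diagonal) = {}" using DX(2) assms(4) by blast
  qed
  moreover have "Domain R \<union> ((X - Domain R) \<union> diagonal) = X \<union> diagonal"
    "Range R \<union> ((Y - Range R) \<union> diagonal) = Y \<union> diagonal" using DX by blast+
  ultimately have bij: "bij_betw \<sigma> (X \<union> diagonal) (Y \<union> diagonal)" by simp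
  have half: "(snd (fst p) - ereal (fst (fst p))) / 2 \<le> K" if "p \<in> diagonal" for p
    using that assms(11) by (auto simp: zero_ereal_def)
  have cost: "pdelta (fst p) (fst (\<sigma> p)) \<le> K" if p: "p \<in> X \<union> diagonal" for p
  proof (cases "p \<in> Domain R")
    case True
    then show ?thesis using matched[OF m[OF True]] by (simp add: \<sigma>_def)
  next
    case False
    then have p': "p \<in> (X - Domain R) \<union> diagonal" using p by auto
    then have "\<sigma> p \<in> (Y - Range R) \<union> diagonal" using \<tau> False by (auto simp: \<sigma>_def bij_betw_def)
    then have "(snd (fst (\<sigma> p)) - ereal (fst (fst (\<sigma> p)))) / 2 \<le> K" using unmatched(2) half by blast
    moreover have "(snd (fst p) - ereal (fst (fst p))) / 2 \<le> K" using p' unmatched(1) half by blast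
    ultimately show ?thesis by (auto simp: pdelta_def case_prod_beta min_le_iff_disj)
  qed
  show ?thesis unfolding dmatch_def
  proof (rule INF_lower2)
    show "\<sigma> \<in> {\<sigma>. bij_betw \<sigma> (X \<union> diagonal) (Y \<union> diagonal)}" using bij by simp
    show "(SUP p\<in>X \<union> diagonal. pdelta (fst p) (fst (\<sigma> p))) \<le> K" using cost by (intro SUP_least)
  qed
qed

lemma single_valued_map_prod:
  assumes "inj f" "single_valued R"
  shows "single_valued (map_prod f g ` R)"
proof (rule single_valuedI)
  fix x y z assume "(x, y) \<in> map_prod f g ` R" "(x, z) \<in> map_prod f g ` R"
  then obtain a b a' b' where ab: "(a, b) \<in> R" "x = f a" "y = g b" "(a', b') \<in> R" "x = f a'"
    "z = g b'" by auto
  then have "a = a'" using assms(1) by (simp add: inj_eq)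
  then show "y = z" using single_valuedD[OF assms(2)] ab by metis
qed

lemma converse_map_prod: "(map_prod f g ` R)\<inverse> = map_prod g f ` (R\<inverse>)"
  by force

lemma dmatch_pdiag_le:
  fixes D :: "'a::euclidean_space set" and f g :: "'a \<Rightarrow> real"
  assumes tri: "triangulable D" and f: "continuous_on D f" and g: "continuous_on D g"
    and \<delta>: "0 \<le> \<delta>" "\<And>x. x \<in> D \<Longrightarrow> \<bar>f x - g x\<bar> \<le> \<delta>"
  shows "dmatch (pdiag (F :: 'f::field itself) D f q) (pdiag F D g q) \<le> ereal \<delta>"
proof (rule ereal_le_epsilon2)
  fix \<kappa> :: real assume \<kappa>: "0 < \<kappa>"
  \<comment> \<open>Half of \<open>\<kappa>\<close> pays for the persistence threshold, the other
    half for the strict gap \<open>\<delta> < \<delta>'\<close> that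
    \<open>matched_along_path\<close> requires.\<close>
  define \<eta> where "\<eta> = \<kappa> / 2"
  define \<delta>' where "\<delta>' = \<delta> + \<kappa> / 2"
  have \<eta>: "\<eta> > 0" "\<delta> < \<delta>'" "\<eta> + \<delta>' = \<delta> + \<kappa>" using \<kappa> by (auto simp: \<eta>_def \<delta>'_def)
  have D: "compact D" by (rule triangulable_compact[OF tri])
  have "bounded (f ` D \<union> g ` D)"
    using compact_continuous_image[OF f D] compact_continuous_image[OF g D]
      by (simp add: compact_imp_bounded)
  then obtain B where B: "\<And>x. x \<in> D \<Longrightarrow> \<bar>f x\<bar> \<le> B" "\<And>x. x \<in> D \<Longrightarrow> \<bar>g x\<bar> \<le> B"
    by (auto simp: bounded_iff)
  \<comment> \<open>The distance from \<open>B\<close> to \<open>T\<close> exceeds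
    \<open>\<delta>'\<close>, so points at level \<open>T\<close> are matched only with points at
    level \<open>T\<close>. It also exceeds \<open>2 * (\<eta> + \<delta>')\<close>, so none of
    them, being born by \<open>B\<close>, can remain unmatched.\<close>
  define T where "T = B + 2 * (\<eta> + \<delta>') + 1"
  have T: "B < T" using \<eta> \<delta>(1) by (simp add: T_def)
  define h where "h = (\<lambda>\<tau> x. (1 - \<tau>) * f x + \<tau> * g x)"
  have h01: "h 0 = f" "h 1 = g" by (auto simp: h_def)
  have fs: "filtered_space D (h \<tau>) (-B) B T" if "0 \<le> \<tau>" "\<tau> \<le> 1" for \<tau>
  proof
    show "continuous_on D (h \<tau>)" unfolding h_def by (intro continuous_intros f g)
    fix x assume x: "x \<in> D"
    have "\<bar>h \<tau> x\<bar> \<le> (1 - \<tau>) * B + \<tau> * B"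
      unfolding h_def using that B[OF x]
      by (intro order_trans[OF abs_triangle_ineq] add_mono)
        (auto simp: abs_mult intro!: mult_left_mono)
    then have "\<bar>h \<tau> x\<bar> \<le> B" by (simp add: algebra_simps)
    then show "- B \<le> h \<tau> x \<and> h \<tau> x \<le> B" by (auto simp: abs_le_iff)
  qed (use tri T in auto)
  let ?r = "\<lambda>\<tau>. cut_rank F T D (h \<tau>) q"
  have "matched \<eta> \<delta>' (?r 0) (?r 1)"
  proof (rule matched_along_path[where lo = "-B" and hi = T])
    fix \<tau> :: real assume \<tau>: "0 \<le> \<tau>" "\<tau> \<le> 1"
    interpret filtered_space D "h \<tau>" q "-B" B T F by (rule fs[OF \<tau>])
    show "rect_nonneg (?r \<tau>)" by (rule nonneg_cr)
    show "- B \<le> s \<and> t \<le> T" if "s < t" "0 < corner_mult (?r \<tau>) s t" for s t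
      using corner_mult_cr_bounds[OF that] T by auto
  next
    fix \<sigma> \<tau> :: real assume st: "0 \<le> \<sigma>" "\<sigma> \<le> 1" "0 \<le> \<tau>" "\<tau> \<le> 1"
    show "interleaved (\<bar>\<sigma> - \<tau>\<bar> * \<delta>) (?r \<sigma>) (?r \<tau>)"
    proof (rule cut_rank_interleaved[OF tri])
      fix x assume x: "x \<in> D"
      have "h \<sigma> x - h \<tau> x = (\<tau> - \<sigma>) * (f x - g x)" by (simp add: h_def algebra_simps)
      then show "\<bar>h \<sigma> x - h \<tau> x\<bar> \<le> \<bar>\<sigma> - \<tau>\<bar> * \<delta>"
        using \<delta>(2)[OF x] by (simp add: abs_mult abs_minus_commute mult_left_mono)
    qed (use \<delta> f g in \<open>auto simp: h_def intro!: continuous_intros\<close>)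
  qed (use \<eta> \<delta> in auto)
  then obtain R where R: "R \<subseteq> corners (?r 0) \<times> corners (?r 1)" "single_valued R"
    "single_valued (R\<inverse>)"
    "\<And>p q. (p, q)\<in>R \<Longrightarrow> near \<delta>' p q" "\<And>p. p\<in>corners (?r 0) - Domain R \<Longrightarrow> persistence p \<le> 2 * (\<eta> + \<delta>')"
    "\<And>q. q\<in>corners (?r 1) - Range R \<Longrightarrow> persistence q \<le> 2 * (\<eta> + \<delta>')"
    unfolding matched_def by fast
  interpret f: filtered_space D "h 0" q "-B" B T F by (rule fs) auto
  interpret g: filtered_space D "h 1" q "-B" B T F by (rule fs) auto
  let ?E = "to_pdiag T"
  define R' where "R' = map_prod ?E ?E ` R"
  have finite_half: "(snd (fst (?E p)) - ereal (fst (fst (?E p)))) / 2 \<le> ereal (\<delta> + \<kappa>)"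
    if "s < t" "0 < corner_mult (?r \<tau>) s t" "p = ((s, t), i)" "s \<le> B" "persistence p \<le> 2 * (\<eta> + \<delta>')"
      for p s t i \<tau>
  proof -
    have "t \<noteq> T" using that(3-5) by (auto simp: persistence_def T_def)
    then show ?thesis using that(3,5) \<eta>(3) by (simp add: to_pdiag_def persistence_def)
  qed
  have "dmatch (?E ` corners (?r 0) \<union> diagonal) (?E ` corners (?r 1) \<union> diagonal) \<le> ereal (\<delta> + \<kappa>)"
  proof (rule dmatch_le[where R = R'])
    show "countable (?E ` corners (?r 0))" "countable (?E ` corners (?r 1))"
      using f.countable_corners g.countable_corners by auto
    show "?E ` corners (?r 0) \<inter> diagonal = {}" "?E ` corners (?r 1) \<inter> diagonal = {}"
      using to_pdiag_diagonal by blast+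
    show "R' \<subseteq> ?E ` corners (?r 0) \<times> ?E ` corners (?r 1)" using R(1) by (auto simp: R'_def)
    show "single_valued R'" "single_valued (R'\<inverse>)"
      unfolding R'_def converse_map_prod using R(2,3) single_valued_map_prod[OF inj_to_pdiag]
        by blast+
    show "(0::ereal) \<le> ereal (\<delta> + \<kappa>)" using \<delta> \<kappa> by simp
  next
    fix p q assume "(p, q) \<in> R'"
    then obtain a b where ab: "(a, b) \<in> R" "p = ?E a" "q = ?E b" by (auto simp: R'_def)
    obtain s t i s' t' j where st: "a = ((s, t), i)" "b = ((s', t'), j)" by (metis surj_pair)
    have "a \<in> corners (?r 0)" "b \<in> corners (?r 1)" using ab R(1) by auto
    then have "s < t" "0 < corner_mult (?r 0) s t" "s' < t'" "0 < corner_mult (?r 1) s' t'" using st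
      by (auto simp: corners_def)
    then have "t \<le> B \<or> t = T" "t' \<le> B \<or> t' = T"
      using f.corner_mult_cr_bounds(3) g.corner_mult_cr_bounds(3) by blast+
    moreover have n: "\<bar>s - s'\<bar> \<le> \<delta>'" "\<bar>t - t'\<bar> \<le> \<delta>'" using R(4)[OF ab(1)] st
      by (auto simp: near_def)
    moreover have "\<delta>' < T - B" using \<eta> \<delta> by (simp add: T_def)
    ultimately have "t = T \<longleftrightarrow> t' = T" by (auto simp: abs_le_iff)
    moreover have "\<delta>' \<le> \<delta> + \<kappa>" using \<eta> by simp
    ultimately show "pdelta (fst p) (fst q) \<le> ereal (\<delta> + \<kappa>)"
      using ab st n by (auto simp: pdelta_def to_pdiag_def ediff_abs_def min_le_iff_disj)
  next
    fix p assume "p \<in> ?E ` corners (?r 0) - Domain R'"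
    then obtain a where a: "p = ?E a" "a \<in> corners (?r 0)" "a \<notin> Domain R" by (force simp: R'_def)
    obtain s t i where st: "a = ((s, t), i)" by (metis surj_pair)
    have c: "s < t" "0 < corner_mult (?r 0) s t" using a(2) st by (auto simp: corners_def)
    show "(snd (fst p) - ereal (fst (fst p))) / 2 \<le> ereal (\<delta> + \<kappa>)"
      unfolding a(1) using finite_half[OF c st f.corner_mult_cr_bounds(2)[OF c]] R(5)[of a] a
        by simp
  next
    fix p assume "p \<in> ?E ` corners (?r 1) - Range R'"
    then obtain a where a: "p = ?E a" "a \<in> corners (?r 1)" "a \<notin> Range R" by (force simp: R'_def)
    obtain s t i where st: "a = ((s, t), i)" by (metis surj_pair)
    have c: "s < t" "0 < corner_mult (?r 1) s t" using a(2) st by (auto simp: corners_def)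
    show "(snd (fst p) - ereal (fst (fst p))) / 2 \<le> ereal (\<delta> + \<kappa>)"
      unfolding a(1) using finite_half[OF c st g.corner_mult_cr_bounds(2)[OF c]] R(6)[of a] a
        by simp
  qed
  then show "dmatch (pdiag F D f q) (pdiag F D g q) \<le> ereal \<delta> + ereal \<kappa>"
    using f.pdiag_eq g.pdiag_eq by (simp add: h01)
qed

section \<open>The multidimensional matching distance\<close>

lemma continuous_on_Fred:
  fixes f :: "'a::topological_space \<Rightarrow> real^'m"
  assumes "continuous_on D f" "\<And>i. 0 < l $ i"
  shows "continuous_on D (Fred f l b)"
proof -
  have "continuous_on D (\<lambda>x. Max ((\<lambda>i. (f x $ i - b $ i) / l $ i) ` S))" if "finite S" "S \<noteq> {}"
    for S
    using that
  proof (induction S rule: finite_ne_induct)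
    case (singleton i)
    then show ?case using assms(2)[of i] by (auto intro!: continuous_intros assms(1))
  next
    case (insert i S)
    have "continuous_on D (\<lambda>x. (f x $ i - b $ i) / l $ i)"
      using assms(2)[of i] by (auto intro!: continuous_intros assms(1))
    with insert show ?case by (auto intro!: continuous_on_max)
  qed
  from this[of UNIV] show ?thesis by (simp add: Fred_def[abs_def])
qed

lemma Fred_le:
  assumes "\<And>i. 0 < l $ i" "\<And>i. \<bar>f x $ i - g x $ i\<bar> \<le> C"
  shows "Fred f l b x \<le> Fred g l b x + C / Min (range (\<lambda>i. l $ i))"
proof -
  let ?m = "Min (range (\<lambda>i. l $ i))"
  have m: "0 < ?m" using assms(1) by auto
  have "0 \<le> C" using assms(2)[of undefined] by (meson abs_ge_zero order_trans)
  have "(f x $ i - b $ i) / l $ i \<le> Fred g l b x + C / ?m" for i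
  proof -
    have "(f x $ i - b $ i) / l $ i \<le> (g x $ i - b $ i + C) / l $ i"
      using assms(1)[of i] assms(2)[of i] by (intro divide_right_mono) auto
    also have "\<dots> = (g x $ i - b $ i) / l $ i + C / l $ i" by (simp add: add_divide_distrib)
    also have "C / l $ i \<le> C / ?m" using m \<open>0 \<le> C\<close> assms(1)[of i] by (intro divide_left_mono) auto
    also have "(g x $ i - b $ i) / l $ i \<le> Fred g l b x" unfolding Fred_def by (rule Max_ge) auto
    finally show ?thesis by simp
  qed
  then show ?thesis by (subst Fred_def) (auto intro!: Max.boundedI)
qed

lemma Fred_diff_le:
  assumes "\<And>i. 0 < l $ i" "\<And>i. \<bar>f x $ i - g x $ i\<bar> \<le> C"
  shows "\<bar>Fred f l b x - Fred g l b x\<bar> \<le> C / Min (range (\<lambda>i. l $ i))"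
proof -
  have "\<bar>g x $ i - f x $ i\<bar> \<le> C" for i using assms(2)[of i] by (simp add: abs_minus_commute)
  then show ?thesis
    using Fred_le[of l f x g C b, OF assms] Fred_le[of l g x f C b, OF assms(1)]
      by (simp add: abs_le_iff)
qed

text \<open>The weight \<open>Min (range (\<lambda>i. l $ i))\<close> in \<open>Dmatch\<close>
  cancels the Lipschitz constant of the reduction along \<open>(l, b)\<close>.\<close>

lemma Dmatch_le:
  fixes D :: "'a::euclidean_space set" and f g :: "'a \<Rightarrow> real^'m"
  assumes tri: "triangulable D" and f: "continuous_on D f" and g: "continuous_on D g"
    and C: "0 \<le> C" "\<And>x i. x \<in> D \<Longrightarrow> \<bar>f x $ i - g x $ i\<bar> \<le> C"
  shows "Dmatch (F :: 'f::field itself) D f g q \<le> ereal C"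
  unfolding Dmatch_def
proof (rule SUP_least)
  fix lb :: "(real^'m) \<times> (real^'m)" assume lb: "lb \<in> Adm"
  define l b where "l = fst lb" and "b = snd lb"
  have l: "0 < l $ i" for i using lb by (auto simp: Adm_def l_def)
  define m where "m = Min (range (\<lambda>i. l $ i))"
  have m: "0 < m" using l by (auto simp: m_def)
  have "dmatch (pdiag F D (Fred f l b) q) (pdiag F D (Fred g l b) q) \<le> ereal (C / m)"
  proof (rule dmatch_pdiag_le[OF tri continuous_on_Fred[OF f l] continuous_on_Fred[OF g l]])
    show "0 \<le> C / m" by (rule divide_nonneg_pos[OF C(1) m])
    show "\<bar>Fred f l b x - Fred g l b x\<bar> \<le> C / m" if "x \<in> D" for x
      unfolding m_def by (rule Fred_diff_le) (use l C(2)[OF that] in auto)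
  qed
  then have "ereal m * dmatch (pdiag F D (Fred f l b) q) (pdiag F D (Fred g l b) q) \<le>
    ereal m * ereal (C / m)"
    using m by (intro ereal_mult_left_mono) auto
  also have "\<dots> = ereal C" using m by simp
  finally show "ereal (Min (range (\<lambda>i. fst lb $ i))) * dmatch
    (pdiag F D (Fred f (fst lb) (snd lb)) q)
      (pdiag F D (Fred g (fst lb) (snd lb)) q) \<le> ereal C" by (simp add: l_def b_def m_def)
qed

section \<open>Continuity and stability of the local density\<close>

lemma lam_eq_measure:
  fixes K :: "(real^'n) set"
  assumes "compact K"
  shows "lam e K x = measure lebesgue (K \<inter> cball x e) / measure lebesgue (cball (0::real^'n) e)"
proof -
  have "K \<inter> cball x e \<in> lmeasurable" using assms by (intro lmeasurable_compact compact_Int) auto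
  then show ?thesis unfolding lam_def
    by (simp add: Equivalence_Lebesgue_Henstock_Integration.integral_indicator)
qed

text \<open>Set and centre vary independently: one set with two centres gives continuity, two sets
  with one centre give stability.\<close>

lemma measure_Int_cball_le:
  fixes K1 K2 :: "'a::euclidean_space set"
  assumes "compact K1" "compact K2"
  shows "measure lebesgue (K1 \<inter> cball x e) \<le> measure lebesgue (K2 \<inter> cball y e)
    + measure lebesgue ((K1 \<inter> cball x e) - (K2 \<inter> cball y e))"
proof -
  have K: "K1 \<inter> cball x e \<in> lmeasurable" "K2 \<inter> cball y e \<in> lmeasurable"
    using assms by (auto intro!: lmeasurable_compact compact_Int)
  have "measure lebesgue (K1 \<inter> cball x e) \<le>
    measure lebesgue ((K2 \<inter> cball y e) \<union> ((K1 \<inter> cball x e) - (K2 \<inter> cball y e)))"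
    using K by (intro measure_mono_fmeasurable)
      (auto intro!: fmeasurable.Un fmeasurable.Diff dest: fmeasurableD)
  also have "\<dots> \<le> measure lebesgue (K2 \<inter> cball y e)
    + measure lebesgue ((K1 \<inter> cball x e) - (K2 \<inter> cball y e))"
    using K by (intro measure_Un_le) (auto dest: fmeasurableD)
  finally show ?thesis .
qed

text \<open>What the ball around \<open>x\<close> contains beyond the ball around \<open>y\<close>
  lies in the shell of radii \<open>e\<close> and \<open>e + dist x y\<close> around
  \<open>y\<close>. Its volume is an explicit polynomial in \<open>dist x y\<close> that vanishes at
  0.\<close>

lemma measure_Int_cball_continuous:
  fixes K :: "'a::euclidean_space set"
  assumes "compact K" "0 < e"
  shows "continuous_on UNIV (\<lambda>x. measure lebesgue (K \<inter> cball x e))"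
proof -
  let ?m = "\<lambda>x. measure lebesgue (K \<inter> cball x e)"
  let ?c = "\<lambda>t. unit_ball_vol (real DIM('a)) * (e + t) ^ DIM('a)"
  have le: "?m x \<le> ?m y + (?c (dist x y) - ?c 0)" for x y
  proof -
    have sub: "cball x e \<subseteq> cball y (e + dist x y)"
    proof
      fix z assume "z \<in> cball x e"
      then show "z \<in> cball y (e + dist x y)" using dist_triangle[of y z x]
        by (simp add: dist_commute)
    qed
    have "measure lebesgue ((K \<inter> cball x e) - (K \<inter> cball y e)) \<le>
      measure lebesgue (cball y (e + dist x y) - cball y e)"
      using sub assms(1)
      by (intro measure_mono_fmeasurable)
        (auto intro!: fmeasurable.Diff sets.Diff sets.Int dest: lmeasurable_compact fmeasurableD)
    also have "\<dots> = measure lebesgue (cball y (e + dist x y)) - measure lebesgue (cball y e)"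
      by (rule measurable_measure_Diff) (auto simp: subset_cball dest: fmeasurableD)
    also have "\<dots> = ?c (dist x y) - ?c 0" using assms(2) by (simp add: content_cball)
    finally show ?thesis using measure_Int_cball_le[OF assms(1) assms(1), of x e y] by simp
  qed
  have bound: "\<bar>?m x - ?m y\<bar> \<le> ?c (dist x y) - ?c 0" for x y
    using le[of x y] le[of y x] by (simp add: dist_commute abs_le_iff)
  show ?thesis unfolding continuous_on_eq_continuous_within
  proof
    fix x :: 'a assume "x \<in> UNIV"
    have "((\<lambda>y. ?c (dist y x) - ?c 0) \<longlongrightarrow> ?c (dist x x) - ?c 0) (at x)" by (intro tendsto_intros)
    then have "((\<lambda>y. ?c (dist y x) - ?c 0) \<longlongrightarrow> 0) (at x)" by simp
    then have "((\<lambda>y. ?m y - ?m x) \<longlongrightarrow> 0) (at x)"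
      by (rule Lim_null_comparison[rotated]) (use bound in auto)
    then show "continuous (at x within UNIV) ?m" by (simp add: continuous_within LIM_zero_iff)
  qed
qed

lemma continuous_on_lam: "compact (K :: (real^'n) set) \<Longrightarrow> 0 < e \<Longrightarrow> continuous_on D (lam e K)"
proof -
  assume *: "compact K" "0 < e"
  have "lam e K = (\<lambda>x. measure lebesgue (K \<inter> cball x e) / measure lebesgue (cball (0::real^'n) e))"
    by (rule ext) (rule lam_eq_measure[OF *(1)])
  moreover have "measure lebesgue (cball (0::real^'n) e) \<noteq> 0"
    using content_cball_pos[OF *(2), of "0::real^'n"] by simp
  ultimately show ?thesis
    using continuous_on_subset[OF measure_Int_cball_continuous[OF *], of D]
      by (simp add: continuous_on_divide)
qed

lemma lam_diff_le:
  fixes K1 K2 :: "(real^'n) set"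
  assumes "compact K1" "compact K2" "0 < e"
  shows "\<bar>lam e K1 x - lam e K2 x\<bar> \<le> dtri K1 K2 / measure lebesgue (cball (0::real^'n) e)"
proof -
  let ?T = "(K1 \<union> K2) - (K1 \<inter> K2)"
  have K: "K1 \<in> lmeasurable" "K2 \<in> lmeasurable" using assms by (auto intro: lmeasurable_compact)
  then have T: "?T \<in> lmeasurable"
    by (intro fmeasurable.Diff fmeasurable.Un) (auto dest: fmeasurableD)
  have "measure lebesgue ((K1 \<inter> cball x e) - (K2 \<inter> cball x e)) \<le> measure lebesgue ?T"
    "measure lebesgue ((K2 \<inter> cball x e) - (K1 \<inter> cball x e)) \<le> measure lebesgue ?T"
    using K T by (auto intro!: measure_mono_fmeasurable sets.Diff sets.Int dest: fmeasurableD)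
  then have "\<bar>measure lebesgue (K1 \<inter> cball x e) - measure lebesgue (K2 \<inter> cball x e)\<bar> \<le>
    measure lebesgue ?T"
    using measure_Int_cball_le[OF assms(1,2), of x e x] measure_Int_cball_le[OF assms(2,1), of x e
      x]
    by (simp add: abs_le_iff)
  then show ?thesis using content_cball_pos[OF assms(3), of "0::real^'n"]
    by (simp add: lam_eq_measure[OF assms(1)] lam_eq_measure[OF assms(2)] dtri_def divide_right_mono
      flip: diff_divide_distrib)
qed

text \<open>Compactness bounds the set under the real \<open>Sup\<close> in \<open>supnorm\<close>;
  only then is it an upper bound.\<close>

lemma component_diff_le_supnorm:
  assumes "compact D" "continuous_on D f" "continuous_on D g" "x \<in> D"
  shows "\<bar>f x $ i - g x $ i\<bar> \<le> supnorm D f g"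
proof -
  let ?n = "\<lambda>x. Max (range (\<lambda>i. \<bar>f x $ i - g x $ i\<bar>))"
  have "bounded ((\<lambda>x. f x - g x) ` D)"
    by (intro compact_imp_bounded compact_continuous_image continuous_intros assms)
  then obtain B where B: "\<And>x. x \<in> D \<Longrightarrow> norm (f x - g x) \<le> B" by (auto simp: bounded_iff)
  have "bdd_above (?n ` D)"
  proof (rule bdd_aboveI2)
    fix x assume "x \<in> D"
    have "\<bar>f x $ i - g x $ i\<bar> \<le> B" for i
      using component_le_norm_cart[of "f x - g x" i] B[OF \<open>x \<in> D\<close>] by simp
    then show "?n x \<le> B" by (auto intro!: Max.boundedI)
  qed
  have "\<bar>f x $ i - g x $ i\<bar> \<le> ?n x" by (rule Max_ge) auto
  also have "\<dots> \<le> supnorm D f g" unfolding supnorm_def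
    by (rule cSup_upper) (use assms(4) \<open>bdd_above (?n ` D)\<close> in auto)
  finally show ?thesis .
qed

lemma continuous_on_Psi:
  assumes "compact K" "0 < e" "continuous_on D \<phi>"
  shows "continuous_on D (Psi e K \<phi>)"
  unfolding Psi_def[abs_def]
proof (rule continuous_on_vec_lambda)
  fix i show "continuous_on D (\<lambda>x. case i of None \<Rightarrow> - lam e K x | Some j \<Rightarrow> \<phi> x $ j)"
    by (cases i) (auto intro!: continuous_intros continuous_on_lam assms)
qed

theorem theorem3p1:
  fixes D K1 K2 :: "(real^'n) set"
    and \<phi>1 \<phi>2 :: "real^'n \<Rightarrow> real^'k"
    and \<epsilon> :: real and q :: int
  assumes "triangulable D"
    and "K1 \<noteq> {}" and "K2 \<noteq> {}"
    and "K1 \<subseteq> D" and "K2 \<subseteq> D"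
    and "closedin (top_of_set D) K1" and "closedin (top_of_set D) K2"
    and "continuous_on D \<phi>1" and "continuous_on D \<phi>2"
    and "\<epsilon> > 0"
  shows "Dmatch TYPE('f::field) D (Psi \<epsilon> K1 \<phi>1) (Psi \<epsilon> K2 \<phi>2) q
           \<le> ereal (max (dtri K1 K2 / measure lebesgue (cball (0::real^'n) \<epsilon>)) (supnorm D \<phi>1 \<phi>2))"
proof (rule Dmatch_le)
  have D: "compact D" by (rule triangulable_compact[OF assms(1)])
  have K: "compact K1" "compact K2" using closedin_compact[OF D] assms(6,7) by auto
  show "continuous_on D (Psi \<epsilon> K1 \<phi>1)" "continuous_on D (Psi \<epsilon> K2 \<phi>2)"
    using K assms by (auto intro: continuous_on_Psi)
  show "0 \<le> max (dtri K1 K2 / measure lebesgue (cball (0::real^'n) \<epsilon>)) (supnorm D \<phi>1 \<phi>2)"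
    by (simp add: dtri_def le_max_iff_disj)
  show "\<bar>Psi \<epsilon> K1 \<phi>1 x $ i - Psi \<epsilon> K2 \<phi>2 x $ i\<bar>
      \<le> max (dtri K1 K2 / measure lebesgue (cball (0::real^'n) \<epsilon>)) (supnorm D \<phi>1 \<phi>2)" if "x \<in>
        D" for x i
  proof (cases i)
    case None
    then show ?thesis using lam_diff_le[OF K assms(10), of x]
      by (simp add: Psi_def abs_minus_commute le_max_iff_disj)
  next
    case (Some j)
    then show ?thesis using component_diff_le_supnorm[OF D assms(8,9) that, of j]
      by (simp add: Psi_def le_max_iff_disj)
  qed
qed (rule assms(1))

end
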